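(* Assume Lang's conjecture in the following form: there is an absolute constant $c_L>0$ such that for every elliptic curve $E/\mathbb{Q}$ and every non-torsion point $P\in E(\mathbb{Q})$, $$\hat{h}(P)\ \ge\ c_L\max\{h(j_E),h(\Delta_E)\}.$$ Then there exist absolute constants $A>1$ and $C>0$ such that for every elliptic curve $E/\mathbb{Q}$ of Mordell–Weil rank $r$ and every sequence $\{P_1,\ldots,P_N\}\subseteq E(\mathbb{Q})$ of rational points in $x$-arithmetic progression, one has $N\le C\,A^r$. Equivalently, $N_x(E)\le C A^r$ for every $E/\mathbb{Q}$ of rank $r$.
   Context: For an elliptic curve $E/\mathbb{Q}$, $j_E$ is its $j$-invariant and $\Delta_E$ its minimal discriminant; $h$ denotes the absolute logarithmic Weil height on $\overline{\mathbb{Q}}$ (so $h(\Delta_E)=\log|\Delta_E|$). For a Weierstrass model of $E$ and $P\in E(\overline{\mathbb{Q}})$, $h(P)=h(x(P))$ and the canonical height is $\hat{h}(P)=\lim_{n\to\infty}h(2^nP)/4^n$ (not normalized by a factor $1/2$). A finite sequence $\{P_1,\dots,P_N\}\subseteq E(\mathbb{Q})$ is in $x$-arithmetic progression if the $x$-coordinates $x(P_1),\dots,x(P_N)$ are $N$ distinct rational numbers forming an arithmetic progression; this notion does not depend on the choice of Weierstrass equation. $N_x(E)$ denotes the maximum length of such a sequence on $E$. *)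

theory Defs
  imports Complex_Main
begin

text \<open>A (general) Weierstrass equation
  y^2 + a1 x y + a3 y = x^3 + a2 x^2 + a4 x + a6 with rational coefficients.\<close>

record wcurve =
  a1 :: rat
  a2 :: rat
  a3 :: rat
  a4 :: rat
  a6 :: rat

definition b2 :: "wcurve \<Rightarrow> rat" where "b2 E = a1 E ^ 2 + 4 * a2 E"
definition b4 :: "wcurve \<Rightarrow> rat" where "b4 E = 2 * a4 E + a1 E * a3 E"
definition b6 :: "wcurve \<Rightarrow> rat" where "b6 E = a3 E ^ 2 + 4 * a6 E"
definition b8 :: "wcurve \<Rightarrow> rat" where
  "b8 E = a1 E ^ 2 * a6 E + 4 * a2 E * a6 E - a1 E * a3 E * a4 E
          + a2 E * a3 E ^ 2 - a4 E ^ 2"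
definition c4 :: "wcurve \<Rightarrow> rat" where "c4 E = b2 E ^ 2 - 24 * b4 E"

definition disc :: "wcurve \<Rightarrow> rat" where
  "disc E = - (b2 E ^ 2 * b8 E) - 8 * b4 E ^ 3 - 27 * b6 E ^ 2
            + 9 * b2 E * b4 E * b6 E"

definition elliptic :: "wcurve \<Rightarrow> bool" where "elliptic E \<longleftrightarrow> disc E \<noteq> 0"

definition j_inv :: "wcurve \<Rightarrow> rat" where "j_inv E = c4 E ^ 3 / disc E"

text \<open>Admissible change of variables x = u^2 x' + r, y = u^3 y' + u^2 s x' + t
  (Silverman, Table III.3.1): E' is the resulting equation.\<close>
definition wiso :: "wcurve \<Rightarrow> wcurve \<Rightarrow> bool" where
  "wiso E E' \<longleftrightarrow> (\<exists>u r s t. u \<noteq> 0 \<and>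
     u * a1 E' = a1 E + 2 * s \<and>
     u ^ 2 * a2 E' = a2 E - s * a1 E + 3 * r - s ^ 2 \<and>
     u ^ 3 * a3 E' = a3 E + r * a1 E + 2 * t \<and>
     u ^ 4 * a4 E' = a4 E - s * a3 E + 2 * r * a2 E - (t + r * s) * a1 E
                      + 3 * r ^ 2 - 2 * s * t \<and>
     u ^ 6 * a6 E' = a6 E + r * a4 E + r ^ 2 * a2 E + r ^ 3 - t * a3 E
                      - t ^ 2 - r * t * a1 E)"

definition integral :: "wcurve \<Rightarrow> bool" where
  "integral E \<longleftrightarrow> a1 E \<in> \<int> \<and> a2 E \<in> \<int> \<and> a3 E \<in> \<int> \<and> a4 E \<in> \<int> \<and> a6 E \<in> \<int>"

definition min_disc_abs :: "wcurve \<Rightarrow> nat" where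
  "min_disc_abs E = (LEAST n. \<exists>E'. wiso E E' \<and> integral E' \<and>
                        of_nat n = \<bar>disc E'\<bar>)"

datatype point = Inf | Aff rat rat

fun on_curve :: "wcurve \<Rightarrow> point \<Rightarrow> bool" where
  "on_curve E Inf = True"
| "on_curve E (Aff x y) \<longleftrightarrow>
     y ^ 2 + a1 E * x * y + a3 E * y = x ^ 3 + a2 E * x ^ 2 + a4 E * x + a6 E"

fun pneg :: "wcurve \<Rightarrow> point \<Rightarrow> point" where
  "pneg E Inf = Inf"
| "pneg E (Aff x y) = Aff x (- y - a1 E * x - a3 E)"

text \<open>Addition law (Silverman, Algorithm III.2.3).\<close>
fun padd :: "wcurve \<Rightarrow> point \<Rightarrow> point \<Rightarrow> point" where
  "padd E Inf Q = Q"
| "padd E (Aff x1 y1) Inf = Aff x1 y1"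
| "padd E (Aff x1 y1) (Aff x2 y2) =
     (if x1 = x2 \<and> y1 + y2 + a1 E * x2 + a3 E = 0 then Inf
      else
        (let lam = (if x1 \<noteq> x2 then (y2 - y1) / (x2 - x1)
                    else (3 * x1 ^ 2 + 2 * a2 E * x1 + a4 E - a1 E * y1)
                           / (2 * y1 + a1 E * x1 + a3 E));
             nu = (if x1 \<noteq> x2 then (y1 * x2 - y2 * x1) / (x2 - x1)
                   else (- (x1 ^ 3) + a4 E * x1 + 2 * a6 E - a3 E * y1)
                           / (2 * y1 + a1 E * x1 + a3 E));
             x3 = lam ^ 2 + a1 E * lam - a2 E - x1 - x2;
             y3 = - (lam + a1 E) * x3 - nu - a3 E
         in Aff x3 y3))"

primrec pmult :: "wcurve \<Rightarrow> nat \<Rightarrow> point \<Rightarrow> point" where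
  "pmult E 0 P = Inf"
| "pmult E (Suc n) P = padd E P (pmult E n P)"

definition zmult :: "wcurve \<Rightarrow> int \<Rightarrow> point \<Rightarrow> point" where
  "zmult E k P = (if k \<ge> 0 then pmult E (nat k) P else pneg E (pmult E (nat (- k)) P))"

definition torsion :: "wcurve \<Rightarrow> point \<Rightarrow> bool" where
  "torsion E P \<longleftrightarrow> (\<exists>n>0. pmult E n P = Inf)"

definition lin_indep :: "wcurve \<Rightarrow> point list \<Rightarrow> bool" where
  "lin_indep E Ps \<longleftrightarrow> (\<forall>P\<in>set Ps. on_curve E P) \<and>
     (\<forall>c :: nat \<Rightarrow> int.
        foldr (\<lambda>i acc. padd E (zmult E (c i) (Ps ! i)) acc) [0..<length Ps] Inf = Inf
        \<longrightarrow> (\<forall>i<length Ps. c i = 0))"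

definition mw_rank :: "wcurve \<Rightarrow> nat \<Rightarrow> bool" where
  "mw_rank E r \<longleftrightarrow> (\<exists>Ps. length Ps = r \<and> lin_indep E Ps) \<and>
                    \<not> (\<exists>Ps. length Ps = Suc r \<and> lin_indep E Ps)"

definition hQ :: "rat \<Rightarrow> real" where
  "hQ q = (case quotient_of q of (a, b) \<Rightarrow> ln (real_of_int (max \<bar>a\<bar> \<bar>b\<bar>)))"

fun hpt :: "point \<Rightarrow> real" where
  "hpt Inf = 0"
| "hpt (Aff x y) = hQ x"

text \<open>Canonical height (not normalised by 1/2).\<close>
definition canon_height :: "wcurve \<Rightarrow> point \<Rightarrow> real" where
  "canon_height E P = lim (\<lambda>n. hpt (pmult E (2 ^ n) P) / 4 ^ n)"

definition x_arith_prog :: "wcurve \<Rightarrow> (rat \<times> rat) list \<Rightarrow> bool" where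
  "x_arith_prog E ps \<longleftrightarrow> (\<forall>(x, y)\<in>set ps. on_curve E (Aff x y)) \<and>
     distinct (map fst ps) \<and>
     (\<exists>a d. \<forall>i<length ps. fst (ps ! i) = a + of_nat i * d)"

end

theory Submission
  imports "HOL-Algebra.FiniteProduct" "HOL-Computational_Algebra.Polynomial" Defs
begin

text \<open>
  The curve is replaced by the short form \<open>y\<^sup>2 = x\<^sup>3 + a x + b\<close> of a minimal model, so that the
  size of \<open>a\<close> and \<open>b\<close> is bounded in terms of the quantity in Lang's conjecture.
  Among any three points \<open>P\<^sub>i\<close> of the progression some difference has large canonical height:
  if the differences \<open>R\<close> of three points are small, the linear relation between
  \<open>x(P)\<close>, \<open>x(P + R)\<close>, \<open>x(P + R')\<close> is a polynomial equation for \<open>x(P)\<close> with small coefficients, so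
  that all the \<open>P\<^sub>i\<close> have small height. When the heights of the points dominate
  \<open>a\<close> and \<open>b\<close> this is a contradiction; otherwise Lang's conjecture applies to the differences,
  provided that they are not torsion. For three points whose indices agree modulo 32, two of them
  are 2-adically so close up to sign, and with the same sign, that their difference lies in a
  torsion-free neighbourhood of the origin; this replaces Mazur's theorem.
  A packing argument in the Mordell--Weil group then bounds the number of points exponentially
  in the rank. It needs no volumes: the ball of radius \<open>R\<close> is covered by its classes modulo
  \<open>2\<^sup>k\<close>, at most \<open>2\<^bsup>rk\<^esup>\<close> in number up to torsion, each of which is a scaled copy of a subset of a
  smaller ball.
\<close>

section \<open>The group law on a short Weierstrass curve\<close>

text \<open>The two radii in the packing must have a ratio bounded by an absolute constant, because
  \<open>k\<close> enters the exponent. Let \<open>H\<close> be the largest height in a set of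
  consecutive terms. If \<open>H\<close> dominates \<open>cst\<close>, the logarithmic size of
  \<open>a\<close> and \<open>b\<close>, both radii are multiples of \<open>H\<close> and the
  separation is unconditional; otherwise both are multiples of the quantity \<open>h\<close> of
  Lang's conjecture, because \<open>cst\<close> is at most \<open>h\<close> plus a constant. A
  progression has two unknown parameters, so three terms are the fewest with a linear relation
  independent of them. Its coefficients are differences of indices and enter the height bounds as
  multiples of \<open>ln L\<close>, where \<open>L\<close> is the length of the interval of indices.
  Heights must therefore exceed a multiple of \<open>ln L\<close>; as few rationals have small
  height, a progression whose length is a suitable power of \<open>L\<close> contains an interval of
  length \<open>L\<close> on which they do. With \<open>L\<close> proportional to
  \<open>2 ^ (r * k)\<close> this gives a bound exponential in \<open>r\<close>.\<close>

definition short :: "rat \<Rightarrow> rat \<Rightarrow> wcurve" where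
  "short a b = \<lparr>a1 = 0, a2 = 0, a3 = 0, a4 = a, a6 = b\<rparr>"

lemma short_simps [simp]:
  "a1 (short a b) = 0" "a2 (short a b) = 0" "a3 (short a b) = 0"
  "a4 (short a b) = a" "a6 (short a b) = b"
  by (simp_all add: short_def)

text \<open>The first equation determines the slope of a chord and the second one that of a tangent;
  both hold in either case, so that chords and tangents need not be distinguished.\<close>
definition slope :: "rat \<Rightarrow> rat \<Rightarrow> rat \<Rightarrow> rat \<Rightarrow> rat \<Rightarrow> rat \<Rightarrow> bool" where
  "slope a x y x' y' l \<longleftrightarrow>
     y - y' = l * (x - x') \<and> l * (y + y') = x ^ 2 + x * x' + x' ^ 2 + a"

lemma slope_sym: "slope a x y x' y' l \<Longrightarrow> slope a x' y' x y l"
  unfolding slope_def by algebra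

lemma slope_exists:
  assumes "on_curve (short a b) (Aff x y)" "on_curve (short a b) (Aff x' y')"
    and "\<not> (x = x' \<and> y + y' = 0)"
  shows "\<exists>l. slope a x y x' y' l"
proof (cases "x = x'")
  case True
  then have "(y - y') * (y + y') = 0"
    using assms(1,2) by (simp add: algebra_simps power2_eq_square)
  with True assms(3) have "y = y'" by simp
  with True assms(3) show ?thesis
    unfolding slope_def by (intro exI[of _ "(3 * x^2 + a) / (2 * y)"]) (auto simp: field_simps power2_eq_square)
next
  case False
  then have nz: "x - x' \<noteq> 0" by simp
  have "(y - y') * (y + y') = (x - x') * (x ^ 2 + x * x' + x' ^ 2 + a)"
    using assms(1,2) unfolding on_curve.simps short_simps by algebra
  then have "(y - y') / (x - x') * (y + y') = x ^ 2 + x * x' + x' ^ 2 + a"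
    using nz by (simp add: field_simps)
  then show ?thesis unfolding slope_def
    using nz by (intro exI[of _ "(y - y') / (x - x')"]) simp
qed

text \<open>In both branches of \<open>padd\<close> the intercept \<open>nu\<close> equals
  \<open>y - l * x\<close>; for a tangent this uses the curve equation. One formula in terms of the
  slope then covers both branches.\<close>

lemma padd_short_slope:
  assumes on: "on_curve (short a b) (Aff x y)" "on_curve (short a b) (Aff x' y')"
    and sl: "slope a x y x' y' l" and ne: "\<not> (x = x' \<and> y + y' = 0)"
  shows "padd (short a b) (Aff x y) (Aff x' y') =
           Aff (l ^ 2 - x - x') (l * (x - (l ^ 2 - x - x')) - y)"
proof (cases "x = x'")
  case True
  have "(y - y') * (y + y') = 0"
    using on True by (simp add: algebra_simps power2_eq_square)
  with True ne have y: "y = y'" "y' \<noteq> 0" by auto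
  then have l: "l = (3 * x' ^ 2 + a) / (2 * y')"
    using sl True unfolding slope_def by (auto simp: field_simps power2_eq_square)
  have "y' ^ 2 = x' ^ 3 + a * x' + b" using on by simp
  then have nu: "(- (x' ^ 3) + a * x' + 2 * b) / (2 * y') = y' - l * x'"
    using y unfolding l by (simp add: field_simps power2_eq_square power3_eq_cube)
  show ?thesis
    using True y nu l[symmetric] by (simp add: Let_def algebra_simps)
next
  case False
  then have nz: "x' - x \<noteq> 0" by simp
  have "y - y' = l * (x - x')" using sl unfolding slope_def by simp
  then have e: "y' = y + l * (x' - x)" by algebra
  then have l: "(y' - y) / (x' - x) = l" using nz by simp
  have nu: "(y * x' - y' * x) / (x' - x) = y - l * x"
    using nz unfolding e by (simp add: field_simps)
  show ?thesis
    using False unfolding padd.simps short_simps Let_def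
    by (simp add: l nu) (simp add: algebra_simps)
qed

lemma padd_short_opp:
  "x = x' \<Longrightarrow> y + y' = 0 \<Longrightarrow> padd (short a b) (Aff x y) (Aff x' y') = Inf"
  by simp

lemma padd_short_eq_Inf:
  "padd (short a b) P Q = Inf \<longleftrightarrow>
     P = Inf \<and> Q = Inf \<or> (\<exists>x y y'. P = Aff x y \<and> Q = Aff x y' \<and> y + y' = 0)"
  by (cases P; cases Q) (auto simp: Let_def)

lemma on_curve_slope:
  assumes "on_curve (short a b) (Aff x y)" "on_curve (short a b) (Aff x' y')"
    and "slope a x y x' y' l"
  shows "on_curve (short a b) (Aff (l ^ 2 - x - x') (l * (x - (l ^ 2 - x - x')) - y))"
  using assms unfolding slope_def on_curve.simps short_simps by algebra

lemma padd_Inf_right [simp]: "padd E P Inf = P"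
  by (cases P) auto

lemma padd_short_cases:
  assumes "on_curve (short a b) P" "on_curve (short a b) Q"
  obtains "P = Inf" | "Q = Inf"
  | x y y' where "P = Aff x y" "Q = Aff x y'" "y + y' = 0" "padd (short a b) P Q = Inf"
  | x y x' y' l where "P = Aff x y" "Q = Aff x' y'" "\<not> (x = x' \<and> y + y' = 0)"
      "slope a x y x' y' l"
      "padd (short a b) P Q = Aff (l ^ 2 - x - x') (l * (x - (l ^ 2 - x - x')) - y)"
proof (cases P)
  case (Aff x y)
  note P = this
  show thesis
  proof (cases Q)
    case (Aff x' y')
    show thesis
    proof (cases "x = x' \<and> y + y' = 0")
      case True
      then show thesis using that(3) P Aff padd_short_opp by blast
    next
      case False
      obtain l where "slope a x y x' y' l"
        using slope_exists False assms P Aff by blast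
      then show thesis using that(4) P Aff False padd_short_slope assms by blast
    qed
  qed (use that in auto)
qed (use that in auto)

lemma on_curve_padd_short:
  assumes "on_curve (short a b) P" "on_curve (short a b) Q"
  shows "on_curve (short a b) (padd (short a b) P Q)"
  using assms
proof (cases rule: padd_short_cases[OF assms])
  case (4 x y x' y' l)
  then show ?thesis using on_curve_slope assms by metis
qed auto

lemma on_curve_pneg_short:
  "on_curve (short a b) P \<Longrightarrow> on_curve (short a b) (pneg (short a b) P)"
  by (cases P) auto

lemma padd_short_comm:
  assumes "on_curve (short a b) P" "on_curve (short a b) Q"
  shows "padd (short a b) P Q = padd (short a b) Q P"
  using assms
proof (cases rule: padd_short_cases[OF assms])
  case (4 x y x' y' l)
  have ne: "\<not> (x' = x \<and> y' + y = 0)" using 4 by auto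
  have "padd (short a b) Q P = Aff (l ^ 2 - x' - x) (l * (x' - (l ^ 2 - x' - x)) - y')"
    using padd_short_slope[OF _ _ slope_sym[OF 4(4)] ne, of b] assms 4 by simp
  moreover have "l * (x' - (l ^ 2 - x' - x)) - y' = l * (x - (l ^ 2 - x - x')) - y"
    using 4(4) unfolding slope_def by algebra
  moreover have "l ^ 2 - x' - x = l ^ 2 - x - x'" by simp
  ultimately show ?thesis unfolding 4(5) by metis
qed auto

lemma padd_pneg_short: "padd (short a b) P (pneg (short a b) P) = Inf"
  by (cases P) auto

lemma pneg_padd_short:
  assumes "on_curve (short a b) P" "on_curve (short a b) Q"
  shows "pneg (short a b) (padd (short a b) P Q) =
           padd (short a b) (pneg (short a b) P) (pneg (short a b) Q)"
proof (cases rule: padd_short_cases[OF assms])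
  case 3
  then show ?thesis by auto
next
  case (4 x y x' y' l)
  have "slope a x (-y) x' (-y') (-l)" using 4(4) unfolding slope_def by algebra
  moreover have "\<not> (x = x' \<and> (-y) + (-y') = 0)" using 4(3) by auto
  ultimately have "padd (short a b) (Aff x (-y)) (Aff x' (-y')) =
       Aff ((-l) ^ 2 - x - x') ((-l) * (x - ((-l) ^ 2 - x - x')) - (-y))"
    using padd_short_slope[of a b x "-y" x' "-y'"] assms 4(1,2) by simp
  then show ?thesis using 4 by simp
qed auto

lemma discriminant_short: "disc (short a b) = - 16 * (4 * a ^ 3 + 27 * b ^ 2)"
  unfolding disc_def b2_def b4_def b6_def b8_def by (simp add: power_mult_distrib)

lemma no_singular_point:
  assumes "elliptic (short a b)" "0 = x ^ 3 + a * x + b" "3 * x ^ 2 + a = 0"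
  shows False
proof -
  have "4 * a ^ 3 + 27 * b ^ 2 = 0" using assms(2,3) by algebra
  then show False using assms(1) unfolding elliptic_def discriminant_short by simp
qed

text \<open>Equality with \<open>Q\<close> affine would force \<open>y = 0\<close> and
  \<open>3 * x ^ 2 + a = 0\<close>, so \<open>P\<close> would be a singular point. This is where
  nonsingularity enters the group law.\<close>

lemma padd_short_eq_left:
  assumes E: "elliptic (short a b)" and on: "on_curve (short a b) P" "on_curve (short a b) Q"
    and eq: "padd (short a b) P Q = P" "P \<noteq> Inf"
  shows "Q = Inf"
proof (cases rule: padd_short_cases[OF on])
  case (4 x y x' y' l)
  have e: "l ^ 2 - x - x' = x" "l * (x - (l ^ 2 - x - x')) - y = y" using eq 4 by auto
  have y: "y = 0" using e(2) unfolding e(1) by simp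
  have "x ^ 3 + a * x + b = 0" using on 4 y by simp
  moreover have "3 * x ^ 2 + a = 0" using 4(4) e y unfolding slope_def by algebra
  ultimately show ?thesis using no_singular_point[OF E] by metis
qed (use eq in auto)

text \<open>Reflection in the x-axis takes the line through \<open>P\<close> and \<open>Q\<close> to
  one through \<open>-P\<close> and \<open>P + Q\<close> of slope \<open>-l\<close>, whose third
  intersection is \<open>-Q\<close>.\<close>

lemma padd_short_cancel:
  assumes E: "elliptic (short a b)" and on: "on_curve (short a b) P" "on_curve (short a b) Q"
  shows "padd (short a b) (pneg (short a b) P) (padd (short a b) P Q) = Q"
proof (cases rule: padd_short_cases[OF on])
  case 1 then show ?thesis by simp
next
  case 2 then show ?thesis using padd_pneg_short padd_short_comm on on_curve_pneg_short
    by (metis padd_Inf_right)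
next
  case (3 x y y')
  have "y' = - y" using 3(3) by (simp add: eq_neg_iff_add_eq_0 add.commute)
  with 3 show ?thesis by simp
next
  case (4 x y x' y' l)
  define x3 where "x3 = l ^ 2 - x - x'"
  define y3 where "y3 = l * (x - x3) - y"
  have s: "padd (short a b) P Q = Aff x3 y3" using 4 unfolding x3_def y3_def by simp
  have on3: "on_curve (short a b) (Aff x3 y3)" using s on_curve_padd_short[OF on] by simp
  have ne: "\<not> (x = x3 \<and> - y + y3 = 0)"
    using padd_short_eq_left[OF E on] s 4(1,2) by auto
  have sl: "slope a x (-y) x3 y3 (-l)"
    using 4(4) x3_def y3_def unfolding slope_def by algebra
  have onn: "on_curve (short a b) (Aff x (-y))" using on(1) 4(1) by simp
  have "padd (short a b) (Aff x (-y)) (Aff x3 y3) =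
     Aff ((-l) ^ 2 - x - x3) ((-l) * (x - ((-l) ^ 2 - x - x3)) - (-y))"
    by (rule padd_short_slope[OF onn on3 sl ne])
  also have "(-l) ^ 2 - x - x3 = x'" unfolding x3_def by simp
  also have "(-l) * (x - x') - (-y) = y'" using 4(4) unfolding slope_def by algebra
  finally show ?thesis unfolding s using 4 by simp
qed

text \<open>The slopes form a 2-cocycle of the group law: the slope of \<open>(P\<^sub>1, P\<^sub>2 + P\<^sub>3)\<close>
  is \<open>l + n - m\<close>. The equation \<open>key\<close> is the equality of the two third \<open>x\<close>-coordinates.\<close>
lemma padd_short_assoc_generic:
  assumes E: "elliptic (short a b)"
    and on: "on_curve (short a b) P" "on_curve (short a b) Q" "on_curve (short a b) R"
    and ne: "P \<noteq> Inf" "Q \<noteq> Inf" "R \<noteq> Inf" "padd (short a b) P Q \<noteq> Inf" "padd (short a b) Q R \<noteq> Inf"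
      "padd (short a b) (padd (short a b) P Q) R \<noteq> Inf"
      "padd (short a b) P (padd (short a b) Q R) \<noteq> Inf"
  shows "padd (short a b) (padd (short a b) P Q) R = padd (short a b) P (padd (short a b) Q R)"
proof -
  obtain x y x2 y2 l where 1: "P = Aff x y" "Q = Aff x2 y2" "\<not> (x = x2 \<and> y + y2 = 0)"
      "slope a x y x2 y2 l"
      "padd (short a b) P Q = Aff (l ^ 2 - x - x2) (l * (x - (l ^ 2 - x - x2)) - y)"
    using ne by (cases rule: padd_short_cases[OF on(1,2)]) auto
  obtain x3 y3 m where 2: "R = Aff x3 y3" "\<not> (x2 = x3 \<and> y2 + y3 = 0)"
      "slope a x2 y2 x3 y3 m"
      "padd (short a b) Q R = Aff (m ^ 2 - x2 - x3) (m * (x2 - (m ^ 2 - x2 - x3)) - y2)"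
    using ne 1(2) by (cases rule: padd_short_cases[OF on(2,3)]) auto
  define x4 y4 x5 y5 where d: "x4 = l ^ 2 - x - x2" "y4 = l * (x - x4) - y"
     "x5 = m ^ 2 - x2 - x3" "y5 = m * (x2 - x5) - y2"
  have s: "padd (short a b) P Q = Aff x4 y4" "padd (short a b) Q R = Aff x5 y5"
    using 1(5) 2(4) by (simp_all add: d)
  have on45: "on_curve (short a b) (Aff x4 y4)" "on_curve (short a b) (Aff x5 y5)"
    using s on_curve_padd_short on by metis+
  have on': "on_curve (short a b) (Aff x y)" "on_curve (short a b) (Aff x3 y3)"
    using on 1 2 by auto
  obtain n where 3: "\<not> (x4 = x3 \<and> y4 + y3 = 0)" "slope a x4 y4 x3 y3 n"
      "padd (short a b) (Aff x4 y4) (Aff x3 y3) = Aff (n ^ 2 - x4 - x3) (n * (x4 - (n ^ 2 - x4 - x3)) - y4)"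
    using ne s 2(1) by (cases rule: padd_short_cases[OF on45(1) on'(2)]) auto
  have 4: "\<not> (x = x5 \<and> y + y5 = 0)"
    using ne s 1 by auto
  note l1 = conjunct1[OF 1(4)[unfolded slope_def]] and l2 = conjunct2[OF 1(4)[unfolded slope_def]]
  note m1 = conjunct1[OF 2(3)[unfolded slope_def]] and m2 = conjunct2[OF 2(3)[unfolded slope_def]]
  note n1 = conjunct1[OF 3(2)[unfolded slope_def]] and n2 = conjunct2[OF 3(2)[unfolded slope_def]]
  \<comment> \<open>Two multipliers are used, since chord and tangent are not distinguished:
    \<open>x4 - x3\<close> and \<open>y4 + y3\<close> do not both vanish.\<close>
  have k: "((l - m) * (l + n) - (x - x3)) * (x4 - x3) = 0"
    "((l - m) * (l + n) - (x - x3)) * (y4 + y3) = 0"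
    using l1 l2 m1 m2 n1 n2 d(1,2) by algebra+
  have key: "(l - m) * (l + n) = x - x3" using k 3(1) by auto
  have sl1: "y - y5 = (l + n - m) * (x - x5)" using l1 m1 n1 d key by algebra
  have h: "2 * y5 + (l + n - 2 * m) * (x - x5) + m ^ 2 * (l - m) = (l - m) * (x + x3 + x5)"
    using l1 m1 n1 d key by algebra
  have h': "(l + n) * (2 * y5 + (l + n - 2 * m) * (x - x5) + m ^ 2 * (l - m))
      = (l + n) * ((l - m) * (x + x3 + x5))"
    using h by simp
  have "m * (y3 - y5) = x3 ^ 2 + x3 * x5 + x5 ^ 2 + a" using m1 m2 d(3,4) by algebra
  moreover have "y3 = m * (x3 - x5) - y5" using m1 d(3,4) by algebra
  ultimately have sl2: "(l + n - m) * (y + y5) = x ^ 2 + x * x5 + x5 ^ 2 + a"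
    using h' sl1 key by algebra
  have sl: "slope a x y x5 y5 (l + n - m)"
    using sl1 sl2 unfolding slope_def by blast
  have r: "padd (short a b) (Aff x y) (Aff x5 y5) =
      Aff ((l + n - m) ^ 2 - x - x5) ((l + n - m) * (x - ((l + n - m) ^ 2 - x - x5)) - y)"
    by (rule padd_short_slope[OF on'(1) on45(2) sl 4])
  have ex: "(l + n - m) ^ 2 - x - x5 = n ^ 2 - x4 - x3"
    using d(1,3) key by algebra
  have ey: "(l + n - m) * (x - (n ^ 2 - x4 - x3)) - y = n * (x4 - (n ^ 2 - x4 - x3)) - y4"
  \<comment> \<open>The quadratic slope equations yield the claim only up to the factor
    \<open>l + n\<close>. When it vanishes, \<open>key\<close> gives \<open>x = x3\<close>, and the
    chord equations suffice.\<close>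
  proof (cases "l + n = 0")
    case True
    then show ?thesis using l1 m1 n1 d key by algebra
  next
    case False
    have "l * (y - y4) = x ^ 2 + x * x4 + x4 ^ 2 + a" using d(1,2) l1 l2 by algebra
    then have "(l + n) * (2 * y4 - (l - n) * (x - x4) + (l - m) * (x - (n ^ 2 - x4 - x3))) = 0"
      using n2 d(2) n1 key by algebra
    then have "2 * y4 - (l - n) * (x - x4) + (l - m) * (x - (n ^ 2 - x4 - x3)) = 0"
      using False by simp
    then show ?thesis using d(2) by algebra
  qed
  show ?thesis using r ex ey s 3(3) 1(1) 2(1) by simp
qed

text \<open>If a partial sum is \<open>Inf\<close>, one of its summands is the negative of the
  other, and cancellation together with the compatibility of addition and negation settles the
  case.\<close>

lemma padd_short_assoc:
  assumes E: "elliptic (short a b)"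
    and on: "on_curve (short a b) P" "on_curve (short a b) Q" "on_curve (short a b) R"
  shows "padd (short a b) (padd (short a b) P Q) R = padd (short a b) P (padd (short a b) Q R)"
    (is "?add (?add P Q) R = _")
proof -
  let ?neg = "pneg (short a b)"
  have canc: "?add (?neg U) (?add U V) = V" if "on_curve (short a b) U" "on_curve (short a b) V" for U V
    using padd_short_cancel[OF E that] .
  have comm: "?add U V = ?add V U" if "on_curve (short a b) U" "on_curve (short a b) V" for U V
    using padd_short_comm[OF that] .
  have nn: "?neg (?neg U) = U" for U by (cases U) auto
  have inv: "V = ?neg U" if "?add U V = Inf" for U V
    using that unfolding padd_short_eq_Inf by (auto simp: eq_neg_iff_add_eq_0 add.commute)
  note onn = on_curve_pneg_short[OF on(1)] on_curve_pneg_short[OF on(2)] on_curve_pneg_short[OF on(3)]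
  note onPQ = on_curve_padd_short[OF on(1,2)] and onQR = on_curve_padd_short[OF on(2,3)]
  consider "P = Inf" | "Q = Inf" | "R = Inf" | "?add P Q = Inf" | "?add Q R = Inf"
    | "?add (?add P Q) R = Inf" | "?add P (?add Q R) = Inf"
    | "P \<noteq> Inf" "Q \<noteq> Inf" "R \<noteq> Inf" "?add P Q \<noteq> Inf" "?add Q R \<noteq> Inf"
      "?add (?add P Q) R \<noteq> Inf" "?add P (?add Q R) \<noteq> Inf" by blast
  then show ?thesis
  proof cases
    case 4
    then have "P = ?neg Q" using inv[of P Q] nn by simp
    then have "?add P (?add Q R) = R" using canc[OF on(2,3)] by simp
    then show ?thesis using 4 by simp
  next
    case 5
    then have "R = ?neg Q" by (rule inv)
    then have "?add (?add P Q) R = ?add (?neg Q) (?add Q P)"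
      using comm[OF on(1,2)] comm[OF onPQ on(3)] by simp
    then show ?thesis using 5 canc[OF on(2,1)] by simp
  next
    case 6
    then have "R = ?neg (?add P Q)" by (rule inv)
    then have R: "R = ?add (?neg Q) (?neg P)"
      using pneg_padd_short[OF on(1,2)] comm[OF onn(1,2)] by simp
    have "?add Q R = ?neg P" using canc[OF onn(2,1)] R nn by simp
    then show ?thesis using 6 padd_pneg_short by simp
  next
    case 7
    then have "P = ?neg (?add Q R)" using inv comm[OF on(1) onQR] by simp
    then have P: "P = ?add (?neg Q) (?neg R)" using pneg_padd_short[OF on(2,3)] by simp
    have "?add P Q = ?neg R" using canc[OF onn(2,3)] P nn comm[OF on(1,2)] by simp
    then show ?thesis using 7 padd_pneg_short[of a b R] comm[OF on(3) onn(3)] by simp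
  next
    case 8
    then show ?thesis using padd_short_assoc_generic[OF E on] by blast
  qed auto
qed

section \<open>Counting in abelian groups of finite rank\<close>

text \<open>\<open>e\<close> is the largest exponent with \<open>2 ^ e\<close> dividing all
  coefficients; it exists because \<open>2 ^ n > n\<close>. Dividing a relation by
  \<open>2 ^ e\<close> costs only a torsion element, and what remains is nontrivial modulo
  2.\<close>

lemma common_power_of_two:
  fixes c :: "nat \<Rightarrow> int"
  assumes "i0 < n" "c i0 \<noteq> 0"
  shows "\<exists>e c'. (\<forall>i<n. c i = 2 ^ e * c' i) \<and> (\<exists>i<n. odd (c' i))"
proof -
  define P where "P e \<longleftrightarrow> (\<forall>i<n. 2 ^ e dvd c i)" for e :: nat
  have "\<not> P (nat \<bar>c i0\<bar>)"
  proof
    assume "P (nat \<bar>c i0\<bar>)"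
    then have "2 ^ nat \<bar>c i0\<bar> \<le> \<bar>c i0\<bar>"
      using assms zdvd_imp_le[of "2 ^ nat \<bar>c i0\<bar>" "\<bar>c i0\<bar>"] unfolding P_def by simp
    moreover have "int (nat \<bar>c i0\<bar>) < 2 ^ nat \<bar>c i0\<bar>"
      using of_nat_less_iff[of "nat \<bar>c i0\<bar>" "2 ^ nat \<bar>c i0\<bar>"] less_exp
      by (metis of_nat_numeral of_nat_power)
    ultimately show False by simp
  qed
  moreover have "P 0" unfolding P_def by simp
  ultimately obtain e where e: "P e" "\<not> P (Suc e)"
    using nat_induct[of P] by blast
  define c' where "c' i = c i div 2 ^ e" for i
  have c': "c i = 2 ^ e * c' i" if "i < n" for i
    using e(1) that unfolding P_def c'_def by simp
  moreover have "\<exists>i<n. odd (c' i)"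
  proof (rule ccontr)
    assume "\<not> (\<exists>i<n. odd (c' i))"
    then have "2 ^ Suc e dvd c i" if "i < n" for i
      using c'[OF that] that by (auto simp: mult.commute)
    then show False using e(2) unfolding P_def by blast
  qed
  ultimately show ?thesis by blast
qed

section \<open>Congruence modulo powers of two and torsion\<close>

context comm_group
begin

lemma finprod_nat_pow:
  assumes "finite I" "\<And>i. i \<in> I \<Longrightarrow> g i \<in> carrier G"
  shows "finprod G (\<lambda>i. g i [^] (m::nat)) I = finprod G g I [^] m"
  using assms by (induction I rule: finite_induct) (auto simp: pow_mult_distrib m_comm)

lemma int_pow_of_nat_pow:
  "x \<in> carrier G \<Longrightarrow> (x [^] (i::int)) [^] (m::nat) = x [^] (i * int m)"
  using int_pow_pow[of x i "int m"] int_pow_int[of G "x [^] i" m] by simp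

definition tors :: "'a set" where
  "tors = {x \<in> carrier G. \<exists>n>0. x [^] (n::nat) = \<one>}"

text \<open>Congruence modulo the subgroup generated by the \<open>2 ^ k\<close>-th powers and the
  torsion. With torsion divided out, the number of classes is bounded in terms of the rank alone,
  whatever the 2-torsion.\<close>

definition pow2_cong :: "nat \<Rightarrow> 'a \<Rightarrow> 'a \<Rightarrow> bool" where
  "pow2_cong k x y \<longleftrightarrow> (\<exists>w\<in>carrier G. \<exists>t\<in>tors. x = y \<otimes> (w [^] (2 ^ k :: nat) \<otimes> t))"

lemma tors_closed: "t \<in> tors \<Longrightarrow> t \<in> carrier G"
  unfolding tors_def by simp

lemma one_tors: "\<one> \<in> tors"
  unfolding tors_def by auto

lemma mult_tors:
  assumes "s \<in> tors" "t \<in> tors" shows "s \<otimes> t \<in> tors"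
proof -
  obtain m n :: nat where mn: "m > 0" "n > 0" "s [^] m = \<one>" "t [^] n = \<one>"
    and c: "s \<in> carrier G" "t \<in> carrier G"
    using assms unfolding tors_def by auto
  have "(s \<otimes> t) [^] (m * n) = (s [^] m) [^] n \<otimes> (t [^] n) [^] m"
    using c by (simp add: pow_mult_distrib m_comm nat_pow_pow mult.commute)
  then show ?thesis using mn c unfolding tors_def by (auto intro!: exI[of _ "m * n"])
qed

lemma inv_tors: "t \<in> tors \<Longrightarrow> inv t \<in> tors"
  unfolding tors_def by (auto simp: nat_pow_inv)

lemma tors_root:
  assumes "x \<in> carrier G" "x [^] (m::nat) \<in> tors" "m > 0" shows "x \<in> tors"
proof -
  obtain n :: nat where "n > 0" "(x [^] m) [^] n = \<one>"
    using assms unfolding tors_def by auto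
  then show ?thesis using assms unfolding tors_def
    by (auto simp: nat_pow_pow intro!: exI[of _ "m * n"])
qed

lemma pow2_cong_refl: "x \<in> carrier G \<Longrightarrow> pow2_cong k x x"
  unfolding pow2_cong_def by (rule bexI[of _ \<one>], rule bexI[of _ \<one>]) (auto simp: one_tors)

lemma pow2_cong_sym:
  assumes "x \<in> carrier G" "y \<in> carrier G" "pow2_cong k x y" shows "pow2_cong k y x"
proof -
  obtain w t where w: "w \<in> carrier G" "t \<in> tors" "x = y \<otimes> (w [^] (2 ^ k :: nat) \<otimes> t)"
    using assms unfolding pow2_cong_def by auto
  have "y = x \<otimes> inv (w [^] (2 ^ k :: nat) \<otimes> t)"
    using w assms by (metis inv_solve_right' m_closed nat_pow_closed tors_closed)
  also have "inv (w [^] (2 ^ k :: nat) \<otimes> t) = inv w [^] (2 ^ k :: nat) \<otimes> inv t"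
    using w tors_closed by (simp add: inv_mult nat_pow_inv)
  finally have "y = x \<otimes> (inv w [^] (2 ^ k :: nat) \<otimes> inv t)" .
  then show ?thesis unfolding pow2_cong_def
    by (rule bexI[of _ "inv w", OF bexI[of _ "inv t"]]) (use w inv_tors in auto)
qed

lemma pow2_cong_mult:
  assumes "x \<in> carrier G" "y \<in> carrier G" "x' \<in> carrier G" "y' \<in> carrier G"
    and "pow2_cong k x y" "pow2_cong k x' y'"
  shows "pow2_cong k (x \<otimes> x') (y \<otimes> y')"
proof -
  obtain w t where w: "w \<in> carrier G" "t \<in> tors" "x = y \<otimes> (w [^] (2 ^ k :: nat) \<otimes> t)"
    using assms unfolding pow2_cong_def by auto
  obtain w' t' where w': "w' \<in> carrier G" "t' \<in> tors" "x' = y' \<otimes> (w' [^] (2 ^ k :: nat) \<otimes> t')"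
    using assms unfolding pow2_cong_def by auto
  have "x \<otimes> x' = (y \<otimes> y') \<otimes> ((w \<otimes> w') [^] (2 ^ k :: nat) \<otimes> (t \<otimes> t'))"
    using w w' assms tors_closed by (simp add: pow_mult_distrib m_comm m_ac)
  then show ?thesis using w w' mult_tors unfolding pow2_cong_def by blast
qed

lemma pow2_cong_trans:
  assumes "x \<in> carrier G" "y \<in> carrier G" "z \<in> carrier G"
    and "pow2_cong k x y" "pow2_cong k y z"
  shows "pow2_cong k x z"
proof -
  obtain w t where w: "w \<in> carrier G" "t \<in> tors" "x = y \<otimes> (w [^] (2 ^ k :: nat) \<otimes> t)"
    using assms unfolding pow2_cong_def by auto
  obtain w' t' where w': "w' \<in> carrier G" "t' \<in> tors" "y = z \<otimes> (w' [^] (2 ^ k :: nat) \<otimes> t')"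
    using assms unfolding pow2_cong_def by auto
  have "x = z \<otimes> ((w' \<otimes> w) [^] (2 ^ k :: nat) \<otimes> (t' \<otimes> t))"
    using w w' assms tors_closed by (simp add: pow_mult_distrib m_comm m_ac)
  then show ?thesis using w w' mult_tors unfolding pow2_cong_def by blast
qed

lemma pow2_cong_square:
  assumes "x \<in> carrier G" shows "pow2_cong 1 (x \<otimes> x) \<one>"
proof -
  have "x \<otimes> x = \<one> \<otimes> (x [^] (2 ^ 1 :: nat) \<otimes> \<one>)"
    using assms by (simp add: numeral_2_eq_2)
  then show ?thesis using assms one_tors unfolding pow2_cong_def by blast
qed

text \<open>The number of classes is expressed by sets of pairwise incongruent elements, so no
  quotient group is formed. The choice in \<open>R\<close> depends only on the class, whence
  congruent elements get the same representative.\<close>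

lemma card_le_classes:
  assumes F: "F \<subseteq> carrier G" "finite F"
    and n: "\<And>R. R \<subseteq> F \<Longrightarrow> (\<And>x y. x \<in> R \<Longrightarrow> y \<in> R \<Longrightarrow> pow2_cong k x y \<Longrightarrow> x = y) \<Longrightarrow> card R \<le> n"
    and m: "\<And>y. y \<in> F \<Longrightarrow> card {x \<in> F. pow2_cong k x y} \<le> m"
  shows "card F \<le> n * m"
proof -
  have FG: "x \<in> carrier G" if "x \<in> F" for x using that F by auto
  define R where "R = (\<lambda>x. SOME y. y \<in> F \<and> pow2_cong k x y)"
  have R: "R x \<in> F" "pow2_cong k x (R x)" if "x \<in> F" for x
    using someI[of "\<lambda>y. y \<in> F \<and> pow2_cong k x y" x] that pow2_cong_refl FG unfolding R_def by auto
  have Req: "R x = R y" if "x \<in> F" "y \<in> F" "pow2_cong k x y" for x y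
  proof -
    have "(z \<in> F \<and> pow2_cong k x z) = (z \<in> F \<and> pow2_cong k y z)" for z
      using that FG pow2_cong_trans[of x y z k] pow2_cong_trans[of y x z k] pow2_cong_sym[of x y k] by blast
    then show ?thesis unfolding R_def by simp
  qed
  have cardR: "card (R ` F) \<le> n"
  proof (rule n)
    fix x y assume xy: "x \<in> R ` F" "y \<in> R ` F" "pow2_cong k x y"
    obtain u v where uv: "u \<in> F" "v \<in> F" "x = R u" "y = R v" using xy by auto
    have "R (R u) = R u" "R (R v) = R v" using Req R uv FG pow2_cong_sym by metis+
    then show "x = y" using Req[of x y] xy R uv by auto
  qed (use R in auto)
  have "card F = card (\<Union>y\<in>R ` F. {x \<in> F. R x = y})"
    by (rule arg_cong[of _ _ card]) auto
  also have "\<dots> \<le> (\<Sum>y\<in>R ` F. card {x \<in> F. R x = y})"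
    using F by (intro card_UN_le) auto
  also have "\<dots> \<le> (\<Sum>y\<in>R ` F. m)"
  proof (rule sum_mono)
    fix y assume y: "y \<in> R ` F"
    have "card {x \<in> F. R x = y} \<le> card {x \<in> F. pow2_cong k x y}"
      using R(2) F(2) by (intro card_mono) auto
    then show "card {x \<in> F. R x = y} \<le> m" using m[of y] y R(1) by auto
  qed
  also have "\<dots> \<le> n * m" using mult_le_mono1[OF cardR] by simp
  finally show ?thesis .
qed

text \<open>Once the common power of two is removed from the exponents, the product
  \<open>?y\<close> is torsion. Its exponents are then reduced modulo 2: the even parts form the
  square of \<open>?z\<close>, and \<open>S\<close> collects the indices with odd exponent.\<close>

lemma relation_mod_squares:
  fixes c :: "nat \<Rightarrow> int"
  assumes g: "\<And>i. i < n \<Longrightarrow> g i \<in> carrier G"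
    and c: "i0 < n" "c i0 \<noteq> 0" and rel: "finprod G (\<lambda>i. g i [^] c i) {..<n} = \<one>"
  shows "\<exists>S\<subseteq>{..<n}. S \<noteq> {} \<and> pow2_cong 1 (finprod G g S) \<one>"
proof -
  obtain e c' where c': "\<And>i. i < n \<Longrightarrow> c i = 2 ^ e * c' i" and odd: "\<exists>i<n. odd (c' i)"
    using common_power_of_two[of i0 n c] c by blast
  let ?y = "finprod G (\<lambda>i. g i [^] c' i) {..<n}"
  have y: "?y \<in> carrier G" using g by (intro finprod_closed) auto
  have "?y [^] (2 ^ e :: nat) = finprod G (\<lambda>i. (g i [^] c' i) [^] (2 ^ e :: nat)) {..<n}"
    using g by (subst finprod_nat_pow) auto
  also have "\<dots> = finprod G (\<lambda>i. g i [^] c i) {..<n}"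
  proof (rule finprod_cong')
    fix i assume "i \<in> {..<n}"
    then show "(g i [^] c' i) [^] (2 ^ e :: nat) = g i [^] c i"
      using int_pow_of_nat_pow[of "g i" "c' i" "2 ^ e"] g[of i] c'[of i] by (simp add: mult.commute)
  qed (use g in auto)
  finally have "?y [^] (2 ^ e :: nat) = \<one>" using rel by simp
  then have yt: "?y \<in> tors" using tors_root[OF y, of "2 ^ e"] one_tors by simp
  define S where "S = {i. i < n \<and> odd (c' i)}"
  let ?z = "finprod G (\<lambda>i. g i [^] (c' i div 2)) {..<n}"
  have z: "?z \<in> carrier G" using g by (intro finprod_closed) auto
  have Sc: "finprod G g S \<in> carrier G" using g by (intro finprod_closed) (auto simp: S_def)
  have "?y = finprod G (\<lambda>i. (g i [^] (c' i div 2)) [^] (2::nat) \<otimes> (if i \<in> S then g i else \<one>)) {..<n}"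
  proof (rule finprod_cong')
    fix i assume i: "i \<in> {..<n}"
    have "g i [^] c' i = g i [^] (c' i div 2 * 2 + c' i mod 2)" by simp
    also have "\<dots> = g i [^] (c' i div 2 * 2) \<otimes> g i [^] (c' i mod 2)"
      using g i by (intro int_pow_mult) auto
    also have "g i [^] (c' i div 2 * 2) = (g i [^] (c' i div 2)) [^] (2::nat)"
      using int_pow_of_nat_pow[of "g i" "c' i div 2" 2] g i by simp
    also have "g i [^] (c' i mod 2) = (if i \<in> S then g i else \<one>)"
      using i g unfolding S_def by (simp add: mod_2_eq_odd int_pow_1)
    finally show "g i [^] c' i = (g i [^] (c' i div 2)) [^] (2::nat) \<otimes> (if i \<in> S then g i else \<one>)" .
  qed (use g in auto)
  also have "\<dots> = finprod G (\<lambda>i. (g i [^] (c' i div 2)) [^] (2::nat)) {..<n} \<otimes>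
       finprod G (\<lambda>i. if i \<in> S then g i else \<one>) {..<n}"
    using g by (intro finprod_multf) auto
  also have "finprod G (\<lambda>i. (g i [^] (c' i div 2)) [^] (2::nat)) {..<n} = ?z [^] (2::nat)"
    using g by (intro finprod_nat_pow) auto
  also have "finprod G (\<lambda>i. if i \<in> S then g i else \<one>) {..<n} = finprod G g S"
  proof -
    have "finprod G g S = finprod G (\<lambda>i. if i \<in> S then g i else \<one>) S"
      using g by (intro finprod_cong') (auto simp: S_def)
    also have "\<dots> = finprod G (\<lambda>i. if i \<in> S then g i else \<one>) {..<n}"
      using g by (intro finprod_mono_neutral_cong_left) (auto simp: S_def)
    finally show ?thesis by simp
  qed
  finally have eq: "?y = ?z [^] (2::nat) \<otimes> finprod G g S" .
  have "finprod G g S = inv (?z [^] (2::nat)) \<otimes> ?y"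
    using inv_solve_left[of "finprod G g S" "?z [^] (2::nat)" ?y] eq z y Sc by simp
  then have "finprod G g S = \<one> \<otimes> ((inv ?z) [^] (2 ^ 1 :: nat) \<otimes> ?y)"
    using z y by (simp add: nat_pow_inv)
  then have "pow2_cong 1 (finprod G g S) \<one>"
    using z yt unfolding pow2_cong_def by (meson inv_closed)
  moreover have "S \<subseteq> {..<n}" "S \<noteq> {}" using odd unfolding S_def by auto
  ultimately show ?thesis by blast
qed

definition rank_le :: "nat \<Rightarrow> bool" where
  "rank_le r \<longleftrightarrow> (\<forall>g. (\<forall>i<Suc r. g i \<in> carrier G) \<longrightarrow>
     (\<exists>c :: nat \<Rightarrow> int. (\<exists>i<Suc r. c i \<noteq> 0) \<and> finprod G (\<lambda>i. g i [^] c i) {..<Suc r} = \<one>))"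

text \<open>Linear algebra over the field with two elements without the quotient space. If
  \<open>ind D\<close>, no nonempty subproduct is a square up to torsion, so \<open>D\<close> has at
  most \<open>r\<close> elements. For a maximal \<open>D\<close> each \<open>x\<close> in
  \<open>F\<close> is congruent to a subproduct, and the subset of \<open>D\<close> determines
  \<open>x\<close>.\<close>

lemma card_incongruent_mod_squares:
  assumes rk: "rank_le r" and F: "F \<subseteq> carrier G"
    and inc: "\<And>x y. x \<in> F \<Longrightarrow> y \<in> F \<Longrightarrow> pow2_cong 1 x y \<Longrightarrow> x = y"
  shows "finite F \<and> card F \<le> 2 ^ r"
proof -
  define ind where "ind D \<longleftrightarrow> finite D \<and> D \<subseteq> carrier G \<and>
     (\<forall>S\<subseteq>D. S \<noteq> {} \<longrightarrow> \<not> pow2_cong 1 (finprod G (\<lambda>x. x) S) \<one>)" for D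
  have bound: "card D \<le> r" if D: "ind D" for D
  proof (rule ccontr)
    assume "\<not> card D \<le> r"
    then obtain D' where D': "D' \<subseteq> D" "card D' = Suc r" "finite D'"
      using obtain_subset_with_card_n[of "Suc r" D] by (metis not_less_eq_eq)
    obtain g where g: "bij_betw g {..<Suc r} D'"
      using D' ex_bij_betw_nat_finite[of D'] by (auto simp: atLeast0LessThan)
    have gc: "g i \<in> carrier G" if "i < Suc r" for i
      using that g D' D unfolding ind_def bij_betw_def by (meson imageI lessThan_iff subset_iff)
    obtain c i0 where "i0 < Suc r" "c i0 \<noteq> (0::int)" "finprod G (\<lambda>i. g i [^] c i) {..<Suc r} = \<one>"
      using rk gc unfolding rank_le_def by blast
    then obtain S where S: "S \<subseteq> {..<Suc r}" "S \<noteq> {}" "pow2_cong 1 (finprod G g S) \<one>"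
      using relation_mod_squares[of "Suc r" g i0 c] gc by blast
    have inj: "inj_on g S" using g S(1) unfolding bij_betw_def by (meson inj_on_subset)
    have "finprod G (\<lambda>x. x) (g ` S) = finprod G g S"
      using inj gc S(1) by (subst finprod_reindex) (auto simp: image_subset_iff)
    moreover have "g ` S \<subseteq> D" using g S(1) D'(1) unfolding bij_betw_def by blast
    ultimately show False using D S unfolding ind_def by (metis image_is_empty)
  qed
  have "\<exists>D. ind D \<and> (\<forall>D'. ind D' \<longrightarrow> card D' \<le> card D)"
  proof -
    have "ind {}" unfolding ind_def by auto
    then show ?thesis using ex_has_greatest_nat[of ind "{}" card "Suc r"] bound by (auto simp: less_Suc_eq_le)
  qed
  then obtain D where D: "ind D" and mx: "\<And>D'. ind D' \<Longrightarrow> card D' \<le> card D" by blast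
  have fin: "finite D" and DG: "D \<subseteq> carrier G" using D unfolding ind_def by auto
  have fp: "finprod G (\<lambda>x. x) S \<in> carrier G" if "S \<subseteq> insert x D" "x \<in> carrier G" for x S
    using that DG by (intro finprod_closed) auto
  have rep: "\<exists>S\<subseteq>D. pow2_cong 1 x (finprod G (\<lambda>x. x) S)" if x: "x \<in> F" for x
  proof (cases "x \<in> D")
    case True
    then show ?thesis using pow2_cong_refl[of x 1] DG by (intro exI[of _ "{x}"]) auto
  next
    case False
    have xG: "x \<in> carrier G" using x F by auto
    have "\<not> ind (insert x D)" using mx[of "insert x D"] False fin by auto
    then obtain S where S: "S \<subseteq> insert x D" "S \<noteq> {}" "pow2_cong 1 (finprod G (\<lambda>x. x) S) \<one>"
      using fin DG xG unfolding ind_def by auto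
    have xS: "x \<in> S" using S D unfolding ind_def by blast
    let ?S = "S - {x}"
    have SD: "?S \<subseteq> D" using S by auto
    \<comment> \<open>Modulo squares \<open>?p\<close> is its own inverse, so triviality of the
      product of \<open>x\<close> and \<open>?p\<close> means that \<open>x\<close> is congruent to
      \<open>?p\<close>.\<close>
    let ?p = "finprod G (\<lambda>x. x) ?S"
    have p: "?p \<in> carrier G" using fp[of ?S x] xG SD by auto
    have "finprod G (\<lambda>x. x) (insert x ?S) = x \<otimes> ?p"
      using finite_subset[OF SD fin] SD xG DG by (intro finprod_insert) auto
    then have "finprod G (\<lambda>x. x) S = x \<otimes> ?p"
      using xS by (simp add: insert_absorb)
    then have "pow2_cong 1 (x \<otimes> ?p) \<one>" using S by simp
    then have "pow2_cong 1 (x \<otimes> ?p \<otimes> ?p) (\<one> \<otimes> ?p)"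
      using xG p pow2_cong_refl[OF p] by (intro pow2_cong_mult) auto
    moreover have "pow2_cong 1 (x \<otimes> (?p \<otimes> ?p)) (x \<otimes> \<one>)"
      using pow2_cong_mult[OF xG xG _ _ pow2_cong_refl[OF xG] pow2_cong_square[OF p]] p by simp
    ultimately have "pow2_cong 1 x ?p"
      using pow2_cong_trans[of x "x \<otimes> (?p \<otimes> ?p)" ?p] pow2_cong_sym[of "x \<otimes> (?p \<otimes> ?p)" x] p xG
      by (simp add: m_assoc)
    then show ?thesis using SD by blast
  qed
  then obtain h where h: "\<And>x. x \<in> F \<Longrightarrow> h x \<subseteq> D" "\<And>x. x \<in> F \<Longrightarrow> pow2_cong 1 x (finprod G (\<lambda>x. x) (h x))"
    by metis
  have inj: "inj_on h F"
  proof (rule inj_onI)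
    fix x y assume xy: "x \<in> F" "y \<in> F" "h x = h y"
    have "h x \<subseteq> insert x D" "x \<in> carrier G" using h(1)[OF xy(1)] xy(1) F by blast+
    then have "finprod G (\<lambda>x. x) (h x) \<in> carrier G" by (rule fp)
    moreover have "pow2_cong 1 x (finprod G (\<lambda>x. x) (h x))" using h(2)[OF xy(1)] .
    moreover have "pow2_cong 1 y (finprod G (\<lambda>x. x) (h x))" using h(2)[OF xy(2)] xy(3) by simp
    moreover have "y \<in> carrier G" using xy(2) F by blast
    ultimately have "pow2_cong 1 x y"
      using \<open>x \<in> carrier G\<close> pow2_cong_trans pow2_cong_sym by blast
    then show "x = y" using inc xy by blast
  qed
  have ran: "h ` F \<subseteq> Pow D" using h by auto
  have finP: "finite (Pow D)" using fin by simp
  have "finite F" by (rule inj_on_finite[OF inj ran finP])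
  moreover have "card F \<le> card (Pow D)" by (rule card_inj_on_le[OF inj ran finP])
  moreover have "card (Pow D) \<le> 2 ^ r" using bound[OF D] fin by (simp add: card_Pow)
  ultimately show ?thesis by linarith
qed

lemma insert_mult_inv:
  assumes "y \<in> carrier G" "u \<in> carrier G" "v \<in> carrier G" "s \<in> carrier G" "t \<in> carrier G"
    "t' \<in> carrier G"
  shows "y \<otimes> (u \<otimes> (v \<otimes> s) \<otimes> t) = y \<otimes> (u \<otimes> t') \<otimes> (v \<otimes> (s \<otimes> (t \<otimes> inv t')))"
proof -
  have "y \<otimes> (u \<otimes> t') \<otimes> (v \<otimes> (s \<otimes> (t \<otimes> inv t'))) =
      (y \<otimes> (u \<otimes> (v \<otimes> s) \<otimes> t)) \<otimes> (t' \<otimes> inv t')"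
    using assms by (simp only: m_ac m_closed inv_closed)
  then show ?thesis using assms by simp
qed

text \<open>Induction on \<open>k\<close>: within the class of \<open>y\<close> modulo squares,
  \<open>x = y * w ^ 2 * t\<close>. A congruence at level \<open>k\<close> between two roots
  \<open>w\<close> squares to one at level \<open>k + 1\<close> between the \<open>x\<close>. So the
  roots are pairwise incongruent, and the induction hypothesis applies to them.\<close>

lemma card_incongruent:
  assumes rk: "rank_le r" and F: "F \<subseteq> carrier G" "finite F"
    and inc: "\<And>x y. x \<in> F \<Longrightarrow> y \<in> F \<Longrightarrow> pow2_cong k x y \<Longrightarrow> x = y"
  shows "card F \<le> 2 ^ (r * k)"
  using F inc
proof (induction k arbitrary: F)
  case 0
  have "x = y" if "x \<in> F" "y \<in> F" for x y
  proof -
    have c: "x \<in> carrier G" "y \<in> carrier G" using that 0 by auto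
    have "x = y \<otimes> ((inv y \<otimes> x) [^] (2 ^ 0 :: nat) \<otimes> \<one>)"
      using c by (simp add: m_assoc[symmetric])
    then have "pow2_cong 0 x y" using c one_tors unfolding pow2_cong_def by blast
    then show ?thesis using 0 that by blast
  qed
  then have "F = {} \<or> (\<exists>x. F = {x})" by blast
  then show ?case by auto
next
  case (Suc k)
  have FG: "x \<in> carrier G" if "x \<in> F" for x using that Suc.prems by auto
  have fibre: "card {x \<in> F. pow2_cong 1 x y} \<le> 2 ^ (r * k)" if yF: "y \<in> F" for y
  proof -
    let ?A = "{x \<in> F. pow2_cong 1 x y}"
    have "\<exists>w t. w \<in> carrier G \<and> t \<in> tors \<and> x = y \<otimes> (w [^] (2 :: nat) \<otimes> t)" if "x \<in> ?A" for x
      using that unfolding pow2_cong_def by auto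
    then have "\<forall>x\<in>?A. \<exists>p. fst p \<in> carrier G \<and> snd p \<in> tors \<and> x = y \<otimes> (fst p [^] (2 :: nat) \<otimes> snd p)"
      by (metis fst_conv snd_conv)
    from bchoice[OF this] obtain p where p: "\<forall>x\<in>?A. fst (p x) \<in> carrier G \<and> snd (p x) \<in> tors \<and>
        x = y \<otimes> (fst (p x) [^] (2 :: nat) \<otimes> snd (p x))" ..
    define w where "w x = fst (p x)" for x
    define t where "t x = snd (p x)" for x
    have wt: "w x \<in> carrier G" "t x \<in> tors" "x = y \<otimes> (w x [^] (2 :: nat) \<otimes> t x)" if "x \<in> ?A" for x
      using p that unfolding w_def t_def by blast+
    have cong: "pow2_cong (Suc k) x x'"
      if xx: "x \<in> ?A" "x' \<in> ?A" and c: "pow2_cong k (w x) (w x')" for x x'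
    proof -
      obtain v s where v: "v \<in> carrier G" "s \<in> tors" "w x = w x' \<otimes> (v [^] (2 ^ k :: nat) \<otimes> s)"
        using c unfolding pow2_cong_def by auto
      have cl: "w x' \<in> carrier G" "t x \<in> carrier G" "t x' \<in> carrier G" "s \<in> carrier G" "y \<in> carrier G"
        using wt xx v tors_closed FG yF by auto
      have "w x [^] (2::nat) = w x' [^] (2::nat) \<otimes> (v [^] (2 ^ Suc k :: nat) \<otimes> s [^] (2::nat))"
        using v cl by (simp add: pow_mult_distrib m_comm nat_pow_pow mult.commute)
      then have "x = y \<otimes> (w x' [^] (2::nat) \<otimes> (v [^] (2 ^ Suc k :: nat) \<otimes> s [^] (2::nat)) \<otimes> t x)"
        using wt(3)[OF xx(1)] by simp
      also have "\<dots> = y \<otimes> (w x' [^] (2::nat) \<otimes> t x') \<otimes>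
           (v [^] (2 ^ Suc k :: nat) \<otimes> (s [^] (2::nat) \<otimes> (t x \<otimes> inv t x')))"
        using cl v(1) by (intro insert_mult_inv) auto
      also have "y \<otimes> (w x' [^] (2::nat) \<otimes> t x') = x'" using wt(3)[OF xx(2)] by simp
      finally have "x = x' \<otimes> (v [^] (2 ^ Suc k :: nat) \<otimes> (s [^] (2::nat) \<otimes> (t x \<otimes> inv t x')))" .
      moreover have "s [^] (2::nat) \<otimes> (t x \<otimes> inv t x') \<in> tors"
        using v(2) wt(2) xx mult_tors inv_tors cl by (simp add: numeral_2_eq_2)
      ultimately show ?thesis using v(1) unfolding pow2_cong_def by blast
    qed
    have inj: "inj_on w ?A"
    proof (rule inj_onI)
      fix x x' assume "x \<in> ?A" "x' \<in> ?A" "w x = w x'"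
      then show "x = x'" using cong[of x x'] pow2_cong_refl[of "w x'" k] wt(1) Suc.prems(3) by auto
    qed
    have "card (w ` ?A) \<le> 2 ^ (r * k)"
    proof (rule Suc.IH)
      fix u v assume "u \<in> w ` ?A" "v \<in> w ` ?A" "pow2_cong k u v"
      then show "u = v" using cong Suc.prems(3) by auto
    qed (use wt Suc.prems in auto)
    then show ?thesis using inj by (simp add: card_image)
  qed
  have "card F \<le> 2 ^ r * 2 ^ (r * k)"
  proof (rule card_le_classes[OF Suc.prems(1,2) _ fibre])
    fix R assume "R \<subseteq> F" "\<And>x y. x \<in> R \<Longrightarrow> y \<in> R \<Longrightarrow> pow2_cong 1 x y \<Longrightarrow> x = y"
    then show "card R \<le> 2 ^ r"
      using card_incongruent_mod_squares[OF rk, of R] Suc.prems(1) by blast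
  qed
  then show ?case by (simp add: power_add)
qed

end

section \<open>Packing in a group with a height\<close>

lemma bounded_by_powers_of_four:
  fixes x :: real
  assumes "\<And>k. 4 ^ k * x \<le> M" shows "x \<le> 0"
proof (rule ccontr)
  assume "\<not> x \<le> 0"
  then have x: "x > 0" by simp
  obtain k where "M / x < 4 ^ k" using real_arch_pow[of 4 "M / x"] by auto
  then show False using assms[of k] x by (simp add: field_simps)
qed

lemma card_le_sum_multiplicity:
  fixes A :: "'i \<Rightarrow> 'b set"
  assumes "finite J" "finite X" "\<And>i. i \<in> J \<Longrightarrow> A i \<subseteq> X"
    and "\<And>x. x \<in> X \<Longrightarrow> card {i \<in> J. x \<in> A i} \<le> m"
  shows "(\<Sum>i\<in>J. card (A i)) \<le> m * card X"
proof -
  have "(\<Sum>i\<in>J. card (A i)) = (\<Sum>i\<in>J. \<Sum>x\<in>X. if x \<in> A i then 1 else 0)"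
  proof (rule sum.cong[OF refl])
    fix i assume "i \<in> J"
    then have "X \<inter> A i = A i" using assms by auto
    then show "card (A i) = (\<Sum>x\<in>X. if x \<in> A i then 1 else 0)"
      using assms(2) by (simp add: sum.If_cases Int_def)
  qed
  also have "\<dots> = (\<Sum>x\<in>X. \<Sum>i\<in>J. if x \<in> A i then 1 else 0)" by (rule sum.swap)
  also have "\<dots> = (\<Sum>x\<in>X. card {i \<in> J. x \<in> A i})"
    using assms(1) by (simp add: sum.If_cases Int_def)
  also have "\<dots> \<le> (\<Sum>x\<in>X. m)" using assms(4) by (intro sum_mono)
  finally show ?thesis by (simp add: mult.commute)
qed

lemma three_elements:
  assumes "card A > 2"
  obtains x y z where "x \<in> A" "y \<in> A" "z \<in> A" "x \<noteq> y" "x \<noteq> z" "y \<noteq> z"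
proof -
  obtain B where "B \<subseteq> A" "card B = 3" using assms obtain_subset_with_card_n[of 3 A] by auto
  then show thesis using that unfolding card_3_iff by auto
qed

lemma (in comm_group) mult_mult_div_div:
  assumes "x = y \<otimes> (u \<otimes> v)" "y \<in> carrier G" "u \<in> carrier G" "v \<in> carrier G"
  shows "(x \<otimes> inv y) \<otimes> inv v = u"
proof -
  have "(x \<otimes> inv y) \<otimes> inv v = (y \<otimes> inv y) \<otimes> (u \<otimes> (v \<otimes> inv v))"
    unfolding assms(1) using assms(2-4) by (simp only: m_ac m_closed inv_closed)
  then show ?thesis using assms by simp
qed

lemma (in comm_group) mult_eq_mult_div_eq:
  assumes "x \<otimes> w = y \<otimes> v" "x \<in> carrier G" "y \<in> carrier G" "v \<in> carrier G" "w \<in> carrier G"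
  shows "x \<otimes> inv y = v \<otimes> inv w"
proof -
  have "(x \<otimes> inv y) \<otimes> (w \<otimes> inv w) = (x \<otimes> w) \<otimes> (inv y \<otimes> inv w)"
    using assms(2-5) by (simp only: m_ac m_closed inv_closed)
  also have "\<dots> = (v \<otimes> inv w) \<otimes> (y \<otimes> inv y)"
    unfolding assms(1) using assms(2-5) by (simp only: m_ac m_closed inv_closed)
  finally show ?thesis using assms(2-5) by simp
qed

lemma (in comm_group) pow_mod_period:
  assumes "t \<in> carrier G" "t [^] (n::nat) = \<one>" shows "t [^] m = t [^] (m mod n)"
proof -
  have "t [^] m = t [^] (n * (m div n) + m mod n)" by simp
  also have "\<dots> = (t [^] n) [^] (m div n) \<otimes> t [^] (m mod n)"
    using assms(1) by (simp only: nat_pow_mult[symmetric] nat_pow_pow)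
  finally show ?thesis using assms by simp
qed

text \<open>No bilinear form is assumed: \<open>mult_le\<close> is a consequence of the
  parallelogram law that passes to the limit from an upper bound for the naive height of a sum.
  \<open>finite_ball\<close> is the Northcott property.\<close>

locale quadratic_height = comm_group +
  fixes q :: "'a \<Rightarrow> real"
  assumes nonneg: "x \<in> carrier G \<Longrightarrow> 0 \<le> q x"
    and mult_le: "x \<in> carrier G \<Longrightarrow> y \<in> carrier G \<Longrightarrow> q (x \<otimes> y) \<le> 2 * q x + 2 * q y"
    and inv_eq: "x \<in> carrier G \<Longrightarrow> q (inv x) = q x"
    and double: "x \<in> carrier G \<Longrightarrow> q (x \<otimes> x) = 4 * q x"
    and finite_ball: "finite {x \<in> carrier G. q x \<le> R}"
begin

lemma q_pow2: "x \<in> carrier G \<Longrightarrow> q (x [^] (2 ^ k :: nat)) = 4 ^ k * q x"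
proof (induction k)
  case (Suc k)
  have "x [^] (2 ^ Suc k :: nat) = x [^] (2 ^ k :: nat) \<otimes> x [^] (2 ^ k :: nat)"
    using Suc.prems by (simp add: nat_pow_mult mult_2)
  then show ?case using Suc double[of "x [^] (2 ^ k :: nat)"] by simp
qed simp

text \<open>A torsion element has finitely many powers, while passing to the \<open>2 ^ k\<close>-th
  power multiplies \<open>q\<close> by \<open>4 ^ k\<close>.\<close>

lemma q_tors: "t \<in> tors \<Longrightarrow> q t = 0"
proof -
  assume t: "t \<in> tors"
  then obtain n :: nat where n: "n > 0" "t [^] n = \<one>" and tG: "t \<in> carrier G"
    unfolding tors_def by auto
  note per = pow_mod_period[OF tG n(2)]
  have "4 ^ k * q t \<le> Max ((\<lambda>i. q (t [^] i)) ` {..<n})" for k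
  proof -
    have "4 ^ k * q t = q (t [^] (2 ^ k mod n))" using q_pow2[OF tG, of k] per[of "2 ^ k"] by metis
    then show ?thesis using n by (auto intro!: Max_ge)
  qed
  then have "q t \<le> 0" by (rule bounded_by_powers_of_four)
  then show ?thesis using nonneg[OF tG] by simp
qed

lemma q_div_le:
  assumes "x \<in> carrier G" "y \<in> carrier G" shows "q (x \<otimes> inv y) \<le> 2 * q x + 2 * q y"
  using mult_le[of x "inv y"] assms inv_eq by simp

text \<open>Write \<open>x = y * w ^ (2 ^ k) * t\<close>. Then \<open>4 ^ k * q w\<close> is at most
  \<open>2 * (2 * B + 2 * B)\<close>, so \<open>w\<close> lies in the ball of radius \<rho>. As
  \<open>w\<close> determines \<open>x\<close> only up to torsion, both sides are multiplied by
  \<open>tors\<close>, and this factor is cancelled at the end.\<close>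

lemma card_fibre_le:
  assumes k: "8 * B \<le> \<rho> * 4 ^ k" and y: "y \<in> carrier G" "q y \<le> B"
    and A: "A \<subseteq> {x \<in> carrier G. q x \<le> B}" "\<And>x. x \<in> A \<Longrightarrow> pow2_cong k x y"
  shows "card A \<le> card {x \<in> carrier G. q x \<le> \<rho>}"
proof -
  let ?m = "2 ^ k :: nat"
  have "tors \<subseteq> {x \<in> carrier G. q x \<le> 0}" using q_tors tors_closed by auto
  then have finT: "finite tors" using finite_ball finite_subset by blast
  then have T: "card tors > 0" using one_tors card_gt_0_iff by blast
  have "\<exists>w t. w \<in> carrier G \<and> t \<in> tors \<and> x = y \<otimes> (w [^] ?m \<otimes> t)" if "x \<in> A" for x
    using A(2)[OF that] unfolding pow2_cong_def by auto
  then obtain w t where w: "\<And>x. x \<in> A \<Longrightarrow> w x \<in> carrier G" and t: "\<And>x. x \<in> A \<Longrightarrow> t x \<in> tors"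
    and x: "\<And>x. x \<in> A \<Longrightarrow> x = y \<otimes> (w x [^] ?m \<otimes> t x)" by metis
  \<comment> \<open>Changing \<open>w\<close> by a torsion element \<open>s\<close> changes
    \<open>t\<close> by the inverse of the \<open>2 ^ k\<close>-th power of \<open>s\<close>, so
    every pair in the image still gives back \<open>x\<close>.\<close>
  define f where "f = (\<lambda>(x, s). (w x \<otimes> s, t x \<otimes> inv (s [^] ?m)))"
  have rec: "x = y \<otimes> (fst (f (x, s)) [^] ?m \<otimes> snd (f (x, s)))" if "x \<in> A" "s \<in> tors" for x s
  proof -
    have cl: "w x \<in> carrier G" "t x \<in> carrier G" "s \<in> carrier G" using w t tors_closed that by auto
    have "(w x \<otimes> s) [^] ?m \<otimes> (t x \<otimes> inv (s [^] ?m)) = w x [^] ?m \<otimes> t x \<otimes> (s [^] ?m \<otimes> inv (s [^] ?m))"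
      using cl by (simp only: pow_mult_distrib m_comm m_ac m_closed inv_closed nat_pow_closed)
    also have "\<dots> = w x [^] ?m \<otimes> t x" using cl by simp
    finally have "fst (f (x, s)) [^] ?m \<otimes> snd (f (x, s)) = w x [^] ?m \<otimes> t x"
      unfolding f_def by simp
    then show ?thesis using x[OF that(1)] by simp
  qed
  have pt: "s [^] ?m \<in> tors" if "s \<in> tors" for s
  proof -
    obtain n :: nat where "n > 0" "s [^] n = \<one>" and sG: "s \<in> carrier G"
      using \<open>s \<in> tors\<close> unfolding tors_def by auto
    moreover have "(s [^] ?m) [^] n = (s [^] n) [^] ?m"
      using sG by (simp add: nat_pow_pow mult.commute)
    ultimately show ?thesis unfolding tors_def by auto
  qed
  have ran: "f ` (A \<times> tors) \<subseteq> {x \<in> carrier G. q x \<le> \<rho>} \<times> tors"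
  proof
    fix z assume "z \<in> f ` (A \<times> tors)"
    then obtain x s where "x \<in> A" "s \<in> tors" "z = f (x, s)" by auto
    moreover obtain u v where z: "z = (u, v)" by (cases z)
    ultimately have xs: "x \<in> A" "s \<in> tors" "(u, v) = f (x, s)" by auto
    then have uv: "u = w x \<otimes> s" "v = t x \<otimes> inv (s [^] ?m)" unfolding f_def by auto
    have uG: "u \<in> carrier G" using uv w tors_closed xs by auto
    have vT: "v \<in> tors" using uv t xs mult_tors inv_tors pt by auto
    have xG: "x \<in> carrier G" "q x \<le> B" using A xs by auto
    have "x = y \<otimes> (u [^] ?m \<otimes> v)" using rec[OF xs(1,2)] xs(3) by (metis fst_conv snd_conv)
    then have "(x \<otimes> inv y) \<otimes> inv v = u [^] ?m"
      using y(1) uG tors_closed[OF vT] by (intro mult_mult_div_div) auto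
    then have "4 ^ k * q u = q ((x \<otimes> inv y) \<otimes> inv v)" using q_pow2[OF uG] by simp
    also have "\<dots> \<le> 2 * q (x \<otimes> inv y) + 2 * q v"
      using q_div_le xG y tors_closed[OF vT] by simp
    also have "\<dots> \<le> 2 * (2 * B + 2 * B)" using q_div_le[of x y] q_tors[OF vT] xG y by simp
    finally have "4 ^ k * q u \<le> 8 * B" by simp
    also have "\<dots> \<le> 4 ^ k * \<rho>" using k by (simp add: mult.commute)
    finally have "q u \<le> \<rho>" by (rule mult_left_le_imp_le) simp
    then show "z \<in> {x \<in> carrier G. q x \<le> \<rho>} \<times> tors" using uG vT z by simp
  qed
  have inj: "inj_on f (A \<times> tors)"
  proof (rule inj_onI, clarify)
    fix x s x' s' assume h: "x \<in> A" "s \<in> tors" "x' \<in> A" "s' \<in> tors" "f (x, s) = f (x', s')"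
    then have e: "x = x'" using rec[OF h(1,2)] rec[OF h(3,4)] by simp
    have "w x \<otimes> s = w x \<otimes> s'" using h(5) e unfolding f_def by simp
    then have "s = s'" using w[OF h(1)] tors_closed h by simp
    with e show "x = x' \<and> s = s'" by simp
  qed
  have "card (A \<times> tors) \<le> card ({x \<in> carrier G. q x \<le> \<rho>} \<times> tors)"
    using card_inj_on_le[OF inj ran] finite_ball finT by simp
  then show ?thesis using T by (simp add: card_cartesian_product)
qed

lemma card_ball_le:
  assumes rk: "rank_le r" and k: "8 * B \<le> \<rho> * 4 ^ k"
  shows "card {x \<in> carrier G. q x \<le> B} \<le> 2 ^ (r * k) * card {x \<in> carrier G. q x \<le> \<rho>}"
proof -
  let ?X = "{x \<in> carrier G. q x \<le> B}"
  have sub: "?X \<subseteq> carrier G" by blast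
  show ?thesis
  proof (rule card_le_classes[OF sub finite_ball])
    fix R assume R: "R \<subseteq> ?X" "\<And>x y. x \<in> R \<Longrightarrow> y \<in> R \<Longrightarrow> pow2_cong k x y \<Longrightarrow> x = y"
    show "card R \<le> 2 ^ (r * k)"
      by (rule card_incongruent[OF rk _ finite_subset[OF R(1) finite_ball] R(2)]) (use R(1) in auto)
  next
    fix y assume "y \<in> ?X"
    then show "card {x \<in> ?X. pow2_cong k x y} \<le> card {x \<in> carrier G. q x \<le> \<rho>}"
      by (intro card_fibre_le[OF k]) auto
  qed
qed

text \<open>Packing: balls of radius \<open>\<rho>\<close> around the points have multiplicity at most 2, and the number
  of group elements in a ball plays the role of its volume.\<close>
lemma card_separated_le:
  fixes P :: "'i \<Rightarrow> 'a"
  assumes rk: "rank_le r" and \<rho>: "\<rho> \<ge> 0" and k: "16 * (B + \<rho>) \<le> \<rho> * 4 ^ k"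
    and J: "finite J" "\<And>i. i \<in> J \<Longrightarrow> P i \<in> carrier G" "\<And>i. i \<in> J \<Longrightarrow> q (P i) \<le> B"
    and sep: "\<And>i j l. i \<in> J \<Longrightarrow> j \<in> J \<Longrightarrow> l \<in> J \<Longrightarrow> i \<noteq> j \<Longrightarrow> i \<noteq> l \<Longrightarrow> j \<noteq> l \<Longrightarrow>
      q (P i \<otimes> inv P j) > 4 * \<rho> \<or> q (P i \<otimes> inv P l) > 4 * \<rho> \<or> q (P j \<otimes> inv P l) > 4 * \<rho>"
  shows "card J \<le> 2 * 2 ^ (r * k)"
proof -
  define N where "N = card {x \<in> carrier G. q x \<le> \<rho>}"
  define X where "X = {x \<in> carrier G. q x \<le> 2 * (B + \<rho>)}"
  define A where "A i = (\<lambda>w. P i \<otimes> w) ` {x \<in> carrier G. q x \<le> \<rho>}" for i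
  have finX: "finite X" unfolding X_def by (rule finite_ball)
  have "q \<one> = 0" using q_tors one_tors by blast
  then have "\<one> \<in> {x \<in> carrier G. q x \<le> \<rho>}" using \<rho> by simp
  then have N: "N > 0" unfolding N_def using finite_ball card_gt_0_iff by blast
  have cA: "card (A i) = N" if "i \<in> J" for i
    unfolding A_def N_def using J(2)[OF that] by (intro card_image inj_onI) auto
  have AX: "A i \<subseteq> X" if "i \<in> J" for i
  proof
    fix x assume "x \<in> A i"
    then obtain w where w: "w \<in> carrier G" "q w \<le> \<rho>" "x = P i \<otimes> w" unfolding A_def by auto
    then show "x \<in> X" using mult_le[of "P i" w] J(2,3)[OF that] unfolding X_def by auto
  qed
  \<comment> \<open>A point common to two translates exhibits \<open>P i - P j\<close> as a
    difference of two elements of the ball, whence the bound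
    \<open>2 * \<rho> + 2 * \<rho>\<close>.\<close>
  have close: "q (P i \<otimes> inv P j) \<le> 4 * \<rho>" if h: "i \<in> J" "j \<in> J" "x \<in> A i" "x \<in> A j" for i j x
  proof -
    obtain w where w: "w \<in> carrier G" "q w \<le> \<rho>" "x = P i \<otimes> w" using h(3) unfolding A_def by auto
    obtain v where v: "v \<in> carrier G" "q v \<le> \<rho>" "x = P j \<otimes> v" using h(4) unfolding A_def by auto
    have c: "P i \<in> carrier G" "P j \<in> carrier G" using J h by auto
    have "P i \<otimes> inv P j = v \<otimes> inv w"
      using c w v by (intro mult_eq_mult_div_eq) auto
    then show ?thesis using q_div_le[of v w] w v by simp
  qed
  have "(\<Sum>i\<in>J. card (A i)) \<le> 2 * card X"
  proof (rule card_le_sum_multiplicity[OF J(1) finX AX])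
    fix x assume "x \<in> X"
    show "card {i \<in> J. x \<in> A i} \<le> 2"
    proof (rule ccontr)
      assume "\<not> card {i \<in> J. x \<in> A i} \<le> 2"
      then have "card {i \<in> J. x \<in> A i} > 2" by simp
      then obtain i j l where ijl: "i \<in> {i \<in> J. x \<in> A i}" "j \<in> {i \<in> J. x \<in> A i}"
        "l \<in> {i \<in> J. x \<in> A i}" "i \<noteq> j" "i \<noteq> l" "j \<noteq> l"
        by (rule three_elements)
      then show False using sep[of i j l] close[of i j x] close[of i l x] close[of j l x] by auto
    qed
  qed
  then have "card J * N \<le> 2 * card X" using cA by simp
  \<comment> \<open>The translates lie in the ball of radius \<open>2 * (B + \<rho>)\<close>; the
    factor 8 in \<open>card_ball_le\<close> turns this into the 16 of the hypothesis on
    \<open>k\<close>.\<close>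
  also have "card X \<le> 2 ^ (r * k) * N"
    unfolding X_def N_def using k by (intro card_ball_le[OF rk]) simp
  finally have "card J * N \<le> (2 * 2 ^ (r * k)) * N" by simp
  then show ?thesis using N by simp
qed

end

section \<open>Heights on an integral short curve\<close>

lemma rat_reduced:
  obtains p d :: int where "d > 0" "coprime p d" "q = of_int p / of_int d"
    "hQ q = ln (real_of_int (max \<bar>p\<bar> d))"
proof -
  obtain p d where pd: "quotient_of q = (p, d)" by (cases "quotient_of q")
  have "d > 0" "coprime p d" "q = of_int p / of_int d"
    using quotient_of_denom_pos[OF pd] quotient_of_coprime[OF pd] quotient_of_div[OF pd] by auto
  then show thesis using that[of d p] pd unfolding hQ_def by simp
qed

lemma hQ_nonneg: "hQ q \<ge> 0"
proof -
  obtain p d :: int where "d > 0" "hQ q = ln (real_of_int (max \<bar>p\<bar> d))" by (rule rat_reduced)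
  then show ?thesis by simp
qed

text \<open>Passing to lowest terms can only shrink numerator and denominator, so formulas for sums
  and doubles give upper bounds without a gcd computation.\<close>

lemma hQ_fraction_le:
  assumes "q = of_int a / of_int b" "b \<noteq> 0" "real_of_int \<bar>a\<bar> \<le> M" "real_of_int \<bar>b\<bar> \<le> M"
  shows "hQ q \<le> ln M"
proof -
  obtain p d :: int where d: "d > 0" "coprime p d" "q = of_int p / of_int d"
    and h: "hQ q = ln (real_of_int (max \<bar>p\<bar> d))" by (rule rat_reduced)
  have "of_int (p * b) = (of_int (a * d) :: rat)"
    using assms(1,2) d by (simp add: field_simps)
  then have e: "p * b = a * d" by (simp only: of_int_eq_iff)
  have cp: "coprime d p" using d(2) by (simp add: coprime_commute)
  have "d dvd p * b" unfolding e by simp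
  then have "d dvd b" using cp by (simp add: coprime_dvd_mult_right_iff)
  then have "d \<le> \<bar>b\<bar>" using dvd_imp_le_int[of b d] assms(2) d(1) by simp
  moreover have "\<bar>p\<bar> \<le> \<bar>a\<bar>"
  proof (cases "a = 0")
    case True then show ?thesis using e assms(2) by simp
  next
    case False
    have "p dvd a * d" unfolding e[symmetric] by simp
    then have "p dvd a" using d(2) by (simp add: coprime_dvd_mult_left_iff)
    then show ?thesis using dvd_imp_le_int[of a p] False by simp
  qed
  ultimately have "max \<bar>p\<bar> d \<le> max \<bar>a\<bar> \<bar>b\<bar>" by (auto simp: max_def)
  then have "real_of_int (max \<bar>p\<bar> d) \<le> M" using assms(3,4) by linarith
  then show ?thesis unfolding h using d(1) by (intro ln_mono) auto
qed

lemma hQ_le_ln: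
  assumes "hQ q \<le> ln M" "M > 0" "d > 0" "coprime p d" "q = of_int p / of_int d"
  shows "real_of_int \<bar>p\<bar> \<le> M" "real_of_int d \<le> M"
proof -
  have "quotient_of q = (p, d)"
    using assms(3-5) by (simp add: Fract_of_int_quotient[symmetric] quotient_of_Fract normalize_stable)
  then have "ln (real_of_int (max \<bar>p\<bar> d)) \<le> ln M" using assms unfolding hQ_def by simp
  then have "real_of_int (max \<bar>p\<bar> d) \<le> M" using assms(2,3) by (subst (asm) ln_le_cancel_iff) auto
  then show "real_of_int \<bar>p\<bar> \<le> M" "real_of_int d \<le> M" by linarith+
qed

lemma finite_hQ_le: "finite {q. hQ q \<le> R}"
proof -
  define S where "S = {n :: int. \<bar>n\<bar> \<le> \<lfloor>exp R\<rfloor>}"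
  have "S = {- \<lfloor>exp R\<rfloor>..\<lfloor>exp R\<rfloor>}" unfolding S_def by auto
  then have "finite S" by simp
  moreover have "{q. hQ q \<le> R} \<subseteq> (\<lambda>(p, d). of_int p / of_int d) ` (S \<times> S)"
  proof
    fix q assume "q \<in> {q. hQ q \<le> R}"
    then have q: "hQ q \<le> ln (exp R)" by simp
    obtain p d :: int where d: "d > 0" "coprime p d" "q = of_int p / of_int d" by (rule rat_reduced)
    have "real_of_int \<bar>p\<bar> \<le> exp R" "real_of_int d \<le> exp R" using hQ_le_ln[OF q _ d] by auto
    then have "p \<in> S" "d \<in> S" using d(1) unfolding S_def by (auto simp: le_floor_iff)
    then show "q \<in> (\<lambda>(p, d). of_int p / of_int d) ` (S \<times> S)" using d(3) by force
  qed
  ultimately show ?thesis using finite_subset by blast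
qed

lemma rat_int_of_square:
  fixes w :: rat assumes "w ^ 2 = of_int n" obtains v where "w = of_int v"
proof -
  obtain p d :: int where d: "d > 0" "coprime p d" "w = of_int p / of_int d" by (rule rat_reduced)
  have "of_int (p ^ 2) = (of_int (n * d ^ 2) :: rat)"
    using assms d by (simp add: field_simps power2_eq_square)
  then have "p ^ 2 = n * d ^ 2" by (simp only: of_int_eq_iff)
  then have "d ^ 2 dvd p ^ 2" by simp
  then have "d dvd p" by simp
  then have "is_unit d" using d(2) coprime_common_divisor[of p d d] by simp
  then have "d = 1" using d(1) by simp
  then show thesis using that d by simp
qed

lemma abs_mult_le:
  fixes x y :: "'a::linordered_idom"
  assumes "\<bar>x\<bar> \<le> a" "\<bar>y\<bar> \<le> b" shows "\<bar>x * y\<bar> \<le> a * b"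
  unfolding abs_mult by (rule mult_mono) (use assms in auto)

lemma abs_power_le:
  fixes x :: "'a::linordered_idom"
  assumes "\<bar>x\<bar> \<le> a" shows "\<bar>x ^ n\<bar> \<le> a ^ n"
  unfolding power_abs by (rule power_mono) (use assms in auto)

lemma abs_linear_combination_le:
  fixes u v f g :: "'a::linordered_idom"
  assumes "\<bar>u\<bar> \<le> A" "\<bar>v\<bar> \<le> B" "\<bar>f\<bar> \<le> M" "\<bar>g\<bar> \<le> N"
  shows "\<bar>u * f + v * g\<bar> \<le> A * M + B * N" "\<bar>u * f - v * g\<bar> \<le> A * M + B * N"
  using abs_mult_le[OF assms(1,3)] abs_mult_le[OF assms(2,4)] by linarith+

definition curve_group :: "rat \<Rightarrow> rat \<Rightarrow> point monoid" where
  "curve_group a b = \<lparr>carrier = {P. on_curve (short a b) P}, monoid.mult = padd (short a b), one = Inf\<rparr>"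

lemma comm_group_curve_group:
  assumes "elliptic (short a b)" shows "comm_group (curve_group a b)"
proof (rule comm_groupI)
  fix x assume "x \<in> carrier (curve_group a b)"
  then show "\<exists>y\<in>carrier (curve_group a b). y \<otimes>\<^bsub>curve_group a b\<^esub> x = \<one>\<^bsub>curve_group a b\<^esub>"
    using on_curve_pneg_short padd_short_comm padd_pneg_short
    unfolding curve_group_def by (intro bexI[of _ "pneg (short a b) x"]) auto
qed (use assms on_curve_padd_short padd_short_assoc padd_short_comm in \<open>auto simp: curve_group_def\<close>)

locale integral_curve =
  fixes a b :: int
  assumes nonsingular: "4 * a ^ 3 + 27 * b ^ 2 \<noteq> 0"
begin

abbreviation "E \<equiv> short (of_int a) (of_int b)"
abbreviation "G \<equiv> curve_group (of_int a) (of_int b)"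

definition K :: int where "K = max 1 (max \<bar>a\<bar> \<bar>b\<bar>)"
text \<open>The summand 1 lets numerical constants be absorbed, so that all error terms are
  multiples of \<open>cst\<close>.\<close>

definition cst :: real where "cst = 1 + ln K"

lemma K: "K \<ge> 1" "\<bar>a\<bar> \<le> K" "\<bar>b\<bar> \<le> K"
  unfolding K_def by auto

lemma cst_ge_1: "cst \<ge> 1"
  using K(1) unfolding cst_def by simp

lemma elliptic_E: "elliptic E"
proof -
  have "disc E = of_int (- 16 * (4 * a ^ 3 + 27 * b ^ 2))"
    unfolding discriminant_short by simp
  then show ?thesis using nonsingular unfolding elliptic_def by (simp only: of_int_eq_0_iff) simp
qed

sublocale comm_group G
  by (rule comm_group_curve_group[OF elliptic_E])

lemma carrier_G [simp]: "P \<in> carrier G \<longleftrightarrow> on_curve E P"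
  and mult_G: "x \<otimes>\<^bsub>G\<^esub> y = padd E x y"
  and one_G: "\<one>\<^bsub>G\<^esub> = Inf"
  by (simp_all add: curve_group_def)

lemma inv_G: "on_curve E P \<Longrightarrow> inv\<^bsub>G\<^esub> P = pneg E P"
  by (rule inv_equality) (auto simp: mult_G one_G on_curve_pneg_short padd_pneg_short
      padd_short_comm[OF on_curve_pneg_short])

lemma pmult_G: "on_curve E P \<Longrightarrow> pmult E n P = P [^]\<^bsub>G\<^esub> n"
proof (induction n)
  case (Suc n)
  then show ?case using nat_pow_Suc2[of P n] by (simp add: mult_G)
qed (simp add: one_G)

lemma abs_cubic_le:
  fixes m n H :: int
  assumes "\<bar>m\<bar> \<le> H" "\<bar>n\<bar> \<le> H"
  shows "\<bar>m ^ 3 + a * m * n ^ 2 + b * n ^ 3\<bar> \<le> 3 * K * H ^ 3"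
proof -
  have H: "H \<ge> 0" using assms by linarith
  have "\<bar>m ^ 3\<bar> \<le> H ^ 3" using assms(1) by (rule abs_power_le)
  moreover have "H ^ 3 \<le> K * H ^ 3" using K H by (simp add: mult_le_cancel_right1)
  moreover have "\<bar>a * m * n ^ 2\<bar> \<le> K * H * H ^ 2"
    using assms K by (intro abs_mult_le abs_power_le)
  moreover have "\<bar>b * n ^ 3\<bar> \<le> K * H ^ 3"
    using assms K by (intro abs_mult_le abs_power_le)
  moreover have "K * H * H ^ 2 = K * H ^ 3" by (simp add: power2_eq_square power3_eq_cube)
  ultimately show ?thesis by linarith
qed

text \<open>Multiplied by \<open>n ^ 4\<close> the equation shows that \<open>y * n ^ 2\<close> is a
  rational number with integral square, hence an integer. The resulting fraction for
  \<open>y\<close> is in general not reduced.\<close>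

lemma rational_point:
  assumes "on_curve E (Aff x y)"
  obtains m n v :: int where "n > 0" "coprime m n" "x = of_int m / of_int n"
    "hQ x = ln (real_of_int (max \<bar>m\<bar> n))" "y * of_int n ^ 2 = of_int v"
    "v ^ 2 = n * (m ^ 3 + a * m * n ^ 2 + b * n ^ 3)"
proof -
  obtain m n :: int where mn: "n > 0" "coprime m n" "x = of_int m / of_int n"
    "hQ x = ln (real_of_int (max \<bar>m\<bar> n))" by (rule rat_reduced)
  have "y ^ 2 = x ^ 3 + of_int a * x + of_int b" using assms by simp
  then have e: "(y * of_int n ^ 2) ^ 2 = of_int (n * (m ^ 3 + a * m * n ^ 2 + b * n ^ 3))"
    using mn(1) unfolding mn(3) power_mult_distrib
    by (simp add: field_simps power2_eq_square power3_eq_cube)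
  obtain v where v: "y * of_int n ^ 2 = of_int v" by (rule rat_int_of_square[OF e])
  have "of_int (v ^ 2) = (of_int (n * (m ^ 3 + a * m * n ^ 2 + b * n ^ 3)) :: rat)"
    using e unfolding v by simp
  then have "v ^ 2 = n * (m ^ 3 + a * m * n ^ 2 + b * n ^ 3)" by (simp only: of_int_eq_iff)
  then show thesis using that[OF mn v] by blast
qed

section \<open>The height of the double of a point\<close>

lemma hpt_nonneg: "hpt P \<ge> 0"
  by (cases P) (auto simp: hQ_nonneg)

text \<open>Together with \<open>dupG\<close> the homogenised numerator and denominator of
  \<open>x(2P)\<close> for \<open>x(P) = m / n\<close>.\<close>

definition dupF :: "int \<Rightarrow> int \<Rightarrow> int" where
  "dupF m n = m ^ 4 - 2 * a * m ^ 2 * n ^ 2 - 8 * b * m * n ^ 3 + a ^ 2 * n ^ 4"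

definition dupG :: "int \<Rightarrow> int \<Rightarrow> int" where
  "dupG m n = 4 * (n * (m ^ 3 + a * m * n ^ 2 + b * n ^ 3))"

definition D :: int where "D = 4 * a ^ 3 + 27 * b ^ 2"

lemma monomial_bound:
  fixes m n H :: int
  assumes "\<bar>m\<bar> \<le> H" "\<bar>n\<bar> \<le> H" "i + j \<le> e" "k + l = d"
  shows "\<bar>a ^ i * b ^ j * m ^ k * n ^ l\<bar> \<le> K ^ e * H ^ d"
proof -
  have H: "H \<ge> 0" using assms by linarith
  have "\<bar>a ^ i * b ^ j * m ^ k * n ^ l\<bar> \<le> K ^ i * K ^ j * H ^ k * H ^ l"
    using K assms by (intro abs_mult_le abs_power_le)
  also have "\<dots> = K ^ (i + j) * H ^ d" using assms(4) by (auto simp: power_add)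
  also have "\<dots> \<le> K ^ e * H ^ d"
    using K(1) assms(3) H by (intro mult_right_mono power_increasing) auto
  finally show ?thesis .
qed

lemma dup_upper:
  assumes "\<bar>m\<bar> \<le> H" "\<bar>n\<bar> \<le> H"
  shows "\<bar>dupF m n\<bar> \<le> 12 * K ^ 2 * H ^ 4" "\<bar>dupG m n\<bar> \<le> 16 * K ^ 2 * H ^ 4"
  using monomial_bound[OF assms, of 0 0 2 4 0 4] monomial_bound[OF assms, of 1 0 2 2 2 4]
    monomial_bound[OF assms, of 0 1 2 1 3 4] monomial_bound[OF assms, of 2 0 2 0 4 4]
    monomial_bound[OF assms, of 0 0 2 3 1 4] monomial_bound[OF assms, of 1 0 2 1 3 4]
    monomial_bound[OF assms, of 0 1 2 0 4 4]
  unfolding dupF_def dupG_def by (simp_all add: algebra_simps power_numeral_reduce)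

text \<open>The two binary quartics have no common zero because \<open>D\<close> is nonzero, and
  these are the resulting Bezout identities for \<open>n ^ 7\<close> and \<open>m ^ 7\<close>. They
  bound the quartics from below and also limit their common divisors.\<close>

lemma dup_bezout:
  "(12 * m ^ 2 * n + 16 * a * n ^ 3) * dupF m n -
     (3 * m ^ 3 - 5 * a * m * n ^ 2 - 27 * b * n ^ 3) * dupG m n = 4 * D * n ^ 7"
  "(4 * D * m ^ 3 - 4 * a ^ 2 * b * m ^ 2 * n + 4 * a * (3 * a ^ 3 + 22 * b ^ 2) * m * n ^ 2
      + 12 * b * (a ^ 3 + 8 * b ^ 2) * n ^ 3) * dupF m n +
    (a ^ 2 * b * m ^ 3 + a * (5 * a ^ 3 + 32 * b ^ 2) * m ^ 2 * n
      + 2 * b * (13 * a ^ 3 + 96 * b ^ 2) * m * n ^ 2 - 3 * a ^ 2 * (a ^ 3 + 8 * b ^ 2) * n ^ 3) * dupG m n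
    = 4 * D * m ^ 7"
  unfolding dupF_def dupG_def D_def by algebra+

text \<open>The cofactors in the Bezout identities are bounded monomial by monomial. Whichever of
  \<open>n\<close> and \<open>\<bar>m\<bar>\<close> equals \<open>H\<close> gives a bound for
  \<open>H ^ 7\<close>, from which \<open>H ^ 3\<close> cancels. The factor \<open>D\<close> is
  kept, to be cancelled against common divisors.\<close>

lemma dup_lower:
  assumes "H = max \<bar>m\<bar> n" "n > 0" "\<bar>dupF m n\<bar> \<le> M" "\<bar>dupG m n\<bar> \<le> M"
  shows "4 * \<bar>D\<bar> * H ^ 4 \<le> 700 * K ^ 5 * M"
proof -
  have mn: "\<bar>m\<bar> \<le> H" "\<bar>n\<bar> \<le> H" and H: "H > 0" using assms by auto
  let ?B = "K ^ 5 * H ^ 3"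
  note mb = monomial_bound[OF mn, where e = 5 and d = 3]
  have n7: "\<bar>4 * D * n ^ 7\<bar> \<le> (28 * ?B) * M + (35 * ?B) * M"
  proof -
    have "\<bar>12 * m ^ 2 * n + 16 * a * n ^ 3\<bar> \<le> 28 * ?B"
      using mb[of 0 0 2 1] mb[of 1 0 0 3] by (simp add: algebra_simps)
    moreover have "\<bar>3 * m ^ 3 - 5 * a * m * n ^ 2 - 27 * b * n ^ 3\<bar> \<le> 35 * ?B"
      using mb[of 0 0 3 0] mb[of 1 0 1 2] mb[of 0 1 0 3] by (simp add: algebra_simps)
    ultimately show ?thesis unfolding dup_bezout(1)[of m n, symmetric]
      using assms(3,4) by (intro abs_linear_combination_le(2))
  qed
  have m7: "\<bar>4 * D * m ^ 7\<bar> \<le> (336 * ?B) * M + (283 * ?B) * M"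
  proof -
    have te1: "\<bar>a ^ 3 * b ^ 0 * m ^ 3 * n ^ 0\<bar> \<le> ?B" "\<bar>a ^ 0 * b ^ 2 * m ^ 3 * n ^ 0\<bar> \<le> ?B"
      "\<bar>a ^ 2 * b ^ 1 * m ^ 2 * n ^ 1\<bar> \<le> ?B" "\<bar>a ^ 4 * b ^ 0 * m ^ 1 * n ^ 2\<bar> \<le> ?B"
      "\<bar>a ^ 1 * b ^ 2 * m ^ 1 * n ^ 2\<bar> \<le> ?B" "\<bar>a ^ 3 * b ^ 1 * m ^ 0 * n ^ 3\<bar> \<le> ?B"
      "\<bar>a ^ 0 * b ^ 3 * m ^ 0 * n ^ 3\<bar> \<le> ?B"
      by (rule mb; simp)+
    have e1: "4 * D * m ^ 3 - 4 * a ^ 2 * b * m ^ 2 * n + 4 * a * (3 * a ^ 3 + 22 * b ^ 2) * m * n ^ 2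
      + 12 * b * (a ^ 3 + 8 * b ^ 2) * n ^ 3 =
        16 * (a ^ 3 * b ^ 0 * m ^ 3 * n ^ 0)
          + 108 * (a ^ 0 * b ^ 2 * m ^ 3 * n ^ 0) - 4 * (a ^ 2 * b ^ 1 * m ^ 2 * n ^ 1)
          + 12 * (a ^ 4 * b ^ 0 * m ^ 1 * n ^ 2)
          + 88 * (a ^ 1 * b ^ 2 * m ^ 1 * n ^ 2) + 12 * (a ^ 3 * b ^ 1 * m ^ 0 * n ^ 3) + 96 * (a ^ 0 * b ^ 3 * m ^ 0 * n ^ 3)"
      unfolding D_def by (simp add: algebra_simps power_numeral_reduce)
    have f: "\<bar>4 * D * m ^ 3 - 4 * a ^ 2 * b * m ^ 2 * n + 4 * a * (3 * a ^ 3 + 22 * b ^ 2) * m * n ^ 2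
      + 12 * b * (a ^ 3 + 8 * b ^ 2) * n ^ 3\<bar> \<le> 336 * ?B"
      unfolding e1 using te1 by linarith
    have te2: "\<bar>a ^ 2 * b ^ 1 * m ^ 3 * n ^ 0\<bar> \<le> ?B" "\<bar>a ^ 4 * b ^ 0 * m ^ 2 * n ^ 1\<bar> \<le> ?B"
      "\<bar>a ^ 1 * b ^ 2 * m ^ 2 * n ^ 1\<bar> \<le> ?B" "\<bar>a ^ 3 * b ^ 1 * m ^ 1 * n ^ 2\<bar> \<le> ?B"
      "\<bar>a ^ 0 * b ^ 3 * m ^ 1 * n ^ 2\<bar> \<le> ?B" "\<bar>a ^ 5 * b ^ 0 * m ^ 0 * n ^ 3\<bar> \<le> ?B"
      "\<bar>a ^ 2 * b ^ 2 * m ^ 0 * n ^ 3\<bar> \<le> ?B"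
      by (rule mb; simp)+
    have e2: "a ^ 2 * b * m ^ 3 + a * (5 * a ^ 3 + 32 * b ^ 2) * m ^ 2 * n
      + 2 * b * (13 * a ^ 3 + 96 * b ^ 2) * m * n ^ 2 - 3 * a ^ 2 * (a ^ 3 + 8 * b ^ 2) * n ^ 3 =
        1 * (a ^ 2 * b ^ 1 * m ^ 3 * n ^ 0)
          + 5 * (a ^ 4 * b ^ 0 * m ^ 2 * n ^ 1)
          + 32 * (a ^ 1 * b ^ 2 * m ^ 2 * n ^ 1)
          + 26 * (a ^ 3 * b ^ 1 * m ^ 1 * n ^ 2) + 192 * (a ^ 0 * b ^ 3 * m ^ 1 * n ^ 2) - 3 * (a ^ 5 * b ^ 0 * m ^ 0 * n ^ 3) - 24 * (a ^ 2 * b ^ 2 * m ^ 0 * n ^ 3)"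
      by (simp add: algebra_simps power_numeral_reduce)
    have g: "\<bar>a ^ 2 * b * m ^ 3 + a * (5 * a ^ 3 + 32 * b ^ 2) * m ^ 2 * n
      + 2 * b * (13 * a ^ 3 + 96 * b ^ 2) * m * n ^ 2 - 3 * a ^ 2 * (a ^ 3 + 8 * b ^ 2) * n ^ 3\<bar> \<le> 283 * ?B"
      unfolding e2 using te2 by linarith
    show ?thesis unfolding dup_bezout(2)[of m n, symmetric]
      using f g assms(3,4) by (intro abs_linear_combination_le(1))
  qed
  have M: "M \<ge> 0" using assms(3) by linarith
  have B: "?B * M \<ge> 0" using K(1) H M by simp
  \<comment> \<open>The bounds for the cofactors add up to 28 + 35 in the first identity and 336 +
    283 in the second; 700 exceeds both totals.\<close>
  have "4 * \<bar>D\<bar> * H ^ 7 \<le> 700 * (?B * M)"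
  proof (cases "H = n")
    case True
    then have "4 * \<bar>D\<bar> * H ^ 7 = \<bar>4 * D * n ^ 7\<bar>" using assms(2) by (simp add: abs_mult)
    then show ?thesis using n7 B by linarith
  next
    case False
    then have "H = \<bar>m\<bar>" using assms(1) by linarith
    then have "4 * \<bar>D\<bar> * H ^ 7 = \<bar>4 * D * m ^ 7\<bar>" by (simp add: abs_mult power_abs)
    then show ?thesis using m7 B by linarith
  qed
  then have "(4 * \<bar>D\<bar> * H ^ 4) * H ^ 3 \<le> (700 * K ^ 5 * M) * H ^ 3"
    by (simp add: algebra_simps power_numeral_reduce)
  then show ?thesis using H by simp
qed

text \<open>By the Bezout identities \<open>g\<close> divides \<open>4 * D * n ^ 7\<close> and
  \<open>4 * D * m ^ 7\<close>, where \<open>m\<close> and \<open>n\<close> are coprime.\<close>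

lemma dup_common_divisor:
  assumes "coprime m n" "g dvd dupF m n" "g dvd dupG m n"
  shows "\<bar>g\<bar> \<le> 4 * \<bar>D\<bar>"
proof -
  have "g dvd 4 * D * n ^ 7" "g dvd 4 * D * m ^ 7"
    unfolding dup_bezout[of m n, symmetric] using assms(2,3) by (auto intro!: dvd_diff dvd_add dvd_mult)
  then have "g dvd gcd (4 * D * n ^ 7) (4 * D * m ^ 7)" by simp
  also have "gcd (4 * D * n ^ 7) (4 * D * m ^ 7) = normalize (4 * D)"
  proof -
    have "gcd (n ^ 7) (m ^ 7) = 1" using assms(1) by (simp add: coprime_commute)
    then show ?thesis by (simp add: gcd_mult_left)
  qed
  finally have "g dvd 4 * D" by simp
  moreover have "4 * D \<noteq> 0" using nonsingular unfolding D_def by simp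
  ultimately have "\<bar>g\<bar> \<le> \<bar>4 * D\<bar>" by (intro dvd_imp_le_int)
  then show ?thesis by (simp add: abs_mult)
qed

lemma ln_K_nonneg: "ln (real_of_int K) \<ge> 0"
  using K(1) by simp

text \<open>\<open>ln c \<le> c\<close> and \<open>e \<le> c\<close> are generous estimates, but
  they leave one constant instead of two.\<close>

lemma ln_const_K_le:
  assumes "c \<ge> 1" "real e \<le> c" shows "ln (c * real_of_int K ^ e) \<le> c * cst"
proof -
  have "ln (c * real_of_int K ^ e) = ln c + e * ln K"
    using K(1) assms by (simp add: ln_mult ln_realpow)
  also have "\<dots> \<le> c + c * ln K"
    using ln_le_minus_one[of c] assms ln_K_nonneg by (intro add_mono mult_right_mono) auto
  finally show ?thesis unfolding cst_def by (simp add: algebra_simps)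
qed

lemma hpt_double:
  assumes on: "on_curve E P" shows "\<bar>hpt (padd E P P) - 4 * hpt P\<bar> \<le> 700 * cst"
proof (cases P)
  case Inf
  then show ?thesis using cst_ge_1 by simp
next
  case (Aff x y)
  obtain m n v :: int where n: "n > 0" and cop: "coprime m n" and x: "x = of_int m / of_int n"
    and hx: "hQ x = ln (real_of_int (max \<bar>m\<bar> n))" and v: "y * of_int n ^ 2 = of_int v"
    and v2: "v ^ 2 = n * (m ^ 3 + a * m * n ^ 2 + b * n ^ 3)"
    using rational_point on unfolding Aff by blast
  define H where "H = max \<bar>m\<bar> n"
  have H: "H \<ge> 1" "\<bar>m\<bar> \<le> H" "\<bar>n\<bar> \<le> H" using n unfolding H_def by auto
  have hP: "hpt P = ln (real_of_int H)" using Aff hx H_def by simp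
  have D0: "D \<noteq> 0" using nonsingular unfolding D_def .
  show ?thesis
  \<comment> \<open>When \<open>2P = Inf\<close>, whose height is 0, the height of \<open>P\<close>
    itself must be bounded. Here \<open>dupG\<close> vanishes, so \<open>dupF\<close> counts as a
    common divisor of both and is at most \<open>4 * \<bar>D\<bar>\<close>.\<close>
  proof (cases "y = 0")
    case True
    then have v0: "v = 0" using v by simp
    have G0: "dupG m n = 0" unfolding dupG_def v2[symmetric] v0 by simp
    have "\<bar>dupF m n\<bar> \<le> 4 * \<bar>D\<bar>" using dup_common_divisor[OF cop, of "dupF m n"] G0 by simp
    then have "4 * \<bar>D\<bar> * H ^ 4 \<le> 700 * K ^ 5 * (4 * \<bar>D\<bar>)"
      using dup_lower[OF H_def n, of "4 * \<bar>D\<bar>"] G0 by simp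
    then have "(4 * \<bar>D\<bar>) * H ^ 4 \<le> (4 * \<bar>D\<bar>) * (700 * K ^ 5)" by (simp only: mult.commute)
    then have "H ^ 4 \<le> 700 * K ^ 5" using D0 by simp
    then have "real_of_int (H ^ 4) \<le> real_of_int (700 * K ^ 5)" by (simp only: of_int_le_iff)
    then have "real_of_int H ^ 4 \<le> 700 * real_of_int K ^ 5" by simp
    then have "ln (real_of_int H ^ 4) \<le> ln (700 * real_of_int K ^ 5)" using H(1) by (intro ln_mono) auto
    then have "4 * hpt P \<le> 700 * cst"
      using ln_const_K_le[of 700 5] H(1) unfolding hP by (simp add: ln_realpow)
    moreover have "padd E P P = Inf" using Aff True by simp
    ultimately show ?thesis using hpt_nonneg[of P] by simp
  next
    case False
    then have v0: "v \<noteq> 0" using v n by auto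
    then have G0: "dupG m n \<noteq> 0" unfolding dupG_def v2[symmetric] by simp
    have y2: "y ^ 2 = x ^ 3 + of_int a * x + of_int b" using on Aff by simp
    define l where "l = (3 * x ^ 2 + of_int a) / (2 * y)"
    have "slope (of_int a) x y x y l"
      using False unfolding slope_def l_def by (simp add: field_simps power2_eq_square)
    then have "padd E P P = Aff (l ^ 2 - x - x) (l * (x - (l ^ 2 - x - x)) - y)"
      using padd_short_slope[of "of_int a" "of_int b" x y x y l] on Aff False by simp
    moreover have "l ^ 2 - x - x = of_int (dupF m n) / of_int (dupG m n)"
    proof -
      have G: "of_int (dupG m n) = 4 * y ^ 2 * of_int n ^ 4"
        unfolding dupG_def v2[symmetric] of_int_mult of_int_power of_int_numeral v[symmetric] by algebra
      have "(l ^ 2 - x - x) * (4 * y ^ 2) = (3 * x ^ 2 + of_int a) ^ 2 - 8 * x * y ^ 2"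
        unfolding l_def using False by (simp add: field_simps power2_eq_square)
      also have "\<dots> = x ^ 4 - 2 * of_int a * x ^ 2 - 8 * of_int b * x + of_int a ^ 2"
        unfolding y2 by algebra
      finally have "(l ^ 2 - x - x) * (4 * y ^ 2 * of_int n ^ 4) =
          (x * of_int n) ^ 4 - 2 * of_int a * (x * of_int n) ^ 2 * of_int n ^ 2
          - 8 * of_int b * (x * of_int n) * of_int n ^ 3 + of_int a ^ 2 * of_int n ^ 4"
        by algebra
      also have "x * of_int n = of_int m" using n unfolding x by simp
      finally have "(l ^ 2 - x - x) * of_int (dupG m n) = of_int (dupF m n)"
        unfolding G dupF_def by simp
      then show ?thesis using G0 by (simp add: field_simps)
    qed
    ultimately have h2: "hpt (padd E P P) = hQ (of_int (dupF m n) / of_int (dupG m n))"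
      (is "_ = hQ ?z") by simp
    have "real_of_int \<bar>dupF m n\<bar> \<le> real_of_int (16 * K ^ 2 * H ^ 4)"
      "real_of_int \<bar>dupG m n\<bar> \<le> real_of_int (16 * K ^ 2 * H ^ 4)"
    proof -
      have "0 \<le> K ^ 2 * H ^ 4" using K(1) H(1) by simp
      then show "real_of_int \<bar>dupF m n\<bar> \<le> real_of_int (16 * K ^ 2 * H ^ 4)"
        "real_of_int \<bar>dupG m n\<bar> \<le> real_of_int (16 * K ^ 2 * H ^ 4)"
        using dup_upper[OF H(2,3)] by (simp_all only: of_int_le_iff)
    qed
    then have "hQ ?z \<le> ln (real_of_int (16 * K ^ 2 * H ^ 4))"
      by (intro hQ_fraction_le[OF refl G0])
    also have "\<dots> = ln (16 * real_of_int K ^ 2) + 4 * hpt P"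
      using K(1) H(1) unfolding hP by (simp add: ln_mult ln_realpow)
    also have "\<dots> \<le> 700 * cst + 4 * hpt P" using ln_const_K_le[of 16 2] cst_ge_1 by simp
    finally have up: "hpt (padd E P P) \<le> 700 * cst + 4 * hpt P" unfolding h2 .
    \<comment> \<open>For the lower bound the fraction is reduced: the cancelled factor
      \<open>g\<close> is at most \<open>4 * \<bar>D\<bar>\<close>, which removes the discriminant
      from \<open>dup_lower\<close>.\<close>
    obtain p d :: int where d: "d > 0" "coprime p d" and z: "?z = of_int p / of_int d"
      and hz: "hQ ?z = ln (real_of_int (max \<bar>p\<bar> d))" by (rule rat_reduced)
    define H2 where "H2 = max \<bar>p\<bar> d"
    have H2: "H2 \<ge> 1" "\<bar>p\<bar> \<le> H2" "\<bar>d\<bar> \<le> H2" using d unfolding H2_def by auto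
    have "of_int (dupF m n * d) = (of_int (p * dupG m n) :: rat)"
      using z G0 d(1) by (simp add: field_simps)
    then have e: "dupF m n * d = p * dupG m n" by (simp only: of_int_eq_iff)
    have "d dvd p * dupG m n" unfolding e[symmetric] by simp
    then have "d dvd dupG m n"
      using d(2) by (simp add: coprime_dvd_mult_right_iff coprime_commute)
    then obtain g where g: "dupG m n = d * g" by (rule dvdE)
    then have "d * dupF m n = d * (p * g)" using e by (simp add: algebra_simps)
    then have gF: "dupF m n = p * g" using d(1) by simp
    have gD: "\<bar>g\<bar> \<le> 4 * \<bar>D\<bar>" by (rule dup_common_divisor[OF cop]) (simp_all add: g gF)
    have "\<bar>dupF m n\<bar> \<le> H2 * (4 * \<bar>D\<bar>)" "\<bar>dupG m n\<bar> \<le> H2 * (4 * \<bar>D\<bar>)"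
      unfolding g gF using H2 gD by (auto intro!: abs_mult_le)
    then have "4 * \<bar>D\<bar> * H ^ 4 \<le> 700 * K ^ 5 * (H2 * (4 * \<bar>D\<bar>))" by (rule dup_lower[OF H_def n])
    also have "\<dots> = (4 * \<bar>D\<bar>) * (700 * K ^ 5 * H2)" by (simp only: ac_simps)
    finally have "H ^ 4 \<le> 700 * K ^ 5 * H2" by (rule mult_left_le_imp_le) (use D0 in simp)
    then have "real_of_int (H ^ 4) \<le> real_of_int (700 * K ^ 5 * H2)" by (simp only: of_int_le_iff)
    then have "ln (real_of_int (H ^ 4)) \<le> ln (real_of_int (700 * K ^ 5 * H2))"
      using H(1) by (intro ln_mono) auto
    also have "\<dots> = ln (700 * real_of_int K ^ 5) + ln (real_of_int H2)"
      using K(1) H2(1) by (simp add: ln_mult)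
    also have "\<dots> \<le> 700 * cst + ln (real_of_int H2)" using ln_const_K_le[of 700 5] by simp
    finally have "4 * hpt P \<le> 700 * cst + hpt (padd E P P)"
      using H(1) unfolding hP h2 hz H2_def[symmetric] by (simp add: ln_realpow)
    then show ?thesis using up by simp
  qed
qed

end

section \<open>The height of a sum\<close>

context integral_curve
begin

lemma abs_ordinate_le:
  fixes m n v H :: int
  assumes "v ^ 2 = n * (m ^ 3 + a * m * n ^ 2 + b * n ^ 3)" "\<bar>m\<bar> \<le> H" "\<bar>n\<bar> \<le> H"
  shows "\<bar>v\<bar> \<le> 2 * K * H ^ 2"
proof -
  have H: "H \<ge> 0" using assms by linarith
  have "\<bar>v ^ 2\<bar> \<le> H * (3 * K * H ^ 3)"
    unfolding assms(1) by (intro abs_mult_le abs_cubic_le assms)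
  then have "v ^ 2 \<le> 3 * (K * H ^ 4)" by (simp add: power_numeral_reduce algebra_simps)
  also have "\<dots> \<le> 4 * (K ^ 2 * H ^ 4)"
  proof -
    have "K * H ^ 4 \<le> K ^ 2 * H ^ 4"
      using K(1) H by (intro mult_right_mono) (auto simp: power2_eq_square)
    moreover have "0 \<le> K ^ 2 * H ^ 4" by simp
    ultimately show ?thesis by linarith
  qed
  also have "\<dots> = (2 * K * H ^ 2) ^ 2" by (simp add: power_mult_distrib power_numeral_reduce)
  finally show ?thesis using K(1) H by (simp add: abs_le_square_iff[symmetric])
qed

text \<open>By the curve equation the squared ordinates disappear from
  \<open>(x - x') ^ 2 * x(P + Q)\<close>, leaving
  \<open>(x * x' + a) * (x + x') + 2 * b - 2 * y * y'\<close>. Its homogeneous form is at most a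
  constant times \<open>K ^ 2 * H ^ 2 * H' ^ 2\<close>, whence the factors 2 before the
  heights.\<close>

lemma hpt_add_distinct:
  assumes on: "on_curve E (Aff x y)" "on_curve E (Aff x' y')" and ne: "x \<noteq> x'"
  shows "hpt (padd E (Aff x y) (Aff x' y')) \<le> 2 * hQ x + 2 * hQ x' + 700 * cst"
proof -
  obtain m n v :: int where n: "n > 0" and x: "x = of_int m / of_int n"
    and hx: "hQ x = ln (real_of_int (max \<bar>m\<bar> n))" and v: "y * of_int n ^ 2 = of_int v"
    and v2: "v ^ 2 = n * (m ^ 3 + a * m * n ^ 2 + b * n ^ 3)"
    using rational_point[OF on(1)] by blast
  obtain m' n' v' :: int where n': "n' > 0" and x': "x' = of_int m' / of_int n'"
    and hx': "hQ x' = ln (real_of_int (max \<bar>m'\<bar> n'))" and v': "y' * of_int n' ^ 2 = of_int v'"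
    and v2': "v' ^ 2 = n' * (m' ^ 3 + a * m' * n' ^ 2 + b * n' ^ 3)"
    using rational_point[OF on(2)] by blast
  define H where "H = max \<bar>m\<bar> n"
  define H' where "H' = max \<bar>m'\<bar> n'"
  have H: "H \<ge> 1" "\<bar>m\<bar> \<le> H" "\<bar>n\<bar> \<le> H" using n unfolding H_def by auto
  have H': "H' \<ge> 1" "\<bar>m'\<bar> \<le> H'" "\<bar>n'\<bar> \<le> H'" using n' unfolding H'_def by auto
  define N where "N = (m * m' + a * (n * n')) * (m * n' + m' * n) + 2 * b * (n * n') ^ 2 - 2 * (v * v')"
  define M where "M = (m * n' - m' * n) ^ 2"
  have M0: "M \<noteq> 0"
  proof
    assume "M = 0"
    then have "m * n' = m' * n" unfolding M_def by simp
    then have "of_int (m * n') = (of_int (m' * n) :: rat)" by simp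
    then show False using ne n n' unfolding x x' by (simp add: field_simps)
  qed
  obtain l where sl: "slope (of_int a) x y x' y' l" using slope_exists[OF on] ne by blast
  have P: "padd E (Aff x y) (Aff x' y') = Aff (l ^ 2 - x - x') (l * (x - (l ^ 2 - x - x')) - y)"
    using padd_short_slope[OF on sl] ne by blast
  have "(l ^ 2 - x - x') * (x - x') ^ 2 = (x * x' + of_int a) * (x + x') + 2 * of_int b - 2 * y * y'"
    using sl on unfolding slope_def on_curve.simps short_simps by algebra
  then have "(l ^ 2 - x - x') * (x * of_int n * of_int n' - x' * of_int n' * of_int n) ^ 2 =
     ((x * of_int n) * (x' * of_int n') + of_int a * (of_int n * of_int n'))
      * ((x * of_int n) * of_int n' + (x' * of_int n') * of_int n)
      + 2 * of_int b * (of_int n * of_int n') ^ 2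
      - 2 * ((y * of_int n ^ 2) * (y' * of_int n' ^ 2))"
    by algebra
  also have "x * of_int n = of_int m" using n unfolding x by simp
  also have "x' * of_int n' = of_int m'" using n' unfolding x' by simp
  finally have "(l ^ 2 - x - x') * of_int M = of_int N"
    unfolding v v' M_def N_def by simp
  then have z: "l ^ 2 - x - x' = of_int N / of_int M" using M0 by (simp add: field_simps)
  define B where "B = H ^ 2 * H' ^ 2"
  have "B > 0" using H(1) H'(1) unfolding B_def by simp
  then have B: "B \<ge> 1" by simp
  have KB: "0 \<le> K * B" "B \<le> K * B" "K * B \<le> K ^ 2 * B"
    using K(1) B by (auto simp: power2_eq_square mult_right_mono)
  have p: "\<bar>m * m'\<bar> \<le> H * H'" "\<bar>n * n'\<bar> \<le> H * H'" "\<bar>m * n'\<bar> \<le> H * H'" "\<bar>m' * n\<bar> \<le> H' * H"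
    using H H' by (intro abs_mult_le; simp)+
  have s: "\<bar>m * n' + m' * n\<bar> \<le> 2 * (H * H')" "\<bar>m * n' - m' * n\<bar> \<le> 2 * (H * H')"
    using p by (simp_all add: mult.commute)
  have "\<bar>m * m' + a * (n * n')\<bar> \<le> H * H' + K * (H * H')"
    using p(1) abs_mult_le[OF K(2) p(2)] by linarith
  then have 1: "\<bar>(m * m' + a * (n * n')) * (m * n' + m' * n)\<bar> \<le> (H * H' + K * (H * H')) * (2 * (H * H'))"
    using s(1) by (rule abs_mult_le)
  have 2: "\<bar>b * (n * n') ^ 2\<bar> \<le> K * (H * H') ^ 2"
    by (rule abs_mult_le[OF K(3) abs_power_le[OF p(2)]])
  have 3: "\<bar>v * v'\<bar> \<le> (2 * K * H ^ 2) * (2 * K * H' ^ 2)"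
    by (rule abs_mult_le[OF abs_ordinate_le[OF v2 H(2,3)] abs_ordinate_le[OF v2' H'(2,3)]])
  have e: "(H * H' + K * (H * H')) * (2 * (H * H')) = 2 * B + 2 * (K * B)" "K * (H * H') ^ 2 = K * B"
    "(2 * K * H ^ 2) * (2 * K * H' ^ 2) = 4 * (K ^ 2 * B)"
    unfolding B_def by (simp_all add: algebra_simps power2_eq_square)
  \<comment> \<open>The sum is \<open>2 * B + 4 * (K * B) + 8 * (K ^ 2 * B)\<close>, with every term
    compared to the last.\<close>
  have "\<bar>N\<bar> \<le> 14 * (K ^ 2 * B)"
    using 1 2 3 KB unfolding N_def e by linarith
  moreover have "\<bar>M\<bar> \<le> (2 * (H * H')) ^ 2" unfolding M_def using s(2) by (rule abs_power_le)
  then have "\<bar>M\<bar> \<le> 14 * (K ^ 2 * B)" using KB unfolding B_def by (simp add: power_mult_distrib)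
  ultimately have "real_of_int \<bar>N\<bar> \<le> real_of_int (14 * (K ^ 2 * B))" "real_of_int \<bar>M\<bar> \<le> real_of_int (14 * (K ^ 2 * B))"
    by (simp_all only: of_int_le_iff)
  then have "hQ (l ^ 2 - x - x') \<le> ln (real_of_int (14 * (K ^ 2 * B)))"
    by (rule hQ_fraction_le[OF z M0])
  also have "\<dots> = ln (14 * real_of_int K ^ 2) + ln (real_of_int B)"
    using K(1) B by (simp add: ln_mult)
  also have "ln (real_of_int B) = 2 * hQ x + 2 * hQ x'"
    unfolding B_def hx hx' H_def[symmetric] H'_def[symmetric] using H(1) H'(1)
    by (simp add: ln_mult ln_realpow)
  also have "ln (14 * real_of_int K ^ 2) \<le> 700 * cst" using ln_const_K_le[of 14 2] cst_ge_1 by simp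
  finally show ?thesis unfolding P by simp
qed

lemma hpt_add:
  assumes on: "on_curve E P" "on_curve E Q"
  shows "hpt (padd E P Q) \<le> 2 * hpt P + 2 * hpt Q + 700 * cst"
proof (cases P)
  case Inf
  then show ?thesis using hpt_nonneg[of Q] cst_ge_1 by simp
next
  case (Aff x y)
  note P = this
  show ?thesis
  proof (cases Q)
    case Inf
    then show ?thesis using hpt_nonneg[of P] cst_ge_1 by simp
  next
    case (Aff x' y')
    note Q = this
    consider "x \<noteq> x'" | "x = x'" "y + y' = 0" | "x = x'" "y = y'"
      using slope_exists[of "of_int a" "of_int b" x y x' y'] on P Q unfolding slope_def by fastforce
    then show ?thesis
    proof cases
      case 1
      then show ?thesis using hpt_add_distinct on unfolding P Q by simp
    next
      case 2
      then show ?thesis using hpt_nonneg[of P] hpt_nonneg[of Q] cst_ge_1 P Q by simp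
    next
      case 3
      then show ?thesis using hpt_double[OF on(1)] P Q by (simp add: abs_le_iff)
    qed
  qed
qed

lemma hpt_pneg: "hpt (pneg E P) = hpt P"
  by (cases P) auto

section \<open>The canonical height\<close>

definition dbl :: "nat \<Rightarrow> point \<Rightarrow> point" where
  "dbl n P = pmult E (2 ^ n) P"

lemma dbl_G: "on_curve E P \<Longrightarrow> dbl n P = P [^]\<^bsub>G\<^esub> (2 ^ n :: nat)"
  unfolding dbl_def by (rule pmult_G)

lemma on_curve_dbl: "on_curve E P \<Longrightarrow> on_curve E (dbl n P)"
  using nat_pow_closed[of P "2 ^ n"] dbl_G by simp

lemma dbl_0: "on_curve E P \<Longrightarrow> dbl 0 P = P"
  using dbl_G[of P 0] by simp

lemma dbl_Suc: "on_curve E P \<Longrightarrow> dbl (Suc n) P = padd E (dbl n P) (dbl n P)"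
  using dbl_G[of P] nat_pow_mult[of P "2 ^ n" "2 ^ n"] by (simp add: mult_G mult_2)

lemma dbl_padd:
  "on_curve E P \<Longrightarrow> on_curve E Q \<Longrightarrow> dbl n (padd E P Q) = padd E (dbl n P) (dbl n Q)"
  using dbl_G[of P n] dbl_G[of Q n] dbl_G[of "padd E P Q" n] pow_mult_distrib[of P Q "2 ^ n"] m_comm[of P Q]
  by (simp add: mult_G on_curve_padd_short)

lemma dbl_pneg: "on_curve E P \<Longrightarrow> dbl n (pneg E P) = pneg E (dbl n P)"
  using dbl_G[of P n] dbl_G[of "pneg E P" n] nat_pow_inv[of P "2 ^ n"] inv_G[of P]
    inv_G[of "P [^]\<^bsub>G\<^esub> (2 ^ n :: nat)"] nat_pow_closed[of P "2 ^ n"]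
  by (simp add: on_curve_pneg_short)

abbreviation "qh \<equiv> canon_height E"

text \<open>With \<open>c = 700 * cst / 3\<close> the doubling error at step \<open>n\<close> is at
  most the decrease of \<open>c / 4 ^ n\<close>. So \<open>u\<close> plus this term decreases and
  \<open>u\<close> minus it increases; both have the same limit, which differs from
  \<open>u 0\<close> by at most \<open>c\<close>.\<close>

lemma canon_height_limit:
  assumes on: "on_curve E P"
  shows "(\<lambda>n. hpt (dbl n P) / 4 ^ n) \<longlonglongrightarrow> qh P" "\<bar>qh P - hpt P\<bar> \<le> 700 * cst"
proof -
  define u where "u n = hpt (dbl n P) / 4 ^ n" for n
  define c where "c = 700 * cst / 3"
  have c: "c \<ge> 0" using cst_ge_1 unfolding c_def by simp
  have step: "\<bar>u (Suc n) - u n\<bar> \<le> 3 * c / 4 ^ Suc n" for n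
  proof -
    have "u (Suc n) - u n = (hpt (padd E (dbl n P) (dbl n P)) - 4 * hpt (dbl n P)) / 4 ^ Suc n"
      unfolding u_def dbl_Suc[OF on] by (simp add: field_simps)
    then have "\<bar>u (Suc n) - u n\<bar> = \<bar>hpt (padd E (dbl n P) (dbl n P)) - 4 * hpt (dbl n P)\<bar> / 4 ^ Suc n"
      by (simp add: abs_divide)
    also have "\<dots> \<le> (700 * cst) / 4 ^ Suc n"
      using hpt_double[OF on_curve_dbl[OF on]] by (intro divide_right_mono) auto
    finally show ?thesis unfolding c_def by simp
  qed
  define v where "v n = u n + c / 4 ^ n" for n
  define w where "w n = u n - c / 4 ^ n" for n
  have c4: "c / 4 ^ n = c / 4 ^ Suc n + 3 * c / 4 ^ Suc n" for n by (simp add: field_simps)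
  have dv: "v (Suc n) \<le> v n" "w n \<le> w (Suc n)" for n
    using step[of n] c4[of n] unfolding v_def w_def by linarith+
  then have vw: "decseq v" "incseq w" by (auto intro: decseq_SucI incseq_SucI)
  have "0 \<le> v n" for n using hpt_nonneg c unfolding v_def u_def by simp
  then obtain L where L: "v \<longlonglongrightarrow> L" and Lv: "\<And>n. L \<le> v n"
    using decseq_convergent[OF vw(1), of 0] by blast
  have z: "(\<lambda>n. c / 4 ^ n) \<longlonglongrightarrow> 0"
    using tendsto_mult[OF tendsto_const[of c] LIMSEQ_inverse_realpow_zero[of 4]] by (simp add: field_simps)
  have uL: "u \<longlonglongrightarrow> L" using tendsto_diff[OF L z] unfolding v_def by simp
  have wL: "w \<longlonglongrightarrow> L" using tendsto_diff[OF uL z] unfolding w_def by simp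
  have q: "qh P = L" using limI[OF uL] unfolding canon_height_def u_def dbl_def .
  show "(\<lambda>n. hpt (dbl n P) / 4 ^ n) \<longlonglongrightarrow> qh P" using uL unfolding q u_def .
  have "w 0 \<le> L" by (rule incseq_le[OF vw(2) wL])
  moreover have "u 0 = hpt P" unfolding u_def dbl_0[OF on] by simp
  ultimately have "\<bar>qh P - hpt P\<bar> \<le> c" using Lv[of 0] unfolding q v_def w_def by simp
  also have "c \<le> 700 * cst" using cst_ge_1 unfolding c_def by simp
  finally show "\<bar>qh P - hpt P\<bar> \<le> 700 * cst" .
qed

lemma canon_height_nonneg: "on_curve E P \<Longrightarrow> qh P \<ge> 0"
  by (rule LIMSEQ_le_const[OF canon_height_limit(1)]) (auto simp: hpt_nonneg)

text \<open>The error \<open>700 * cst\<close> of the naive inequality is divided by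
  \<open>4 ^ n\<close> and disappears in the limit.\<close>

lemma canon_height_add:
  assumes "on_curve E P" "on_curve E Q" shows "qh (padd E P Q) \<le> 2 * qh P + 2 * qh Q"
proof (rule LIMSEQ_le)
  show "(\<lambda>n. hpt (dbl n (padd E P Q)) / 4 ^ n) \<longlonglongrightarrow> qh (padd E P Q)"
    by (intro canon_height_limit on_curve_padd_short assms)
  have "(\<lambda>n. 700 * cst / 4 ^ n) \<longlonglongrightarrow> 0"
    using tendsto_mult[OF tendsto_const[of "700 * cst"] LIMSEQ_inverse_realpow_zero[of 4]]
    by (simp add: field_simps)
  then have "(\<lambda>n. 2 * (hpt (dbl n P) / 4 ^ n) + 2 * (hpt (dbl n Q) / 4 ^ n) + 700 * cst / 4 ^ n)
      \<longlonglongrightarrow> 2 * qh P + 2 * qh Q + 0"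
    by (intro tendsto_intros canon_height_limit assms)
  then show "(\<lambda>n. (2 * hpt (dbl n P) + 2 * hpt (dbl n Q) + 700 * cst) / 4 ^ n)
      \<longlonglongrightarrow> 2 * qh P + 2 * qh Q" by (simp add: add_divide_distrib)
  show "\<exists>N. \<forall>n\<ge>N. hpt (dbl n (padd E P Q)) / 4 ^ n
      \<le> (2 * hpt (dbl n P) + 2 * hpt (dbl n Q) + 700 * cst) / 4 ^ n"
    using hpt_add on_curve_dbl assms dbl_padd by (auto intro!: divide_right_mono)
qed

lemma canon_height_pneg: "on_curve E P \<Longrightarrow> qh (pneg E P) = qh P"
  using dbl_pneg unfolding canon_height_def dbl_def[symmetric] by (simp add: hpt_pneg)

lemma canon_height_double:
  assumes on: "on_curve E P" shows "qh (padd E P P) = 4 * qh P"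
proof -
  have "(\<lambda>n. 4 * (hpt (dbl (Suc n) P) / 4 ^ Suc n)) \<longlonglongrightarrow> 4 * qh P"
    by (intro tendsto_intros LIMSEQ_Suc[OF canon_height_limit(1)[OF on]])
  moreover have "(\<lambda>n. 4 * (hpt (dbl (Suc n) P) / 4 ^ Suc n)) = (\<lambda>n. hpt (dbl n (padd E P P)) / 4 ^ n)"
    using dbl_Suc[OF on] dbl_padd[OF on on] by auto
  ultimately show ?thesis
    using LIMSEQ_unique canon_height_limit(1)[OF on_curve_padd_short[OF on on]] by metis
qed

text \<open>Comparison with the naive height leaves finitely many abscissae, each with at most two
  ordinates.\<close>

lemma finite_canon_height_le: "finite {P. on_curve E P \<and> qh P \<le> R}"
proof -
  define X where "X = {q. hQ q \<le> R + 700 * cst}"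
  have fin: "finite X" unfolding X_def by (rule finite_hQ_le)
  have sub: "{P. on_curve E P \<and> qh P \<le> R} \<subseteq>
      insert Inf (\<Union>x\<in>X. Aff x ` {y. y ^ 2 = x ^ 3 + of_int a * x + of_int b})"
  proof
    fix P assume "P \<in> {P. on_curve E P \<and> qh P \<le> R}"
    then have P: "on_curve E P" "qh P \<le> R" by auto
    then have "hpt P \<le> R + 700 * cst" using canon_height_limit(2)[OF P(1)] by linarith
    then show "P \<in> insert Inf (\<Union>x\<in>X. Aff x ` {y. y ^ 2 = x ^ 3 + of_int a * x + of_int b})"
      using P by (cases P) (auto simp: X_def)
  qed
  have fy: "finite {y :: rat. y ^ 2 = c}" for c
  proof (cases "\<exists>z. z ^ 2 = c")
    case True
    then obtain z where "z ^ 2 = c" by blast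
    then have "{y. y ^ 2 = c} \<subseteq> {z, - z}" by (auto simp: power2_eq_iff)
    then show ?thesis by (rule finite_subset) simp
  qed simp
  show ?thesis by (rule finite_subset[OF sub]) (use fin fy in simp)
qed

sublocale quadratic_height G qh
proof unfold_locales
  fix x y R
  show "x \<in> carrier G \<Longrightarrow> 0 \<le> qh x" by (simp add: canon_height_nonneg)
  show "x \<in> carrier G \<Longrightarrow> y \<in> carrier G \<Longrightarrow> qh (x \<otimes>\<^bsub>G\<^esub> y) \<le> 2 * qh x + 2 * qh y"
    by (simp add: mult_G canon_height_add)
  show "x \<in> carrier G \<Longrightarrow> qh (inv\<^bsub>G\<^esub> x) = qh x" by (simp add: inv_G canon_height_pneg)
  show "x \<in> carrier G \<Longrightarrow> qh (x \<otimes>\<^bsub>G\<^esub> x) = 4 * qh x" by (simp add: mult_G canon_height_double)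
  show "finite {x \<in> carrier G. qh x \<le> R}" using finite_canon_height_le by simp
qed

end

section \<open>Heights of points with three translates in linear relation\<close>

text \<open>This norm is submultiplicative, so a bound for the polynomial obtained by elimination
  follows from its factors without expanding it.\<close>

definition poly_norm :: "rat poly \<Rightarrow> rat" where
  "poly_norm p = (\<Sum>c\<leftarrow>coeffs p. \<bar>c\<bar>)"

definition int_coeffs :: "rat poly \<Rightarrow> bool" where
  "int_coeffs p \<longleftrightarrow> (\<forall>i. coeff p i \<in> \<int>)"

lemma poly_norm_0 [simp]: "poly_norm 0 = 0"
  by (simp add: poly_norm_def)

lemma poly_norm_pCons [simp]: "poly_norm (pCons c p) = \<bar>c\<bar> + poly_norm p"
  by (simp add: poly_norm_def cCons_def)

lemma poly_norm_nonneg: "poly_norm p \<ge> 0"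
  by (induction p) auto

lemma poly_norm_smult: "poly_norm (smult c p) = \<bar>c\<bar> * poly_norm p"
  by (induction p) (auto simp: abs_mult algebra_simps)

lemma poly_norm_add: "poly_norm (p + q) \<le> poly_norm p + poly_norm q"
proof (induction p q rule: poly_induct2)
  case (pCons a p b q)
  then show ?case using abs_triangle_ineq[of a b] by simp
qed simp

lemma poly_norm_mult: "poly_norm (p * q) \<le> poly_norm p * poly_norm q"
proof (induction p)
  case (pCons c p)
  have "poly_norm (pCons c p * q) \<le> poly_norm (smult c q) + poly_norm (pCons 0 (p * q))"
    using poly_norm_add[of "smult c q" "pCons 0 (p * q)"] by simp
  also have "\<dots> \<le> poly_norm (pCons c p) * poly_norm q"
    using pCons.IH by (simp add: poly_norm_smult algebra_simps)
  finally show ?case .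
qed simp

lemma poly_norm_diff: "poly_norm (p - q) \<le> poly_norm p + poly_norm q"
  using poly_norm_add[of p "- q"] poly_norm_smult[of "- 1" q] by simp

lemma poly_norm_mult_le:
  assumes "poly_norm p \<le> A" "poly_norm q \<le> B" shows "poly_norm (p * q) \<le> A * B"
  by (rule order_trans[OF poly_norm_mult mult_mono]) (use assms poly_norm_nonneg[of p] poly_norm_nonneg[of q] in auto)

lemma poly_norm_add_le: "poly_norm p \<le> A \<Longrightarrow> poly_norm q \<le> B \<Longrightarrow> poly_norm (p + q) \<le> A + B"
  using poly_norm_add[of p q] by linarith

lemma poly_norm_diff_le: "poly_norm p \<le> A \<Longrightarrow> poly_norm q \<le> B \<Longrightarrow> poly_norm (p - q) \<le> A + B"
  using poly_norm_diff[of p q] by linarith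

lemma poly_norm_reflect: "poly_norm (reflect_poly p) = poly_norm p"
proof -
  have "(\<Sum>c\<leftarrow>dropWhile ((=) 0) xs. \<bar>c\<bar>) = (\<Sum>c\<leftarrow>xs. \<bar>c\<bar>)" for xs :: "rat list"
    by (induction xs) auto
  then show ?thesis unfolding poly_norm_def coeffs_reflect_poly rev_map[symmetric]
    by (simp add: sum_list_rev)
qed

lemma int_coeffs_pCons [simp]: "int_coeffs (pCons c p) \<longleftrightarrow> c \<in> \<int> \<and> int_coeffs p"
  unfolding int_coeffs_def by (auto simp: coeff_pCons split: nat.splits)

lemma int_coeffs_0 [simp]: "int_coeffs 0"
  by (simp add: int_coeffs_def)

lemma int_coeffs_add: "int_coeffs p \<Longrightarrow> int_coeffs q \<Longrightarrow> int_coeffs (p + q)"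
  by (simp add: int_coeffs_def)

lemma int_coeffs_diff: "int_coeffs p \<Longrightarrow> int_coeffs q \<Longrightarrow> int_coeffs (p - q)"
  by (simp add: int_coeffs_def)

lemma int_coeffs_mult: "int_coeffs p \<Longrightarrow> int_coeffs q \<Longrightarrow> int_coeffs (p * q)"
  by (auto simp: int_coeffs_def coeff_mult intro!: Ints_sum)

lemma int_coeffs_reflect: "int_coeffs p \<Longrightarrow> int_coeffs (reflect_poly p)"
  by (simp add: int_coeffs_def coeff_reflect_poly)

lemma poly_clear_denominator:
  assumes "int_coeffs p" "d \<noteq> 0"
  shows "\<exists>e k. poly p (of_int m / of_int d) * of_int d ^ e = of_int k"
  using assms(1)
proof (induction p)
  case (pCons c p)
  obtain e k where ek: "poly p (of_int m / of_int d) * of_int d ^ e = of_int k"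
    using pCons by auto
  obtain i where i: "c = of_int i" using pCons.prems by (auto elim: Ints_cases)
  have "poly (pCons c p) (of_int m / of_int d) * of_int d ^ Suc e
      = of_int i * of_int d ^ Suc e + of_int m * (poly p (of_int m / of_int d) * of_int d ^ e)"
    using assms(2) unfolding i by (simp add: field_simps)
  also have "\<dots> = of_int (i * d ^ Suc e + m * k)" unfolding ek by simp
  finally show ?case by blast
qed (auto intro: exI[of _ 0])

text \<open>A zero constant coefficient allows a factor of the variable to be removed, as
  \<open>m\<close> is nonzero; otherwise \<open>m\<close> divides the constant coefficient.\<close>

lemma rational_root_numerator:
  fixes m d :: int
  assumes "int_coeffs p" "p \<noteq> 0" "d \<noteq> 0" "m \<noteq> 0" "coprime m d"
    and "poly p (of_int m / of_int d) = 0"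
  shows "of_int \<bar>m\<bar> \<le> poly_norm p"
  using assms(1,2,6)
proof (induction p)
  case (pCons c p)
  show ?case
  proof (cases "c = 0")
    case True
    then show ?thesis using pCons assms(3,4) by auto
  next
    case False
    obtain e k where ek: "poly p (of_int m / of_int d) * of_int d ^ e = of_int k"
      using poly_clear_denominator[of p d m] pCons.prems assms(3) by auto
    obtain i where i: "c = of_int i" using pCons.prems by (auto elim: Ints_cases)
    have "c + of_int m / of_int d * poly p (of_int m / of_int d) = 0" using pCons.prems by simp
    then have "c * of_int d + of_int m * poly p (of_int m / of_int d) = 0"
      using assms(3) by (simp add: field_simps)
    then have "(c * of_int d + of_int m * poly p (of_int m / of_int d)) * of_int d ^ e = 0" by simp
    then have "c * of_int d ^ Suc e = - of_int m * (poly p (of_int m / of_int d) * of_int d ^ e)"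
      by (simp add: algebra_simps eq_neg_iff_add_eq_0)
    then have "of_int (i * d ^ Suc e) = (of_int (- (m * k)) :: rat)" unfolding ek i by simp
    then have "i * d ^ Suc e = - (m * k)" by (simp only: of_int_eq_iff)
    then have "m dvd i * d ^ Suc e" by simp
    moreover have "coprime m (d ^ Suc e)" using assms(5) by simp
    ultimately have "m dvd i" by (simp add: coprime_dvd_mult_left_iff)
    then have "\<bar>m\<bar> \<le> \<bar>i\<bar>" using dvd_imp_le_int[of i m] False i by simp
    then have "(of_int \<bar>m\<bar> :: rat) \<le> \<bar>c\<bar>" unfolding i by linarith
    then show ?thesis using poly_norm_nonneg[of p] by simp
  qed
qed simp

text \<open>The numerator is bounded by the rational root theorem for \<open>p\<close>, the
  denominator by the same theorem for the reversed polynomial at \<open>1 / x\<close>. For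
  \<open>x = 0\<close> the height is 0, and some coefficient is a nonzero integer.\<close>

lemma hQ_root_le:
  assumes "int_coeffs p" "p \<noteq> 0" "poly p x = 0" "poly_norm p \<le> of_int M"
  shows "hQ x \<le> ln (real_of_int M)"
proof -
  obtain m d :: int where d: "d > 0" "coprime m d" "x = of_int m / of_int d"
    and h: "hQ x = ln (real_of_int (max \<bar>m\<bar> d))" by (rule rat_reduced)
  have "of_int (max \<bar>m\<bar> d) \<le> poly_norm p"
  proof (cases "m = 0")
    case True
    then have "d = 1" using d by simp
    obtain i where "coeff p i \<noteq> 0" using assms(2) by (auto simp: poly_eq_iff)
    moreover have "\<bar>coeff p i\<bar> \<le> poly_norm p"
    proof (induction p arbitrary: i)
      case (pCons c p)
      show ?case
      proof (cases i)
        case 0 then show ?thesis using poly_norm_nonneg[of p] by simp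
      next
        case (Suc j)
        then show ?thesis using pCons.IH[of j] by simp
      qed
    qed simp
    moreover obtain k where "coeff p i = of_int k"
      using assms(1) unfolding int_coeffs_def by (auto elim: Ints_cases)
    ultimately have "1 \<le> poly_norm p" by (cases "k = 0") auto
    then show ?thesis using True \<open>d = 1\<close> by simp
  next
    case False
    have "of_int \<bar>m\<bar> \<le> poly_norm p"
      using rational_root_numerator[of p d m] assms d False by simp
    moreover have "of_int \<bar>d\<bar> \<le> poly_norm (reflect_poly p)"
    proof (rule rational_root_numerator)
      have "poly (reflect_poly p) (inverse x) = inverse x ^ degree p * poly p x"
        using poly_reflect_poly_nz[of "inverse x" p] d False by simp
      then show "poly (reflect_poly p) (of_int d / of_int m) = 0" using assms(3) d(3) by simp
    qed (use assms d False in \<open>auto simp: int_coeffs_reflect coprime_commute\<close>)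
    ultimately show ?thesis using d(1) unfolding poly_norm_reflect by (simp add: max_def)
  qed
  then have "(of_int (max \<bar>m\<bar> d) :: rat) \<le> of_int M" using assms(4) by linarith
  then have "max \<bar>m\<bar> d \<le> M" by (simp only: of_int_le_iff)
  then show ?thesis unfolding h using d(1) by (intro ln_mono) auto
qed

text \<open>Unless \<open>V\<close> or \<open>f\<close> is zero, the degrees of \<open>U * U\<close>
  and \<open>V * V * f\<close> have different parity. This keeps the equation for \<open>x\<close>
  nontrivial for every \<open>V\<close>.\<close>

lemma square_ne_square_mult_cubic:
  fixes U V f :: "rat poly"
  assumes "U \<noteq> 0" "odd (degree f)" shows "U * U - V * V * f \<noteq> 0"
proof
  assume "U * U - V * V * f = 0"
  then have e: "U * U = V * V * f" by simp
  then have "V \<noteq> 0" "f \<noteq> 0" using assms(1) by auto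
  then have "degree (V * V * f) = 2 * degree V + degree f" by (simp add: degree_mult_eq)
  moreover have "degree (U * U) = 2 * degree U" using assms(1) by (simp add: degree_mult_eq)
  ultimately have "2 * degree U = 2 * degree V + degree f" using e by simp
  then show False using assms(2) by presburger
qed

section \<open>Elimination of the ordinate from a relation between translates\<close>

context integral_curve
begin

text \<open>\<open>x(P + R) = (G - 2 Y y) / L\<^sup>2\<close> as a function of \<open>P = (x, y)\<close>, where \<open>R = (p/q, Y/q\<^sup>2)\<close>.\<close>
definition addL :: "int \<Rightarrow> int \<Rightarrow> rat poly" where
  "addL p q = [:- of_int p, of_int q:]"

definition addG :: "int \<Rightarrow> int \<Rightarrow> rat poly" where
  "addG p q = [:of_int p, of_int q:] * [:of_int (a * q), of_int p:] + [:of_int (2 * b * q ^ 2):]"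

lemma addition_polys:
  assumes on: "on_curve E (Aff x y)" "on_curve E (Aff x' y')" and ne: "x \<noteq> x'"
    and q: "q > 0" "x' = of_int p / of_int q" "y' * of_int q ^ 2 = of_int Y"
    and s: "padd E (Aff x y) (Aff x' y') = Aff u w"
  shows "u * poly (addL p q * addL p q) x = poly (addG p q) x - 2 * of_int Y * y"
proof -
  obtain l where sl: "slope (of_int a) x y x' y' l" using slope_exists[OF on] ne by blast
  have u: "u = l ^ 2 - x - x'" using padd_short_slope[OF on sl] ne s by auto
  have "u * (x - x') ^ 2 = (x * x' + of_int a) * (x + x') + 2 * of_int b - 2 * y * y'"
    using sl on unfolding u slope_def on_curve.simps short_simps by algebra
  then have "u * (of_int q * x - x' * of_int q) ^ 2 =
      (x * (x' * of_int q) + of_int a * of_int q) * (x * of_int q + x' * of_int q)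
      + 2 * of_int b * of_int q ^ 2 - 2 * y * (y' * of_int q ^ 2)"
    by algebra
  also have "x' * of_int q = of_int p" using q by simp
  finally have "u * (of_int q * x - of_int p) ^ 2 =
      (x * of_int p + of_int a * of_int q) * (x * of_int q + of_int p)
      + 2 * of_int b * of_int q ^ 2 - 2 * y * of_int Y" unfolding q(3) .
  then show ?thesis unfolding addL_def addG_def by (simp add: power2_eq_square algebra_simps)
qed

lemma poly_norm_addL:
  assumes "\<bar>p\<bar> \<le> H" "\<bar>q\<bar> \<le> H" shows "poly_norm (addL p q) \<le> 2 * of_int H"
proof -
  have "(of_int \<bar>p\<bar> :: rat) \<le> of_int H" "(of_int \<bar>q\<bar> :: rat) \<le> of_int H"
    using assms by (simp_all only: of_int_le_iff)
  then show ?thesis unfolding addL_def by simp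
qed

lemma poly_norm_addG:
  assumes "\<bar>p\<bar> \<le> H" "\<bar>q\<bar> \<le> H" shows "poly_norm (addG p q) \<le> 6 * of_int K * of_int H ^ 2"
proof -
  have H: "0 \<le> H" using assms by linarith
  have HK: "H \<le> K * H" using K(1) H by (simp add: mult_le_cancel_right1)
  have h: "(of_int \<bar>p\<bar> :: rat) \<le> of_int H" "(of_int \<bar>q\<bar> :: rat) \<le> of_int H"
    "(of_int \<bar>a * q\<bar> :: rat) \<le> of_int (K * H)" "(of_int \<bar>p\<bar> :: rat) \<le> of_int (K * H)"
    "(of_int \<bar>b * q ^ 2\<bar> :: rat) \<le> of_int (K * H ^ 2)"
    using assms HK abs_mult_le[OF K(2) assms(2)] abs_mult_le[OF K(3) abs_power_le[OF assms(2)]]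
    by (simp_all only: of_int_le_iff)
  have "poly_norm [:of_int p, of_int q:] \<le> 2 * of_int H" using h(1,2) by simp
  moreover have "poly_norm [:of_int (a * q), of_int p:] \<le> 2 * of_int (K * H)"
    using h(3,4) by (simp del: of_int_mult)
  moreover have "poly_norm [:of_int (2 * b * q ^ 2):] \<le> 2 * of_int (K * H ^ 2)"
    using h(5) by (simp add: abs_mult)
  ultimately have "poly_norm (addG p q) \<le> (2 * of_int H) * (2 * of_int (K * H)) + 2 * of_int (K * H ^ 2)"
    unfolding addG_def by (intro poly_norm_add_le poly_norm_mult_le)
  then show ?thesis by (simp add: power2_eq_square algebra_simps)
qed

text \<open>Eliminating \<open>y\<close> from the relation yields a polynomial equation of degree 10 for \<open>x\<close>.\<close>
lemma three_translates_height:
  fixes \<alpha> \<beta> \<gamma> N :: int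
  assumes on: "on_curve E (Aff x y)" "on_curve E (Aff x2 y2)" "on_curve E (Aff x3 y3)"
    and s2: "padd E (Aff x y) (Aff x2 y2) = Aff u2 w2"
    and s3: "padd E (Aff x y) (Aff x3 y3) = Aff u3 w3"
    and rel: "of_int \<alpha> * x + of_int \<beta> * u2 + of_int \<gamma> * u3 = 0"
    and N: "\<alpha> \<noteq> 0" "\<bar>\<alpha>\<bar> \<le> N" "\<bar>\<beta>\<bar> \<le> N" "\<bar>\<gamma>\<bar> \<le> N"
  shows "hQ x \<le> 2 * ln N + 4 * hQ x2 + 4 * hQ x3 + 7168 * cst"
proof -
  have N1: "N \<ge> 1" using N by linarith
  have lnN: "ln (real_of_int N) \<ge> 0" using N1 by simp
  have pos: "0 \<le> 7168 * cst" using cst_ge_1 by simp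
  \<comment> \<open>If \<open>x\<close> is \<open>x2\<close> or \<open>x3\<close> the addition
    polynomials do not apply, but then the claim is immediate, because the right-hand side contains
    \<open>4 * hQ x2\<close> and \<open>4 * hQ x3\<close>.\<close>
  consider "x = x2" | "x = x3" | "x \<noteq> x2" "x \<noteq> x3" by blast
  then show ?thesis
  proof cases
    case 1
    show ?thesis unfolding 1 using hQ_nonneg[of x2] hQ_nonneg[of x3] lnN pos by linarith
  next
    case 2
    show ?thesis unfolding 2 using hQ_nonneg[of x2] hQ_nonneg[of x3] lnN pos by linarith
  next
    case 3
    obtain p2 q2 Y2 :: int where q2: "q2 > 0" and x2: "x2 = of_int p2 / of_int q2"
      and h2: "hQ x2 = ln (real_of_int (max \<bar>p2\<bar> q2))" and Y2: "y2 * of_int q2 ^ 2 = of_int Y2"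
      and YY2: "Y2 ^ 2 = q2 * (p2 ^ 3 + a * p2 * q2 ^ 2 + b * q2 ^ 3)"
      using rational_point[OF on(2)] by blast
    obtain p3 q3 Y3 :: int where q3: "q3 > 0" and x3: "x3 = of_int p3 / of_int q3"
      and h3: "hQ x3 = ln (real_of_int (max \<bar>p3\<bar> q3))" and Y3: "y3 * of_int q3 ^ 2 = of_int Y3"
      and YY3: "Y3 ^ 2 = q3 * (p3 ^ 3 + a * p3 * q3 ^ 2 + b * q3 ^ 3)"
      using rational_point[OF on(3)] by blast
    define H2 where "H2 = max \<bar>p2\<bar> q2"
    define H3 where "H3 = max \<bar>p3\<bar> q3"
    have H2: "H2 \<ge> 1" "\<bar>p2\<bar> \<le> H2" "\<bar>q2\<bar> \<le> H2" using q2 unfolding H2_def by auto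
    have H3: "H3 \<ge> 1" "\<bar>p3\<bar> \<le> H3" "\<bar>q3\<bar> \<le> H3" using q3 unfolding H3_def by auto
    define L2 where "L2 = addL p2 q2 * addL p2 q2"
    define L3 where "L3 = addL p3 q3 * addL p3 q3"
    define U where "U = [:0, of_int \<alpha>:] * (L2 * L3) + ([:of_int \<beta>:] * (addG p2 q2 * L3) + [:of_int \<gamma>:] * (addG p3 q3 * L2))"
    define V where "V = [:2 * of_int (\<beta> * Y2):] * L3 + [:2 * of_int (\<gamma> * Y3):] * L2"
    define f where "f = [:of_int b, of_int a, 0, 1 :: rat:]"
    define R where "R = U * U - V * V * f"
    have e2: "u2 * poly L2 x = poly (addG p2 q2) x - 2 * of_int Y2 * y"
      unfolding L2_def by (rule addition_polys[OF on(1,2) 3(1) q2 x2 Y2 s2])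
    have e3: "u3 * poly L3 x = poly (addG p3 q3) x - 2 * of_int Y3 * y"
      unfolding L3_def by (rule addition_polys[OF on(1,3) 3(2) q3 x3 Y3 s3])
    have UV: "poly U x = poly V x * y"
    proof -
      have "poly U x - poly V x * y = of_int \<alpha> * x * (poly L2 x * poly L3 x)
         + of_int \<beta> * ((poly (addG p2 q2) x - 2 * of_int Y2 * y) * poly L3 x)
         + of_int \<gamma> * ((poly (addG p3 q3) x - 2 * of_int Y3 * y) * poly L2 x)"
        unfolding U_def V_def by (simp add: algebra_simps)
      also have "\<dots> = (of_int \<alpha> * x + of_int \<beta> * u2 + of_int \<gamma> * u3) * (poly L2 x * poly L3 x)"
        unfolding e2[symmetric] e3[symmetric] by (simp add: algebra_simps)
      finally show ?thesis unfolding rel by simp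
    qed
    have fx: "poly f x = y ^ 2"
      using on(1) unfolding f_def by (simp add: power2_eq_square power3_eq_cube algebra_simps)
    have root: "poly R x = 0"
      unfolding R_def using UV fx by (simp add: power2_eq_square)
    have dL: "degree L2 = 2" "degree L3 = 2" "L2 \<noteq> 0" "L3 \<noteq> 0"
      using q2 q3 unfolding L2_def L3_def addL_def by (auto simp: degree_mult_eq)
    have dG: "degree (addG p q) \<le> 2" for p q
    proof -
      have "degree ([:of_int p, of_int q:] * [:of_int (a * q), of_int p :: rat:]) \<le> 1 + 1"
        by (rule order_trans[OF degree_mult_le add_mono]) (auto intro: order_trans[OF degree_pCons_le])
      then show ?thesis unfolding addG_def by (intro degree_add_le) auto
    qed
    \<comment> \<open>Each \<open>addG\<close> has degree at most 2 and each of \<open>L2\<close>,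
      \<open>L3\<close> degree 2, so only the term with \<alpha> reaches degree 5. Since \<alpha> is
      nonzero, \<open>U\<close> does not vanish.\<close>
    have "degree (addG p q * L) \<le> 4" if "degree L = 2" for p q and L :: "rat poly"
      using degree_mult_le[of "addG p q" L] dG[of p q] that by linarith
    then have "degree ([:of_int \<beta>:] * (addG p2 q2 * L3) + [:of_int \<gamma>:] * (addG p3 q3 * L2)) \<le> 4"
      using dL by (intro degree_add_le) (auto intro: order_trans[OF degree_smult_le])
    moreover have "degree ([:0, of_int \<alpha>:] * (L2 * L3)) = 5"
      using dL N(1) by (subst degree_mult_eq) (auto simp: degree_mult_eq)
    ultimately have "degree U = 5" unfolding U_def by (subst degree_add_eq_left) auto
    then have "U \<noteq> 0" by auto
    then have R0: "R \<noteq> 0" unfolding R_def by (rule square_ne_square_mult_cubic) (simp add: f_def)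
    have iL: "int_coeffs (addL p q)" for p q by (simp add: addL_def)
    have iG: "int_coeffs (addG p q)" for p q
      unfolding addG_def by (rule int_coeffs_add[OF int_coeffs_mult]) simp_all
    have iR: "int_coeffs R"
      unfolding R_def U_def V_def f_def L2_def L3_def
      by (intro int_coeffs_diff int_coeffs_add int_coeffs_mult iL iG) simp_all
    define B :: rat where "B = of_int (H2 ^ 2 * H3 ^ 2)"
    define k :: rat where "k = of_int K"
    define n :: rat where "n = of_int N"
    have kn: "k \<ge> 1" "n \<ge> 1" using K(1) N1 unfolding k_def n_def by simp_all
    have "H2 ^ 2 * H3 ^ 2 > 0" using H2(1) H3(1) by simp
    then have B: "B > 0" unfolding B_def by (simp only: of_int_0_less_iff)
    have nL: "poly_norm L2 \<le> (2 * of_int H2) * (2 * of_int H2)" "poly_norm L3 \<le> (2 * of_int H3) * (2 * of_int H3)"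
      unfolding L2_def L3_def using H2 H3 by (intro poly_norm_mult_le poly_norm_addL; simp)+
    have nG: "poly_norm (addG p2 q2) \<le> 6 * k * of_int H2 ^ 2" "poly_norm (addG p3 q3) \<le> 6 * k * of_int H3 ^ 2"
      unfolding k_def using H2 H3 by (intro poly_norm_addG; simp)+
    have nab: "\<bar>of_int \<alpha>\<bar> \<le> n" "\<bar>of_int \<beta>\<bar> \<le> n" "\<bar>of_int \<gamma>\<bar> \<le> n"
      unfolding n_def using N by (simp_all only: of_int_abs[symmetric] of_int_le_iff)
    have "poly_norm [:0, of_int \<alpha>:] \<le> n" "poly_norm [:of_int \<beta>:] \<le> n" "poly_norm [:of_int \<gamma>:] \<le> n"
      using nab by simp_all
    then have "poly_norm U \<le> n * (((2 * of_int H2) * (2 * of_int H2)) * ((2 * of_int H3) * (2 * of_int H3)))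
       + (n * ((6 * k * of_int H2 ^ 2) * ((2 * of_int H3) * (2 * of_int H3)))
       + n * ((6 * k * of_int H3 ^ 2) * ((2 * of_int H2) * (2 * of_int H2))))"
      unfolding U_def using nL nG by (intro poly_norm_add_le poly_norm_mult_le)
    also have "\<dots> = 16 * (1 * n * B) + 48 * (k * n * B)"
      unfolding B_def by (simp add: power2_eq_square algebra_simps)
    also have "\<dots> \<le> 64 * (k * n * B)"
    proof -
      have "1 * n * B \<le> k * n * B" using kn B by (intro mult_right_mono) auto
      then show ?thesis by linarith
    qed
    finally have nU: "poly_norm U \<le> 64 * (k * n * B)" .
    have "\<bar>Y2\<bar> \<le> 2 * K * H2 ^ 2" "\<bar>Y3\<bar> \<le> 2 * K * H3 ^ 2"
      by (rule abs_ordinate_le[OF YY2 H2(2,3)], rule abs_ordinate_le[OF YY3 H3(2,3)])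
    then have "\<bar>\<beta> * Y2\<bar> \<le> N * (2 * K * H2 ^ 2)" "\<bar>\<gamma> * Y3\<bar> \<le> N * (2 * K * H3 ^ 2)"
      using abs_mult_le[OF N(3)] abs_mult_le[OF N(4)] by blast+
    moreover have "poly_norm [:2 * of_int z:] \<le> 2 * of_int M" if "\<bar>z\<bar> \<le> M" for z M :: int
    proof -
      have "(of_int \<bar>z\<bar> :: rat) \<le> of_int M" using that by (simp only: of_int_le_iff)
      then show ?thesis by simp
    qed
    ultimately have "poly_norm [:2 * of_int (\<beta> * Y2):] \<le> 2 * of_int (N * (2 * K * H2 ^ 2))"
      "poly_norm [:2 * of_int (\<gamma> * Y3):] \<le> 2 * of_int (N * (2 * K * H3 ^ 2))"
      by blast+
    then have "poly_norm V \<le> 2 * of_int (N * (2 * K * H2 ^ 2)) * ((2 * of_int H3) * (2 * of_int H3))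
       + 2 * of_int (N * (2 * K * H3 ^ 2)) * ((2 * of_int H2) * (2 * of_int H2))"
      unfolding V_def using nL by (intro poly_norm_add_le poly_norm_mult_le)
    also have "\<dots> = 32 * (k * n * B)"
      unfolding B_def k_def n_def by (simp add: power2_eq_square algebra_simps)
    finally have nV: "poly_norm V \<le> 32 * (k * n * B)" .
    have "\<bar>of_int a\<bar> \<le> k" "\<bar>of_int b\<bar> \<le> k"
      unfolding k_def using K by (simp_all only: of_int_abs[symmetric] of_int_le_iff)
    then have nf: "poly_norm f \<le> 3 * k" using kn unfolding f_def by simp
    \<comment> \<open>\<open>64 ^ 2 + 3 * 32 ^ 2 = 7168\<close>; the factor 3 counts the
      coefficients of \<open>f\<close>, each of size at most \<open>k\<close>.\<close>
    have "poly_norm R \<le> (64 * (k * n * B)) * (64 * (k * n * B))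
        + (32 * (k * n * B)) * (32 * (k * n * B)) * (3 * k)"
      unfolding R_def using nU nV nf by (intro poly_norm_diff_le poly_norm_mult_le)
    also have "\<dots> = 4096 * (1 * (k ^ 2 * n ^ 2 * B ^ 2)) + 3072 * (k * (k ^ 2 * n ^ 2 * B ^ 2))"
      by (simp add: power2_eq_square algebra_simps)
    also have "\<dots> \<le> 7168 * (k * (k ^ 2 * n ^ 2 * B ^ 2))"
    proof -
      have "1 * (k ^ 2 * n ^ 2 * B ^ 2) \<le> k * (k ^ 2 * n ^ 2 * B ^ 2)" using kn by (intro mult_right_mono) auto
      then show ?thesis by linarith
    qed
    also have "\<dots> = of_int (7168 * K ^ 3 * (N ^ 2 * (H2 ^ 4 * H3 ^ 4)))"
      unfolding k_def n_def B_def by (simp add: power_numeral_reduce algebra_simps)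
    finally have "hQ x \<le> ln (real_of_int (7168 * K ^ 3 * (N ^ 2 * (H2 ^ 4 * H3 ^ 4))))"
      by (rule hQ_root_le[OF iR R0 root])
    also have "\<dots> = ln (7168 * real_of_int K ^ 3) + (2 * ln N + (4 * hQ x2 + 4 * hQ x3))"
      using K(1) N1 H2(1) H3(1) unfolding h2 h3 H2_def[symmetric] H3_def[symmetric]
      by (simp add: ln_mult ln_realpow)
    also have "ln (7168 * real_of_int K ^ 3) \<le> 7168 * cst" using ln_const_K_le[of 7168 3] by simp
    finally show ?thesis by simp
  qed
qed

end

section \<open>The 2-adic absolute value\<close>

definition norm2 :: "rat \<Rightarrow> real" where
  "norm2 q = (let (m, n) = quotient_of q in
     if m = 0 then 0 else 2 powi (int (multiplicity 2 n) - int (multiplicity 2 m)))"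

lemma norm2_0 [simp]: "norm2 0 = 0"
  by (simp add: norm2_def)

lemma norm2_fraction:
  assumes "m \<noteq> 0" "n \<noteq> 0"
  shows "norm2 (of_int m / of_int n) = 2 powi (int (multiplicity 2 n) - int (multiplicity 2 m))"
proof -
  obtain p d where pd: "quotient_of (of_int m / of_int n) = (p, d)" by (cases "quotient_of (of_int m / of_int n :: rat)")
  have d: "d > 0" and e: "of_int m / of_int n = (of_int p / of_int d :: rat)"
    using quotient_of_denom_pos[OF pd] quotient_of_div[OF pd] by auto
  have "of_int (m * d) = (of_int (p * n) :: rat)" using e d assms(2) by (simp add: field_simps)
  then have md: "m * d = p * n" by (simp only: of_int_eq_iff)
  then have p: "p \<noteq> 0" using assms d by auto
  have "multiplicity 2 (m * d) = multiplicity 2 (p * n)" using md by simp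
  then have "multiplicity 2 m + multiplicity 2 d = multiplicity 2 p + multiplicity 2 n"
    using assms d p by (simp add: prime_elem_multiplicity_mult_distrib)
  then have "int (multiplicity 2 d) - int (multiplicity 2 p) = int (multiplicity 2 n) - int (multiplicity 2 m)"
    by linarith
  then show ?thesis using p unfolding norm2_def pd by simp
qed

lemma norm2_eq_0_iff [simp]: "norm2 q = 0 \<longleftrightarrow> q = 0"
proof
  assume "norm2 q = 0"
  moreover obtain m n :: int where n: "n > 0" "q = of_int m / of_int n" by (rule rat_reduced)
  ultimately have "m = 0" using norm2_fraction[of m n] by (cases "m = 0") auto
  then show "q = 0" using n by simp
qed simp

lemma norm2_nonneg: "norm2 q \<ge> 0"
  unfolding norm2_def by (auto split: prod.splits)

lemma norm2_mult: "norm2 (x * y) = norm2 x * norm2 y"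
proof (cases "x = 0 \<or> y = 0")
  case False
  obtain m n :: int where n: "n > 0" "x = of_int m / of_int n" by (rule rat_reduced)
  obtain p d :: int where d: "d > 0" "y = of_int p / of_int d" by (rule rat_reduced)
  have nz: "m \<noteq> 0" "p \<noteq> 0" using False n d by auto
  have xy: "x * y = of_int (m * p) / of_int (n * d)" using n d by simp
  have "norm2 (x * y) = 2 powi (int (multiplicity 2 (n * d)) - int (multiplicity 2 (m * p)))"
    unfolding xy by (rule norm2_fraction) (use n d nz in auto)
  also have "int (multiplicity 2 (n * d)) - int (multiplicity 2 (m * p)) =
      (int (multiplicity 2 n) - int (multiplicity 2 m)) + (int (multiplicity 2 d) - int (multiplicity 2 p))"
    using n d nz by (simp add: prime_elem_multiplicity_mult_distrib)
  also have "(2::real) powi \<dots> = norm2 x * norm2 y"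
    using norm2_fraction[of m n] norm2_fraction[of p d] n d nz by (simp add: power_int_add)
  finally show ?thesis .
qed auto

lemma norm2_odd: "odd n \<Longrightarrow> norm2 (of_int n) = 1"
  using norm2_fraction[of n 1] by (cases "n = 0") (auto simp: not_dvd_imp_multiplicity_0)

lemma norm2_1 [simp]: "norm2 1 = 1"
  using norm2_odd[of 1] by simp

lemma norm2_2: "norm2 2 = 1 / 2"
  using norm2_fraction[of 2 1] by simp

lemma norm2_int: "norm2 (of_int n) \<le> 1"
proof (cases "n = 0")
  case False
  then show ?thesis using norm2_fraction[of n 1] by (simp add: power_int_minus inverse_le_1_iff)
qed simp

lemma norm2_uminus [simp]: "norm2 (- x) = norm2 x"
  using norm2_mult[of "-1" x] norm2_odd[of "-1"] by simp

lemma norm2_power: "norm2 (x ^ n) = norm2 x ^ n"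
  by (induction n) (auto simp: norm2_mult)

lemma norm2_divide: "norm2 (x / y) = norm2 x / norm2 y"
proof (cases "y = 0")
  case False
  then have "norm2 x = norm2 (x / y) * norm2 y" using norm2_mult[of "x / y" y] by simp
  then show ?thesis using False by simp
qed simp

text \<open>Norm at most 1 means an odd denominator in lowest terms. The ultrametric inequality
  follows from this by scaling.\<close>

lemma norm2_1_add:
  assumes "norm2 z \<le> 1" shows "norm2 (1 + z) \<le> 1"
proof -
  obtain m n :: int where n: "n > 0" "coprime m n" "z = of_int m / of_int n" by (rule rat_reduced)
  have "odd n"
  proof
    assume "even n"
    then have "odd m" using n(2) by (metis coprime_common_divisor even_iff_mod_2_eq_zero odd_one)
    then have "norm2 z = inverse (norm2 (of_int n))" using norm2_odd unfolding n(3) norm2_divide by (simp add: field_simps)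
    moreover have "norm2 (of_int n) \<le> 1 / 2"
    proof -
      obtain k where "n = 2 * k" using \<open>even n\<close> by (rule evenE)
      then show ?thesis using norm2_mult[of 2 "of_int k"] norm2_int[of k] norm2_2 by simp
    qed
    moreover have "norm2 (of_int n) > 0" using n(1) norm2_nonneg[of "of_int n"] by (simp add: order_less_le)
    ultimately have "norm2 z \<ge> 2" by (simp add: field_simps)
    then show False using assms by simp
  qed
  have "1 + z = of_int (n + m) / of_int n" using n by (simp add: field_simps)
  then have "norm2 (1 + z) = norm2 (of_int (n + m)) / norm2 (of_int n)" by (simp only: norm2_divide)
  then show ?thesis using norm2_int[of "n + m"] norm2_odd[OF \<open>odd n\<close>] by simp
qed

lemma norm2_add: "norm2 (x + y) \<le> max (norm2 x) (norm2 y)"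
proof -
  have *: "norm2 (x + y) \<le> norm2 x" if "norm2 y \<le> norm2 x" for x y
  proof (cases "x = 0")
    case True
    then show ?thesis using that norm2_nonneg[of y] norm2_eq_0_iff[of y] by simp
  next
    case False
    have "x + y = x * (1 + y / x)" using False by (simp add: field_simps)
    moreover have "norm2 (y / x) \<le> 1"
      using that norm2_nonneg[of x] False unfolding norm2_divide by (simp add: divide_le_eq_1 order_less_le)
    ultimately show ?thesis using norm2_1_add[of "y / x"] norm2_nonneg[of x]
      by (simp add: norm2_mult mult_left_le)
  qed
  show ?thesis using *[of y x] *[of x y] by (cases "norm2 y \<le> norm2 x") (auto simp: add.commute max_def)
qed

lemma norm2_diff_mod_32:
  assumes "i mod 32 = (j mod 32 :: int)" shows "norm2 (of_int (i - j)) \<le> 1 / 32"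
proof -
  have "32 dvd i - j" using assms by (simp add: mod_eq_dvd_iff)
  then obtain k where k: "i - j = 32 * k" by (rule dvdE)
  have "norm2 (of_int (i - j)) = norm2 (2 ^ 5 * of_int k)" unfolding k by simp
  also have "\<dots> = (1 / 2) ^ 5 * norm2 (of_int k)" by (simp only: norm2_mult norm2_power norm2_2)
  also have "\<dots> \<le> (1 / 2) ^ 5 * 1" by (intro mult_left_mono norm2_int) simp
  finally show ?thesis by (simp add: power_one_over)
qed

lemma norm2_add_le: "norm2 x \<le> c \<Longrightarrow> norm2 y \<le> c \<Longrightarrow> norm2 (x + y) \<le> c"
  using norm2_add[of x y] by linarith

lemma norm2_diff_le: "norm2 x \<le> c \<Longrightarrow> norm2 y \<le> c \<Longrightarrow> norm2 (x - y) \<le> c"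
  using norm2_add_le[of x c "- y"] by simp

lemma norm2_add_less: "norm2 x < c \<Longrightarrow> norm2 y < c \<Longrightarrow> norm2 (x + y) < c"
  using norm2_add[of x y] by linarith

lemma norm2_add_eq:
  assumes "norm2 y < norm2 x" shows "norm2 (x + y) = norm2 x"
proof -
  have "norm2 x \<le> max (norm2 (x + y)) (norm2 y)" using norm2_add[of "x + y" "- y"] by simp
  then show ?thesis using assms norm2_add[of x y] by linarith
qed

lemma norm2_diff_eq: "norm2 y < norm2 x \<Longrightarrow> norm2 (x - y) = norm2 x"
  using norm2_add_eq[of "- y" x] by simp

lemma norm2_mult_le: "norm2 x \<le> c \<Longrightarrow> norm2 y \<le> d \<Longrightarrow> norm2 (x * y) \<le> c * d"
  unfolding norm2_mult by (intro mult_mono norm2_nonneg) (auto intro: order_trans[OF norm2_nonneg])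

lemma norm2_mult_int_le: "norm2 x \<le> c \<Longrightarrow> norm2 (x * of_int n) \<le> c"
  using norm2_mult_le[OF _ norm2_int[of n], of x c] by simp

section \<open>A monic cubic at integers congruent modulo 32\<close>

locale monic_cubic =
  fixes A B C :: rat
begin

definition f :: "rat \<Rightarrow> rat" where "f z = z ^ 3 + A * z ^ 2 + B * z + C"

text \<open>The Gauss norm of \<open>f\<close>; the 1 comes from the leading coefficient.\<close>

definition M :: real where "M = max 1 (max (norm2 A) (max (norm2 B) (norm2 C)))"

lemma M: "M \<ge> 1" "norm2 A \<le> M" "norm2 B \<le> M" "norm2 C \<le> M"
  unfolding M_def by auto

text \<open>The coefficients are recovered from four values by Newton interpolation, where all
  differences of the nodes have 2-adic norm at least 1/2.\<close>
lemma norm2_coeffs_le_values: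
  fixes i :: "nat \<Rightarrow> int"
  assumes i: "\<And>k. k < 4 \<Longrightarrow> i k mod 4 = int k"
    and e: "\<And>k. k < 4 \<Longrightarrow> norm2 (f (of_int (i k))) \<le> e"
  shows "M \<le> 2 * e"
proof -
  define r :: "nat \<Rightarrow> rat" where "r k = of_int (i k)" for k
  have i4: "i 0 mod 4 = 0" "i 1 mod 4 = 1" "i 2 mod 4 = 2" "i 3 mod 4 = 3"
    using i[of 0] i[of 1] i[of 2] i[of 3] by auto
  have odd: "odd (i 0 - i 1)" "odd (i 1 - i 2)" "odd (i 2 - i 3)" "odd (i 0 - i 3)"
    using i4 by presburger+
  have n1: "norm2 (r 0 - r 1) = 1" "norm2 (r 1 - r 2) = 1" "norm2 (r 2 - r 3) = 1" "norm2 (r 0 - r 3) = 1"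
    using odd[THEN norm2_odd] unfolding r_def by simp_all
  have ex: "\<exists>k. i 0 - i 2 = 2 * k \<and> odd k" "\<exists>k. i 1 - i 3 = 2 * k \<and> odd k"
    using i4 by presburger+
  have n2: "norm2 (r 0 - r 2) = 1 / 2" "norm2 (r 1 - r 3) = 1 / 2"
  proof -
    have "norm2 (of_int (i u - i v)) = 1 / 2" if h: "\<exists>k. i u - i v = 2 * k \<and> odd k" for u v
    proof -
      obtain k where "i u - i v = 2 * k" "odd k" using h by blast
      then show ?thesis using norm2_mult[of 2 "of_int k"] norm2_odd[of k] norm2_2 by simp
    qed
    then show "norm2 (r 0 - r 2) = 1 / 2" "norm2 (r 1 - r 3) = 1 / 2"
      using ex unfolding r_def by fastforce+
  qed
  have q: "norm2 u \<le> d / c" if "norm2 v \<le> d" "w * u = v" "norm2 w = c" "c > 0" for u v w c d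
    using that norm2_mult[of w u] by (auto simp: field_simps)
  have fk: "norm2 (f (r k)) \<le> e" if "k < 4" for k using e[OF that] unfolding r_def .
  have e0: "e \<ge> 0" using fk[of 0] norm2_nonneg[of "f (r 0)"] by linarith
  have r1: "norm2 (r k) \<le> 1" for k unfolding r_def by (rule norm2_int)
  define g where "g u v = u ^ 2 + u * v + v ^ 2 + A * (u + v) + B" for u v
  define h where "h u v w = u + v + w + A" for u v w
  have g: "norm2 (g (r 0) (r 1)) \<le> e" "norm2 (g (r 1) (r 2)) \<le> e" "norm2 (g (r 2) (r 3)) \<le> e"
  proof -
    have id: "(u - v) * g u v = f u - f v" for u v unfolding g_def f_def by algebra
    show "norm2 (g (r 0) (r 1)) \<le> e" using q[OF norm2_diff_le[OF fk fk] id n1(1)] by simp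
    show "norm2 (g (r 1) (r 2)) \<le> e" using q[OF norm2_diff_le[OF fk fk] id n1(2)] by simp
    show "norm2 (g (r 2) (r 3)) \<le> e" using q[OF norm2_diff_le[OF fk fk] id n1(3)] by simp
  qed
  \<comment> \<open>Nodes two apart modulo 4 have a difference of norm 1/2, which costs the factor 2
    in the second divided differences. The third one is 1, as \<open>f\<close> is monic, and its
    outer nodes differ by an odd number, so the factor is lost only once.\<close>
  have h: "norm2 (h (r 0) (r 1) (r 2)) \<le> 2 * e" "norm2 (h (r 1) (r 2) (r 3)) \<le> 2 * e"
  proof -
    have id: "(u - w) * h u v w = g u v - g v w" for u v w unfolding g_def h_def by algebra
    show "norm2 (h (r 0) (r 1) (r 2)) \<le> 2 * e" using q[OF norm2_diff_le[OF g(1,2)] id n2(1)] by simp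
    show "norm2 (h (r 1) (r 2) (r 3)) \<le> 2 * e" using q[OF norm2_diff_le[OF g(2,3)] id n2(2)] by simp
  qed
  have "norm2 1 \<le> 2 * e"
  proof -
    have "(r 0 - r 3) * 1 = h (r 0) (r 1) (r 2) - h (r 1) (r 2) (r 3)" unfolding h_def by simp
    from q[OF norm2_diff_le[OF h] this n1(4)] show ?thesis by simp
  qed
  then have e1: "1 \<le> 2 * e" by simp
  have r2: "norm2 (r k) \<le> 2 * e" for k using r1[of k] e1 by linarith
  have A: "norm2 A \<le> 2 * e"
  proof -
    have "norm2 (h (r 0) (r 1) (r 2) - (r 0 + r 1 + r 2)) \<le> 2 * e"
      by (intro norm2_diff_le norm2_add_le h r2)
    then show ?thesis unfolding h_def by simp
  qed
  have I: "norm2 (of_int n) \<le> 2 * e" for n using norm2_int[of n] e1 by linarith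
  have B: "norm2 B \<le> 2 * e"
  proof -
    have "g (r 0) (r 1) - (of_int (i 0 ^ 2 + i 0 * i 1 + i 1 ^ 2) + A * of_int (i 0 + i 1)) = B"
      unfolding g_def r_def by simp
    moreover have "norm2 (g (r 0) (r 1) - (of_int (i 0 ^ 2 + i 0 * i 1 + i 1 ^ 2) + A * of_int (i 0 + i 1))) \<le> 2 * e"
      using g(1) e0 by (intro norm2_diff_le norm2_add_le I norm2_mult_int_le A) simp
    ultimately show ?thesis by simp
  qed
  have C: "norm2 C \<le> 2 * e"
  proof -
    have "f (r 0) - (of_int (i 0 ^ 3) + A * of_int (i 0 ^ 2) + B * of_int (i 0)) = C"
      unfolding f_def r_def by simp
    moreover have "norm2 (f (r 0) - (of_int (i 0 ^ 3) + A * of_int (i 0 ^ 2) + B * of_int (i 0))) \<le> 2 * e"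
      using fk[of 0] e0 by (intro norm2_diff_le norm2_add_le I norm2_mult_int_le A B) simp
    ultimately show ?thesis by simp
  qed
  show ?thesis using e1 A B C unfolding M_def by simp
qed

text \<open>Otherwise every class modulo 4 contains an index with small value, and four such indices
  contradict \<open>norm2_coeffs_le_values\<close>. On the class found here \<open>f\<close> stays
  away from zero 2-adically.\<close>

lemma exists_good_residue:
  "\<exists>c\<in>{0..<4}. \<forall>i::int. i mod 4 = c \<longrightarrow> i \<in> S \<longrightarrow> M \<le> 2 * norm2 (f (of_int i))"
proof (rule ccontr)
  assume "\<not> ?thesis"
  then have "\<exists>i. i mod 4 = int k \<and> \<not> M \<le> 2 * norm2 (f (of_int i))" if "k < 4" for k
    using that by (meson atLeastLessThan_iff of_nat_0_le_iff of_nat_less_numeral_iff)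
  then obtain i where i: "\<And>k. k < 4 \<Longrightarrow> i k mod 4 = int k"
     "\<And>k. k < 4 \<Longrightarrow> \<not> M \<le> 2 * norm2 (f (of_int (i k)))" by metis
  define e where "e = Max ((\<lambda>k. norm2 (f (of_int (i k)))) ` {..<4})"
  have "e \<in> (\<lambda>k. norm2 (f (of_int (i k)))) ` {..<4}" unfolding e_def by (rule Max_in) (auto simp: lessThan_empty_iff)
  then obtain k where k: "k < 4" "e = norm2 (f (of_int (i k)))" by auto
  have ge: "norm2 (f (of_int (i k))) \<le> e" if "k < 4" for k
    unfolding e_def using that by (intro Max_ge) auto
  have "M \<le> 2 * e" by (rule norm2_coeffs_le_values[OF i(1) ge])
  then show False using i(2)[OF k(1)] k(2) by simp
qed

lemma norm2_f_diff:
  "norm2 (f (of_int i) - f (of_int j)) \<le> norm2 (of_int (i - j)) * M"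
proof -
  have "f (of_int i) - f (of_int j) =
      of_int (i - j) * (of_int (i ^ 2 + i * j + j ^ 2) + A * of_int (i + j) + B)"
    unfolding f_def by (simp, algebra)
  moreover have "norm2 (of_int (i ^ 2 + i * j + j ^ 2) + A * of_int (i + j) + B) \<le> M"
  proof -
    have "norm2 (of_int n) \<le> M" for n using norm2_int[of n] M(1) by linarith
    then show ?thesis by (intro norm2_add_le norm2_mult_int_le M)
  qed
  ultimately show ?thesis using norm2_mult_le[OF order_refl] by simp
qed

text \<open>From \<open>i mod 32 = j mod 32\<close> and \<open>good\<close> the relative error of
  \<open>f j\<close> against \<open>f i\<close> is at most 2/32. The factors of
  \<open>(w - f i) * (w + f i) = f i * (f j - f i)\<close> differ by \<open>2 * f i\<close>, so one
  of them has half the norm of \<open>f i\<close> and the other at most 1/8 of it.\<close>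

lemma square_root_sign:
  assumes good: "M \<le> 2 * norm2 (f (of_int i))" and ij: "i mod 32 = j mod 32"
    and w: "w ^ 2 = f (of_int i) * f (of_int j)"
  shows "norm2 (f (of_int j) - f (of_int i)) \<le> norm2 (f (of_int i)) / 16"
    "norm2 (f (of_int j)) = norm2 (f (of_int i))"
    "norm2 (w - f (of_int i)) \<le> norm2 (f (of_int i)) / 8 \<or> norm2 (w + f (of_int i)) \<le> norm2 (f (of_int i)) / 8"
proof -
  let ?f = "f (of_int i)" and ?g = "f (of_int j)"
  have pos: "norm2 ?f > 0" using good M(1) by linarith
  have "norm2 (of_int (j - i)) \<le> 1 / 32" using ij by (intro norm2_diff_mod_32) simp
  then have "norm2 (of_int (j - i)) * M \<le> 1 / 32 * (2 * norm2 ?f)"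
    using good M(1) norm2_nonneg by (intro mult_mono) auto
  then show d: "norm2 (?g - ?f) \<le> norm2 ?f / 16"
    using norm2_f_diff[of j i] by simp
  then have "norm2 (?f + (?g - ?f)) = norm2 ?f" using pos by (intro norm2_add_eq) simp
  then show "norm2 ?g = norm2 ?f" by simp
  have "(w - ?f) * (w + ?f) = ?f * (?g - ?f)" using w by algebra
  then have p: "norm2 (w - ?f) * norm2 (w + ?f) = norm2 ?f * norm2 (?g - ?f)" by (metis norm2_mult)
  also have "\<dots> \<le> norm2 ?f * (norm2 ?f / 16)" using d norm2_nonneg by (intro mult_left_mono)
  finally have le: "norm2 (w - ?f) * norm2 (w + ?f) \<le> norm2 ?f * (norm2 ?f / 16)" .
  have two: "norm2 (2 * ?f) = norm2 ?f / 2" by (simp add: norm2_mult norm2_2)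
  show "norm2 (w - ?f) \<le> norm2 ?f / 8 \<or> norm2 (w + ?f) \<le> norm2 ?f / 8"
  proof (cases "norm2 (w - ?f) \<le> norm2 ?f / 4")
    case True
    then have "norm2 (2 * ?f + (w - ?f)) = norm2 (2 * ?f)" using pos two by (intro norm2_add_eq) simp
    then have e: "norm2 (w + ?f) = norm2 ?f / 2" unfolding two by (simp add: add.commute)
    have "(norm2 ?f / 2) * norm2 (w - ?f) \<le> (norm2 ?f / 2) * (norm2 ?f / 8)"
      using le unfolding e by (simp add: mult.commute)
    then show ?thesis using pos by simp
  next
    case False
    have "norm2 (w + ?f) \<le> norm2 ?f / 4"
    proof (rule ccontr)
      assume "\<not> norm2 (w + ?f) \<le> norm2 ?f / 4"
      then have "(norm2 ?f / 4) * (norm2 ?f / 4) < norm2 (w - ?f) * norm2 (w + ?f)"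
        using False pos by (intro mult_strict_mono) auto
      then show False using le by simp
    qed
    then have "norm2 (w + ?f) < norm2 (2 * ?f)" using pos two by linarith
    then have "norm2 (w + ?f - 2 * ?f) = norm2 ?f / 2"
      using norm2_diff_eq[of "w + ?f" "2 * ?f"] norm2_uminus[of "w - ?f"] two by simp
    then have e: "norm2 (w - ?f) = norm2 ?f / 2" by simp
    have "(norm2 ?f / 2) * norm2 (w + ?f) \<le> (norm2 ?f / 2) * (norm2 ?f / 8)"
      using le unfolding e by simp
    then show ?thesis using pos by simp
  qed
qed

text \<open>The three square roots cannot all have the sign \<open>-1\<close>, because their product is
  2-adically close to \<open>f(i)\<^sup>3\<close>.\<close>
lemma three_square_roots:
  assumes good: "M \<le> 2 * norm2 (f (of_int i))" "M \<le> 2 * norm2 (f (of_int j))"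
    and mods: "i mod 32 = j mod 32" "i mod 32 = k mod 32"
    and w: "u ^ 2 = f (of_int i) * f (of_int j)" "v ^ 2 = f (of_int i) * f (of_int k)"
      "w ^ 2 = f (of_int j) * f (of_int k)"
    and prod: "u * v * w = f (of_int i) * f (of_int j) * f (of_int k)"
  shows "norm2 (u - f (of_int i)) \<le> norm2 (f (of_int i)) / 8 \<or>
         norm2 (v - f (of_int i)) \<le> norm2 (f (of_int i)) / 8 \<or>
         norm2 (w - f (of_int j)) \<le> norm2 (f (of_int j)) / 8"
proof (rule ccontr)
  assume neg: "\<not> ?thesis"
  let ?f = "f (of_int i)" and ?g = "f (of_int j)" and ?h = "f (of_int k)"
  define n where "n = norm2 ?f"
  have pos: "n > 0" using good M(1) unfolding n_def by linarith
  then have f0: "?f \<noteq> 0" unfolding n_def by auto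
  note s1 = square_root_sign[OF good(1) mods(1) w(1)] and s2 = square_root_sign[OF good(1) mods(2) w(2)]
  have jk: "j mod 32 = k mod 32" using mods by simp
  note s3 = square_root_sign[OF good(2) jk w(3)]
  have uvw: "norm2 (u + ?f) \<le> n / 8" "norm2 (v + ?f) \<le> n / 8" "norm2 (w + ?g) \<le> n / 8"
    using neg s1 s2 s3 unfolding n_def by auto
  have "norm2 (?g - ?f) \<le> n / 8" using s1(1) pos unfolding n_def by linarith
  then have "norm2 ((w + ?g) - (?g - ?f)) \<le> n / 8" by (rule norm2_diff_le[OF uvw(3)])
  then have w': "norm2 (w + ?f) \<le> n / 8" by simp
  have r: "norm2 (x / ?f + 1) \<le> 1 / 8" "norm2 (x / ?f) \<le> 1" if "norm2 (x + ?f) \<le> n / 8" for x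
  proof -
    have "x / ?f + 1 = (x + ?f) / ?f" using f0 by (simp add: field_simps)
    then show 1: "norm2 (x / ?f + 1) \<le> 1 / 8"
      using that pos unfolding n_def by (simp add: norm2_divide field_simps)
    then show "norm2 (x / ?f) \<le> 1" using norm2_diff_le[of "x / ?f + 1" 1 1] by simp
  qed
  have s: "norm2 (x / ?f - 1) \<le> 1 / 8" "norm2 (x / ?f) \<le> 1" if "norm2 (x - ?f) \<le> n / 16" for x
  proof -
    have "x / ?f - 1 = (x - ?f) / ?f" using f0 by (simp add: field_simps)
    then show 1: "norm2 (x / ?f - 1) \<le> 1 / 8"
      using that pos unfolding n_def by (simp add: norm2_divide field_simps)
    then show "norm2 (x / ?f) \<le> 1" using norm2_add_le[of "x / ?f - 1" 1 1] by simp
  qed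
  have s12: "norm2 (?g - ?f) \<le> n / 16" "norm2 (?h - ?f) \<le> n / 16" using s1(1) s2(1) unfolding n_def .
  let ?a = "u / ?f" and ?b = "v / ?f" and ?c = "w / ?f" and ?d = "?g / ?f" and ?e = "?h / ?f"
  have "?a * ?b * ?c = ?d * ?e" using prod f0 by (simp add: field_simps)
  \<comment> \<open>Telescoped forms of \<open>p * q * r + 1\<close> and \<open>s * t - 1\<close>:
    with \<open>p\<close>, \<open>q\<close>, \<open>r\<close> close to -1 and \<open>s\<close>,
    \<open>t\<close> close to 1, the number 2 would be small.\<close>
  moreover have "2 = ((p + 1) * (q * r) - (q + 1) * r + (r + 1)) - ((s - 1) * t + (t - 1))"
    if "p * q * r = s * t" for p q r s t :: rat using that by algebra
  ultimately have "2 = ((?a + 1) * (?b * ?c) - (?b + 1) * ?c + (?c + 1)) - ((?d - 1) * ?e + (?e - 1))"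
    by blast
  moreover have "norm2 (((?a + 1) * (?b * ?c) - (?b + 1) * ?c + (?c + 1)) - ((?d - 1) * ?e + (?e - 1))) \<le> 1 / 8"
  proof -
    have bc: "norm2 (?b * ?c) \<le> 1" using norm2_mult_le[OF r(2)[OF uvw(2)] r(2)[OF w']] by simp
    have p1: "norm2 ((?a + 1) * (?b * ?c)) \<le> 1 / 8" using norm2_mult_le[OF r(1)[OF uvw(1)] bc] by simp
    have p2: "norm2 ((?b + 1) * ?c) \<le> 1 / 8" using norm2_mult_le[OF r(1)[OF uvw(2)] r(2)[OF w']] by simp
    have p3: "norm2 ((?d - 1) * ?e) \<le> 1 / 8" using norm2_mult_le[OF s(1)[OF s12(1)] s(2)[OF s12(2)]] by simp
    show ?thesis
      by (rule norm2_diff_le[OF norm2_add_le[OF norm2_diff_le[OF p1 p2] r(1)[OF w']]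
            norm2_add_le[OF p3 s(1)[OF s12(2)]]])
  qed
  ultimately have "norm2 2 \<le> 1 / 8" by metis
  then show False by (simp add: norm2_2)
qed

text \<open>In the application the expression is the coordinate \<open>(x - s) / t\<close> of a
  difference of two points of the progression. With the right sign of \<open>w\<close> the numerator
  \<open>4 * f i + (f j - f i) + 2 * (w - f i)\<close> has the norm of its first term, a quarter of
  that of \<open>f i\<close>, while the denominator has norm at most
  \<open>(1 / 32) ^ 2\<close>.\<close>

lemma norm2_difference_point:
  assumes good: "M \<le> 2 * norm2 (f (of_int i))" and ij: "i mod 32 = j mod 32" "i \<noteq> j"
    and w: "w ^ 2 = f (of_int i) * f (of_int j)" and sign: "norm2 (w - f (of_int i)) \<le> norm2 (f (of_int i)) / 8"
  shows "norm2 ((f (of_int i) + f (of_int j) + 2 * w) / (of_int (i - j)) ^ 2 - (A + of_int i + of_int j)) > M"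
proof -
  let ?f = "f (of_int i)" and ?g = "f (of_int j)"
  have pos: "norm2 ?f > 0" using good M(1) by linarith
  have four: "norm2 (4 * ?f) = norm2 ?f / 4"
    using norm2_mult[of 2 "2 * ?f"] norm2_mult[of 2 ?f] by (simp add: norm2_2)
  have "norm2 (2 * (w - ?f)) \<le> norm2 ?f / 16" using sign unfolding norm2_mult norm2_2 by simp
  then have "norm2 ((?g - ?f) + 2 * (w - ?f)) \<le> norm2 ?f / 16"
    by (rule norm2_add_le[OF square_root_sign(1)[OF good ij(1) w]])
  then have n4: "norm2 (4 * ?f + ((?g - ?f) + 2 * (w - ?f))) = norm2 (4 * ?f)"
    using pos four by (intro norm2_add_eq) simp
  have e4: "4 * ?f + ((?g - ?f) + 2 * (w - ?f)) = ?f + ?g + 2 * w" by simp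
  have num: "norm2 (?f + ?g + 2 * w) = norm2 ?f / 4" using n4 unfolding e4 four .
  define d where "d = norm2 (of_int (i - j))"
  have "d > 0" using ij(2) norm2_nonneg[of "of_int (i - j)"] norm2_eq_0_iff[of "of_int (i - j)"]
    unfolding d_def by (simp add: order_less_le)
  moreover have "d \<le> 1 / 32" unfolding d_def using ij(1) by (rule norm2_diff_mod_32)
  ultimately have d: "0 < d ^ 2" "d ^ 2 \<le> (1 / 32) ^ 2" by (simp_all add: power_mono)
  have "norm2 ((?f + ?g + 2 * w) / (of_int (i - j)) ^ 2) = norm2 ?f / 4 / d ^ 2"
    unfolding norm2_divide num norm2_power d_def ..
  also have "\<dots> > M"
  proof -
    have "M * d ^ 2 \<le> (2 * norm2 ?f) * (1 / 32) ^ 2" using good M(1) d by (intro mult_mono) auto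
    also have "\<dots> < norm2 ?f / 4" using pos by (simp add: power2_eq_square)
    finally show ?thesis using d(1) by (simp add: field_simps)
  qed
  finally have big: "norm2 ((?f + ?g + 2 * w) / (of_int (i - j)) ^ 2) > M" .
  have "norm2 (A + of_int i + of_int j) \<le> M"
    using M(1,2) norm2_int by (intro norm2_add_le) (auto intro: order_trans)
  then have "norm2 (A + of_int i + of_int j) < norm2 ((?f + ?g + 2 * w) / (of_int (i - j)) ^ 2)"
    using big by linarith
  then show ?thesis using big by (simp only: norm2_diff_eq)
qed

text \<open>This is the duplication formula for the cubic. Where \<open>norm2 z\<close> exceeds the
  Gauss norm, the terms \<open>z ^ 4\<close> and \<open>4 * z ^ 3\<close> dominate, so that doubling
  changes the norm like division of \<open>z\<close> by 4.\<close>

lemma norm2_doubling: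
  assumes z: "norm2 z > M"
  shows "f z \<noteq> 0"
    "norm2 ((3 * z ^ 2 + 2 * A * z + B) ^ 2 / (4 * f z) - 2 * z - A) = 4 * norm2 z"
proof -
  let ?n = "norm2 z"
  have n: "?n > 1" "?n > M" using z M(1) by linarith+
  have lt: "M * ?n < ?n ^ 2" using n by (simp add: power2_eq_square)
  have n23: "?n ^ 2 < ?n ^ 3" "?n ^ 3 < ?n ^ 4" "?n < ?n ^ 2"
    using n(1) power_strict_increasing[of 2 3 ?n] power_strict_increasing[of 3 4 ?n]
      power_strict_increasing[of 1 2 ?n] by simp_all
  have A: "norm2 (A * z ^ 2) < ?n ^ 3"
  proof -
    have "norm2 (A * z ^ 2) \<le> M * ?n ^ 2" using M(2) by (intro norm2_mult_le) (auto simp: norm2_power)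
    also have "\<dots> < ?n * ?n ^ 2" using n by (intro mult_strict_right_mono) auto
    finally show ?thesis by (simp add: power_numeral_reduce)
  qed
  have "norm2 (B * z) \<le> M * ?n" using M(3) by (intro norm2_mult_le) auto
  then have B: "norm2 (B * z) < ?n ^ 3" using lt n23 by linarith
  have C: "norm2 C < ?n ^ 3" using M(4) n n23 by linarith
  have "norm2 (A * z ^ 2 + (B * z + C)) < norm2 (z ^ 3)"
    unfolding norm2_power using A B C by (intro norm2_add_less)
  then have "norm2 (z ^ 3 + (A * z ^ 2 + (B * z + C))) = norm2 (z ^ 3)" by (rule norm2_add_eq)
  then have fz: "norm2 (f z) = ?n ^ 3" unfolding f_def norm2_power by (simp add: add.assoc)
  then show f0: "f z \<noteq> 0" using n by auto
  have int: "norm2 (of_int k * x) \<le> norm2 x" for k x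
    using norm2_mult_le[OF norm2_int[of k] order_refl[of "norm2 x"]] by simp
  have M2: "M * M < ?n ^ 2" unfolding power2_eq_square using n M(1) by (intro mult_strict_mono) auto
  have 1: "norm2 (B * z ^ 2) < ?n ^ 4"
  proof -
    have "norm2 (B * z ^ 2) \<le> M * ?n ^ 2" using M(3) by (intro norm2_mult_le) (auto simp: norm2_power)
    also have "\<dots> < ?n * ?n ^ 2" using n by (intro mult_strict_right_mono) auto
    finally show ?thesis using n23 by (simp add: power_numeral_reduce)
  qed
  have "norm2 (C * z) \<le> M * ?n" using M(4) by (intro norm2_mult_le) auto
  then have 2: "norm2 (C * z) < ?n ^ 4" using lt n23 by linarith
  have "norm2 (B ^ 2) \<le> M * M" unfolding power2_eq_square using M(3) by (intro norm2_mult_le)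
  then have 3: "norm2 (B ^ 2) < ?n ^ 4" using M2 n23 by linarith
  have "norm2 (A * C) \<le> M * M" using M(2,4) by (intro norm2_mult_le)
  then have 4: "norm2 (A * C) < ?n ^ 4" using M2 n23 by linarith
  have "norm2 (of_int (- 2) * (B * z ^ 2) + (of_int (- 8) * (C * z) + (B ^ 2 + of_int (- 4) * (A * C)))) < norm2 (z ^ 4)"
    unfolding norm2_power using 1 2 3 4 by (intro norm2_add_less le_less_trans[OF int])
  then have num: "norm2 (z ^ 4 + (of_int (- 2) * (B * z ^ 2) + (of_int (- 8) * (C * z) + (B ^ 2 + of_int (- 4) * (A * C))))) = norm2 (z ^ 4)"
    by (rule norm2_add_eq)
  have "(3 * z ^ 2 + 2 * A * z + B) ^ 2 / (4 * f z) - 2 * z - A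
     = ((3 * z ^ 2 + 2 * A * z + B) ^ 2 - (2 * z + A) * (4 * f z)) / (4 * f z)"
    using f0 by (simp add: field_simps)
  also have "(3 * z ^ 2 + 2 * A * z + B) ^ 2 - (2 * z + A) * (4 * f z)
     = z ^ 4 + (of_int (- 2) * (B * z ^ 2) + (of_int (- 8) * (C * z) + (B ^ 2 + of_int (- 4) * (A * C))))"
    unfolding f_def by (simp, algebra)
  finally have "norm2 ((3 * z ^ 2 + 2 * A * z + B) ^ 2 / (4 * f z) - 2 * z - A) = norm2 (z ^ 4) / norm2 (4 * f z)"
    by (simp only: norm2_divide num)
  also have "norm2 (4 * f z) = norm2 (f z) / 4"
    using norm2_mult[of 2 "2 * f z"] norm2_mult[of 2 "f z"] by (simp add: norm2_2)
  also have "norm2 (z ^ 4) / (norm2 (f z) / 4) = 4 * norm2 z"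
    unfolding fz norm2_power using n by (simp add: power_numeral_reduce)
  finally show "norm2 ((3 * z ^ 2 + 2 * A * z + B) ^ 2 / (4 * f z) - 2 * z - A) = 4 * norm2 z" .
qed

end

section \<open>Torsion and differences of points\<close>

context integral_curve
begin

lemma torsion_iff_tors: "on_curve E P \<Longrightarrow> torsion E P \<longleftrightarrow> P \<in> tors"
  unfolding torsion_def tors_def by (auto simp: pmult_G one_G)

definition pdiff :: "point \<Rightarrow> point \<Rightarrow> point" where
  "pdiff P Q = padd E P (pneg E Q)"

lemma pdiff_G: "on_curve E Q \<Longrightarrow> pdiff P Q = P \<otimes>\<^bsub>G\<^esub> inv\<^bsub>G\<^esub> Q"
  unfolding pdiff_def by (simp add: mult_G inv_G)

lemma on_curve_pdiff: "on_curve E P \<Longrightarrow> on_curve E Q \<Longrightarrow> on_curve E (pdiff P Q)"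
  unfolding pdiff_def by (intro on_curve_padd_short on_curve_pneg_short)

lemma pdiff_Aff:
  assumes "on_curve E (Aff x y)" "on_curve E (Aff x' y')" "x \<noteq> x'"
  shows "\<exists>w. pdiff (Aff x y) (Aff x' y') = Aff (((y + y') / (x - x')) ^ 2 - x - x') w"
proof -
  have on: "on_curve E (Aff x' (- y'))" using assms(2) by simp
  obtain l where sl: "slope (of_int a) x y x' (- y') l" using slope_exists[OF assms(1) on] assms(3) by blast
  then have "l = (y + y') / (x - x')" using assms(3) unfolding slope_def by (simp add: field_simps)
  then show ?thesis
    using padd_short_slope[OF assms(1) on sl] assms(3) unfolding pdiff_def by simp
qed

end

locale shifted_curve = integral_curve +
  fixes s t :: rat
  assumes t: "t \<noteq> 0"
begin

text \<open>These are the coefficients of the right-hand side at \<open>x = s + t * z\<close>,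
  divided by \<open>t ^ 3\<close> to make it monic. At the points of the progression
  \<open>z\<close> is the index, hence an integer.\<close>

sublocale monic_cubic "3 * s / t" "(3 * s ^ 2 + of_int a) / t ^ 2" "(s ^ 3 + of_int a * s + of_int b) / t ^ 3" .

lemma f_shift: "f z * t ^ 3 = (s + t * z) ^ 3 + of_int a * (s + t * z) + of_int b"
  using t unfolding f_def by (simp add: field_simps power2_eq_square power3_eq_cube)

lemma f_on_curve: "on_curve E (Aff (s + t * z) y) \<Longrightarrow> f z = y ^ 2 / t ^ 3"
  using f_shift[of z] t by (simp add: field_simps)

text \<open>\<open>Inf\<close> receives 0, although 2-adically it is a limit of points of large
  norm: a value above \<open>M\<close> then guarantees an affine point.\<close>

fun shifted_norm :: "point \<Rightarrow> real" where
  "shifted_norm Inf = 0"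
| "shifted_norm (Aff x y) = norm2 ((x - s) / t)"

lemma shifted_norm_double:
  assumes on: "on_curve E P" and big: "shifted_norm P > M"
  shows "shifted_norm (padd E P P) = 4 * shifted_norm P"
proof (cases P)
  case Inf
  then show ?thesis using big M(1) by simp
next
  case (Aff x y)
  define z where "z = (x - s) / t"
  have x: "x = s + t * z" using t unfolding z_def by simp
  have z: "norm2 z > M" using big Aff unfolding z_def by simp
  have fz: "f z = y ^ 2 / t ^ 3" using f_on_curve on unfolding Aff x .
  then have y: "y \<noteq> 0" using norm2_doubling(1)[OF z] by auto
  define l where "l = (3 * x ^ 2 + of_int a) / (2 * y)"
  have "slope (of_int a) x y x y l"
    using y unfolding slope_def l_def by (simp add: field_simps power2_eq_square)
  then have "padd E P P = Aff (l ^ 2 - x - x) (l * (x - (l ^ 2 - x - x)) - y)"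
    using padd_short_slope[of "of_int a" "of_int b" x y x y l] on Aff y by simp
  then have "shifted_norm (padd E P P) = norm2 ((l ^ 2 - x - x - s) / t)" by simp
  also have "(l ^ 2 - x - x - s) / t =
      (3 * z ^ 2 + 2 * (3 * s / t) * z + (3 * s ^ 2 + of_int a) / t ^ 2) ^ 2 / (4 * f z) - 2 * z - 3 * s / t"
  proof -
    have "3 * z ^ 2 + 2 * (3 * s / t) * z + (3 * s ^ 2 + of_int a) / t ^ 2 = (3 * x ^ 2 + of_int a) / t ^ 2"
      using t unfolding x by (simp add: field_simps power2_eq_square)
    moreover have "((3 * x ^ 2 + of_int a) / t ^ 2) ^ 2 / (4 * (y ^ 2 / t ^ 3)) = l ^ 2 / t"
      using t y unfolding l_def by (simp add: power_divide power_mult_distrib) (simp add: field_simps power_numeral_reduce)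
    moreover have "(l ^ 2 - x - x - s) / t = l ^ 2 / t - 2 * z - 3 * s / t"
      using t unfolding x by (simp add: field_simps)
    ultimately show ?thesis unfolding fz by simp
  qed
  also have "norm2 \<dots> = 4 * norm2 z" by (rule norm2_doubling(2)[OF z])
  finally show ?thesis using Aff unfolding z_def by simp
qed

text \<open>The norms of the points \<open>2 ^ k * P\<close> grow like \<open>4 ^ k\<close>, whereas
  a torsion point has finitely many multiples.\<close>

lemma not_torsion_of_shifted_norm:
  assumes on: "on_curve E P" and big: "shifted_norm P > M"
  shows "\<not> torsion E P"
proof
  assume "torsion E P"
  then obtain n :: nat where n: "n > 0" "P [^]\<^bsub>G\<^esub> n = \<one>\<^bsub>G\<^esub>"
    unfolding torsion_iff_tors[OF on] tors_def by auto
  have P: "P \<in> carrier G" using on by simp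
  have step: "shifted_norm (dbl k P) = 4 ^ k * shifted_norm P" for k
  proof (induction k)
    case (Suc k)
    have "1 * shifted_norm P \<le> 4 ^ k * shifted_norm P" using big M(1) by (intro mult_right_mono) auto
    then have "shifted_norm (dbl k P) > M" using Suc big by simp
    then show ?case unfolding dbl_Suc[OF on] using shifted_norm_double[OF on_curve_dbl[OF on]] Suc by simp
  qed (simp add: dbl_0[OF on])
  have "4 ^ k * shifted_norm P \<le> Max ((\<lambda>i. shifted_norm (P [^]\<^bsub>G\<^esub> i)) ` {..<n})" for k
  proof -
    have "4 ^ k * shifted_norm P = shifted_norm (P [^]\<^bsub>G\<^esub> (2 ^ k mod n))"
      using step[of k] dbl_G[OF on, of k] pow_mod_period[OF P n(2), of "2 ^ k"] by metis
    then show ?thesis using n(1) by (auto intro!: Max_ge)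
  qed
  then have "shifted_norm P \<le> 0" by (rule bounded_by_powers_of_four)
  then show False using big M(1) by linarith
qed

text \<open>For ordinates \<open>y\<close>, \<open>v\<close> of two points,
  \<open>y * v / t ^ 3\<close> is a square root of the product of the two values of
  \<open>f\<close>. In the product of the three roots each ordinate occurs twice, which gives the
  condition \<open>prod\<close> of \<open>three_square_roots\<close>; a pair with positive sign has
  a non-torsion difference.\<close>

lemma three_points_torsion:
  assumes on: "on_curve E (Aff (s + t * of_int i) y)" "on_curve E (Aff (s + t * of_int i') y')"
      "on_curve E (Aff (s + t * of_int i'') y'')"
    and good: "M \<le> 2 * norm2 (f (of_int i))" "M \<le> 2 * norm2 (f (of_int i'))"
    and mods: "i mod 32 = i' mod 32" "i mod 32 = i'' mod 32"
    and dist: "i \<noteq> i'" "i \<noteq> i''" "i' \<noteq> i''"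
  shows "\<not> torsion E (pdiff (Aff (s + t * of_int i) y) (Aff (s + t * of_int i') y')) \<or>
    \<not> torsion E (pdiff (Aff (s + t * of_int i) y) (Aff (s + t * of_int i'') y'')) \<or>
    \<not> torsion E (pdiff (Aff (s + t * of_int i') y') (Aff (s + t * of_int i'') y''))"
proof -
  have nt: "\<not> torsion E (pdiff (Aff (s + t * of_int i) y) (Aff (s + t * of_int j) v))"
    if on: "on_curve E (Aff (s + t * of_int i) y)" "on_curve E (Aff (s + t * of_int j) v)"
      and good: "M \<le> 2 * norm2 (f (of_int i))" and ij: "i mod 32 = j mod 32" "i \<noteq> j"
      and sign: "norm2 (y * v / t ^ 3 - f (of_int i)) \<le> norm2 (f (of_int i)) / 8" for i j y v
  proof (rule not_torsion_of_shifted_norm)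
    let ?x = "s + t * of_int i" and ?x' = "s + t * of_int j"
    show "on_curve E (pdiff (Aff ?x y) (Aff ?x' v))" by (rule on_curve_pdiff[OF on])
    have ne: "?x \<noteq> ?x'" using ij t by simp
    note fi = f_on_curve[OF on(1)] and fj = f_on_curve[OF on(2)]
    have w2: "(y * v / t ^ 3) ^ 2 = f (of_int i) * f (of_int j)"
      unfolding fi fj by (simp add: power_divide power_mult_distrib power2_eq_square)
    have "shifted_norm (pdiff (Aff ?x y) (Aff ?x' v)) = norm2 ((((y + v) / (?x - ?x')) ^ 2 - ?x - ?x' - s) / t)"
      using pdiff_Aff[OF on ne] by auto
    also have "(((y + v) / (?x - ?x')) ^ 2 - ?x - ?x' - s) / t =
       (f (of_int i) + f (of_int j) + 2 * (y * v / t ^ 3)) / (of_int (i - j)) ^ 2 - (3 * s / t + of_int i + of_int j)"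
    proof -
      have xx: "?x - ?x' = t * of_int (i - j)" by (simp add: algebra_simps)
      have d: "of_int (i - j) \<noteq> (0 :: rat)" using ij by simp
      have "((y + v) / (t * of_int (i - j))) ^ 2 / t = (y ^ 2 / t ^ 3 + v ^ 2 / t ^ 3 + 2 * (y * v / t ^ 3)) / (of_int (i - j)) ^ 2"
        using t d by (simp add: power_divide power_mult_distrib del: of_int_diff)
          (simp add: field_simps power_numeral_reduce del: of_int_diff)
      moreover have "(c - ?x - ?x' - s) / t = c / t - (3 * s / t + of_int i + of_int j)" for c
        using t by (simp add: field_simps)
      ultimately show ?thesis unfolding fi fj xx by simp
    qed
    also have "norm2 \<dots> > M"
      by (rule norm2_difference_point[OF good ij w2 sign])
    finally show "shifted_norm (pdiff (Aff ?x y) (Aff ?x' v)) > M" .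
  qed
  note fi = f_on_curve[OF on(1)] and fj = f_on_curve[OF on(2)] and fk = f_on_curve[OF on(3)]
  have sq: "(u * v / t ^ 3) ^ 2 = u ^ 2 / t ^ 3 * (v ^ 2 / t ^ 3)" for u v
    by (simp add: power_divide power_mult_distrib power2_eq_square)
  have m3: "i' mod 32 = i'' mod 32" using mods by simp
  have "norm2 (y * y' / t ^ 3 - f (of_int i)) \<le> norm2 (f (of_int i)) / 8 \<or>
         norm2 (y * y'' / t ^ 3 - f (of_int i)) \<le> norm2 (f (of_int i)) / 8 \<or>
         norm2 (y' * y'' / t ^ 3 - f (of_int i')) \<le> norm2 (f (of_int i')) / 8"
  proof (rule three_square_roots[OF good mods])
    show "y * y' / t ^ 3 * (y * y'' / t ^ 3) * (y' * y'' / t ^ 3) = f (of_int i) * f (of_int i') * f (of_int i'')"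
      unfolding fi fj fk by (simp add: power2_eq_square)
  qed (simp_all only: fi fj fk sq)
  then show ?thesis
    using nt[OF on(1,2) good(1) mods(1) dist(1)] nt[OF on(1,3) good(1) mods(2) dist(2)]
      nt[OF on(2,3) good(2) m3 dist(3)] by blast
qed

end

section \<open>Progressions on a fixed curve\<close>

lemma hQ_linear_combination_le:
  fixes \<alpha> \<beta> \<gamma> L :: int
  assumes "z = (of_int \<alpha> * x + of_int \<beta> * y) / of_int \<gamma>" "\<gamma> \<noteq> 0"
    and L: "\<bar>\<alpha>\<bar> \<le> L" "\<bar>\<beta>\<bar> \<le> L" "\<bar>\<gamma>\<bar> \<le> L"
  shows "hQ z \<le> 1 + ln L + hQ x + hQ y"
proof -
  obtain p d :: int where d: "d > 0" "x = of_int p / of_int d" and hx: "hQ x = ln (real_of_int (max \<bar>p\<bar> d))"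
    by (rule rat_reduced)
  obtain p' d' :: int where d': "d' > 0" "y = of_int p' / of_int d'" and hy: "hQ y = ln (real_of_int (max \<bar>p'\<bar> d'))"
    by (rule rat_reduced)
  define H where "H = max \<bar>p\<bar> d"
  define H' where "H' = max \<bar>p'\<bar> d'"
  have H: "H \<ge> 1" "\<bar>p\<bar> \<le> H" "\<bar>d\<bar> \<le> H" using d(1) unfolding H_def by auto
  have H': "H' \<ge> 1" "\<bar>p'\<bar> \<le> H'" "\<bar>d'\<bar> \<le> H'" using d'(1) unfolding H'_def by auto
  have L1: "L \<ge> 1" using assms(2) L(3) by linarith
  have pos: "0 < L * (H * H')" using L1 H(1) H'(1) by simp
  have "\<bar>\<alpha> * (p * d')\<bar> \<le> L * (H * H')" "\<bar>\<beta> * (p' * d)\<bar> \<le> L * (H' * H)" "\<bar>\<gamma> * (d * d')\<bar> \<le> L * (H * H')"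
    using L H H' by (intro abs_mult_le; simp)+
  then have "\<bar>\<alpha> * (p * d') + \<beta> * (p' * d)\<bar> \<le> 2 * (L * (H * H'))" "\<bar>\<gamma> * (d * d')\<bar> \<le> 2 * (L * (H * H'))"
    using pos by (simp_all add: mult.commute[of H' H])
  then have "real_of_int \<bar>\<alpha> * (p * d') + \<beta> * (p' * d)\<bar> \<le> real_of_int (2 * (L * (H * H')))"
    "real_of_int \<bar>\<gamma> * (d * d')\<bar> \<le> real_of_int (2 * (L * (H * H')))"
    by (simp_all only: of_int_le_iff)
  moreover have "z = of_int (\<alpha> * (p * d') + \<beta> * (p' * d)) / of_int (\<gamma> * (d * d'))"
    unfolding assms(1) d(2) d'(2) using d(1) d'(1) assms(2) by (simp add: field_simps)
  moreover have "\<gamma> * (d * d') \<noteq> 0" using assms(2) d d' by simp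
  ultimately have "hQ z \<le> ln (real_of_int (2 * (L * (H * H'))))" using hQ_fraction_le by blast
  also have "\<dots> = ln 2 + (ln L + (hQ x + hQ y))"
    unfolding hx hy H_def[symmetric] H'_def[symmetric] using L1 H(1) H'(1) by (simp add: ln_mult)
  also have "ln 2 \<le> (1::real)" using ln_le_minus_one[of "2::real"] by simp
  finally show ?thesis by simp
qed

lemma card_small_height:
  fixes X :: "nat \<Rightarrow> rat"
  assumes "inj_on X T" "\<And>i. i \<in> T \<Longrightarrow> hQ (X i) \<le> ln (real n)" "n > 0"
  shows "finite T \<and> card T \<le> 3 * n ^ 2"
proof -
  let ?F = "\<lambda>(p, d). of_int p / of_int d :: rat"
  let ?S = "{- int n..int n} \<times> {1..int n}"
  have sub: "X ` T \<subseteq> ?F ` ?S"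
  proof
    fix q assume "q \<in> X ` T"
    then have q: "hQ q \<le> ln (real n)" using assms(2) by auto
    obtain p d :: int where d: "d > 0" "coprime p d" "q = of_int p / of_int d" by (rule rat_reduced)
    have "real_of_int \<bar>p\<bar> \<le> real n" "real_of_int d \<le> real n" using hQ_le_ln[OF q _ d] assms(3) by auto
    then have "\<bar>p\<bar> \<le> int n" "d \<le> int n" by linarith+
    then have "(p, d) \<in> ?S" using d(1) by auto
    then show "q \<in> ?F ` ?S" using d(3) by force
  qed
  have fin: "finite (?F ` ?S)" by simp
  have "finite (X ` T)" by (rule finite_subset[OF sub fin])
  then have finT: "finite T" using assms(1) finite_image_iff by blast
  have "card T = card (X ` T)" using assms(1) by (simp add: card_image)
  also have "\<dots> \<le> card (?F ` ?S)" by (rule card_mono[OF fin sub])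
  also have "\<dots> \<le> card ?S" by (rule card_image_le) simp
  also have "\<dots> = nat (2 * int n + 1) * n" by (simp add: card_cartesian_product)
  also have "nat (2 * int n + 1) = 2 * n + 1" by simp
  also have "(2 * n + 1) * n \<le> (3 * n) * n" using assms(3) by (intro mult_right_mono) auto
  finally show ?thesis using finT by (simp add: power2_eq_square mult.assoc)
qed

text \<open>Pigeonhole over disjoint blocks of length \<open>L\<close>.\<close>
lemma block_without_small_height:
  fixes X :: "nat \<Rightarrow> rat" and L m N :: nat
  assumes inj: "inj_on X {..<N}" and L: "L \<ge> 1" and N: "N \<ge> 4 * L ^ (2 * m + 1)"
  shows "\<exists>u. u + L \<le> N \<and> (\<forall>i. u \<le> i \<longrightarrow> i < u + L \<longrightarrow> hQ (X i) > m * ln (real L))"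
proof (rule ccontr)
  assume neg: "\<not> ?thesis"
  define n where "n = L ^ m"
  have n: "n > 0" using L unfolding n_def by simp
  have ln_n: "ln (real n) = m * ln (real L)" using L unfolding n_def by (simp add: ln_realpow)
  \<comment> \<open>One block more than \<open>card_small_height\<close> allows for terms of height
    at most \<open>ln n\<close>.\<close>
  define R where "R = 3 * n ^ 2 + 1"
  have "R * L \<le> 4 * n ^ 2 * L" using n unfolding R_def by (intro mult_right_mono) auto
  also have "\<dots> = 4 * L ^ (2 * m + 1)" unfolding n_def by (simp add: power_add power_mult[symmetric] mult.commute)
  finally have RL: "R * L \<le> N" using N by linarith
  have "\<exists>i. b * L \<le> i \<and> i < b * L + L \<and> hQ (X i) \<le> ln (real n)" if "b < R" for b
  proof -
    have "Suc b * L \<le> R * L" using that by (intro mult_right_mono) auto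
    then have "b * L + L \<le> N" using RL by simp
    then show ?thesis using neg unfolding ln_n by (meson not_less)
  qed
  then obtain i where i: "\<And>b. b < R \<Longrightarrow> b * L \<le> i b \<and> i b < b * L + L \<and> hQ (X (i b)) \<le> ln (real n)" by metis
  have div: "i b div L = b" if "b < R" for b
    using i[OF that] L by (intro div_nat_eqI) (auto simp: mult.commute)
  have "inj_on i {..<R}" by (rule inj_on_inverseI[of _ "\<lambda>j. j div L"]) (use div in auto)
  then have "card (i ` {..<R}) = R" by (simp add: card_image)
  moreover have "i ` {..<R} \<subseteq> {..<N}"
  proof
    fix j assume "j \<in> i ` {..<R}"
    then obtain b where b: "b < R" "j = i b" by auto
    have "Suc b * L \<le> R * L" using b by (intro mult_right_mono) auto
    then show "j \<in> {..<N}" using i[OF b(1)] b(2) RL by simp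
  qed
  then have "inj_on X (i ` {..<R})" using inj inj_on_subset by blast
  then have "card (i ` {..<R}) \<le> 3 * n ^ 2"
    using card_small_height[of X "i ` {..<R}" n] i n by auto
  ultimately show False unfolding R_def by simp
qed

lemma card_residue_class:
  fixes u c :: int
  shows "L div 32 \<le> card {i \<in> {u..<u + int L}. i mod 32 = c mod 32}"
proof -
  \<comment> \<open>\<open>(c - u) mod 32\<close> is the distance from \<open>u\<close> to the first
    member of the class.\<close>
  define g where "g q = u + (c - u) mod 32 + 32 * int q" for q :: nat
  have "inj_on g {..<L div 32}" unfolding g_def by (rule inj_onI) simp
  moreover have "g ` {..<L div 32} \<subseteq> {i \<in> {u..<u + int L}. i mod 32 = c mod 32}"
  proof
    fix i assume "i \<in> g ` {..<L div 32}"
    then obtain q where q: "q < L div 32" "i = g q" by auto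
    have "0 \<le> (c - u) mod 32" "(c - u) mod 32 < 32" by simp_all
    moreover have "32 * int q + 32 \<le> int L" using q(1) by linarith
    ultimately have "i \<in> {u..<u + int L}" using q(2) unfolding g_def by auto
    moreover have "i mod 32 = c mod 32" unfolding q(2) g_def by (simp add: mod_add_right_eq)
    ultimately show "i \<in> {i \<in> {u..<u + int L}. i mod 32 = c mod 32}" by simp
  qed
  moreover have "finite {i \<in> {u..<u + int L}. i mod 32 = c mod 32}"
    by (rule finite_subset[of _ "{u..<u + int L}"]) auto
  ultimately show ?thesis using card_inj_on_le[of g "{..<L div 32}"] by simp
qed

section \<open>Counting the points of a progression on a short curve\<close>

context shifted_curve
begin

definition apt :: "(int \<Rightarrow> rat) \<Rightarrow> int \<Rightarrow> point" where
  "apt y i = Aff (s + t * of_int i) (y i)"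

lemma apt_neq: "i \<noteq> j \<Longrightarrow> apt y i \<noteq> apt y j"
  using t unfolding apt_def by simp

lemma pdiff_apt:
  assumes on: "on_curve E (apt y i)" "on_curve E (apt y j)" and ij: "i \<noteq> j"
  obtains x' y' where "pdiff (apt y j) (apt y i) = Aff x' y'" "on_curve E (Aff x' y')"
    "padd E (apt y i) (Aff x' y') = apt y j" "hQ x' \<le> qh (pdiff (apt y i) (apt y j)) + 700 * cst"
proof -
  let ?R = "pdiff (apt y j) (apt y i)"
  have c: "apt y i \<in> carrier G" "apt y j \<in> carrier G" using on by simp_all
  have R: "on_curve E ?R" by (rule on_curve_pdiff[OF on(2,1)])
  have add: "padd E (apt y i) ?R = apt y j"
  proof -
    have "apt y i \<otimes>\<^bsub>G\<^esub> (apt y j \<otimes>\<^bsub>G\<^esub> inv\<^bsub>G\<^esub> apt y i) = apt y j \<otimes>\<^bsub>G\<^esub> (apt y i \<otimes>\<^bsub>G\<^esub> inv\<^bsub>G\<^esub> apt y i)"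
      using c by (intro m_lcomm) (auto simp del: carrier_G)
    also have "\<dots> = apt y j" using c by (simp del: carrier_G)
    finally show ?thesis by (simp add: pdiff_G[OF on(1)] mult_G)
  qed
  have "?R \<noteq> Inf"
  proof
    assume "?R = Inf"
    then have "apt y i = apt y j" using add by simp
    then show False using apt_neq[OF ij] by blast
  qed
  then obtain x' y' where A: "?R = Aff x' y'" by (cases ?R) auto
  have neg: "pneg E ?R = pdiff (apt y i) (apt y j)"
  proof -
    have "inv\<^bsub>G\<^esub> (apt y j \<otimes>\<^bsub>G\<^esub> inv\<^bsub>G\<^esub> apt y i) = apt y i \<otimes>\<^bsub>G\<^esub> inv\<^bsub>G\<^esub> apt y j"
      using c by (simp add: inv_mult m_comm del: carrier_G)
    then show ?thesis using on pdiff_G[OF on(1)] pdiff_G[OF on(2)] inv_G[OF R] by simp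
  qed
  have "hQ x' = hpt ?R" using A by simp
  also have "\<dots> \<le> qh ?R + 700 * cst" using canon_height_limit(2)[OF R] by linarith
  also have "qh ?R = qh (pdiff (apt y i) (apt y j))" using canon_height_pneg[OF R] neg by simp
  finally show thesis using that[OF A] R add A by metis
qed

text \<open>The coefficients \<open>k - j\<close>, \<open>i - k\<close>, \<open>j - i\<close> have
  sum 0 and are orthogonal to the indices, which eliminates \<open>s\<close> and \<open>t\<close>.
  Each translate contributes at most \<open>4 * (\<delta> + 700 * cst)\<close>, and
  \<open>7168 + 5600\<close> is rounded up to 13000.\<close>

lemma close_triple_height:
  fixes L i j k :: int
  assumes on: "on_curve E (apt y i)" "on_curve E (apt y j)" "on_curve E (apt y k)"
    and dist: "i \<noteq> j" "i \<noteq> k" "j \<noteq> k" and L: "\<bar>i - j\<bar> \<le> L" "\<bar>i - k\<bar> \<le> L" "\<bar>j - k\<bar> \<le> L"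
    and D: "qh (pdiff (apt y i) (apt y j)) \<le> \<delta>" "qh (pdiff (apt y i) (apt y k)) \<le> \<delta>"
  shows "hQ (s + t * of_int i) \<le> 2 * ln L + 8 * \<delta> + 13000 * cst"
proof -
  obtain x2 y2 where 2: "on_curve E (Aff x2 y2)" "padd E (apt y i) (Aff x2 y2) = apt y j"
    "hQ x2 \<le> qh (pdiff (apt y i) (apt y j)) + 700 * cst" using pdiff_apt[OF on(1,2) dist(1)] by metis
  obtain x3 y3 where 3: "on_curve E (Aff x3 y3)" "padd E (apt y i) (Aff x3 y3) = apt y k"
    "hQ x3 \<le> qh (pdiff (apt y i) (apt y k)) + 700 * cst" using pdiff_apt[OF on(1,3) dist(2)] by metis
  have "hQ (s + t * of_int i) \<le> 2 * ln L + 4 * hQ x2 + 4 * hQ x3 + 7168 * cst"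
  proof (rule three_translates_height[OF on(1)[unfolded apt_def] 2(1) 3(1) 2(2)[unfolded apt_def] 3(2)[unfolded apt_def]])
    show "of_int (k - j) * (s + t * of_int i) + of_int (i - k) * (s + t * of_int j)
        + of_int (j - i) * (s + t * of_int k) = 0" by (simp add: algebra_simps)
  qed (use dist L in \<open>auto simp: abs_minus_commute\<close>)
  then show ?thesis using 2(3) 3(3) D cst_ge_1 by linarith
qed

text \<open>Two terms determine the progression: each term is a combination of the terms
  \<open>i\<close> and \<open>j\<close> with integer coefficients of size at most \<open>L\<close>,
  divided by \<open>j - i\<close>. Hence one close triple makes all heights of the interval
  small.\<close>

lemma close_triple_height_all:
  fixes L i j k l u :: int
  assumes on: "on_curve E (apt y i)" "on_curve E (apt y j)" "on_curve E (apt y k)"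
    and dist: "i \<noteq> j" "i \<noteq> k" "j \<noteq> k" and S: "i \<in> {u..<u + L}" "j \<in> {u..<u + L}" "k \<in> {u..<u + L}" "l \<in> {u..<u + L}"
    and D: "qh (pdiff (apt y i) (apt y j)) \<le> \<delta>" "qh (pdiff (apt y i) (apt y k)) \<le> \<delta>"
      "qh (pdiff (apt y j) (apt y k)) \<le> \<delta>"
  shows "hQ (s + t * of_int l) \<le> 5 * ln L + 16 * \<delta> + 26001 * cst"
proof -
  have sym: "qh (pdiff (apt y j) (apt y i)) = qh (pdiff (apt y i) (apt y j))"
  proof -
    have c: "apt y i \<in> carrier G" "apt y j \<in> carrier G" using on by simp_all
    have "inv\<^bsub>G\<^esub> (apt y i \<otimes>\<^bsub>G\<^esub> inv\<^bsub>G\<^esub> apt y j) = apt y j \<otimes>\<^bsub>G\<^esub> inv\<^bsub>G\<^esub> apt y i"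
      using c by (simp add: inv_mult m_comm del: carrier_G)
    then show ?thesis using on inv_eq[OF m_closed[OF c(1) inv_closed[OF c(2)]]] by (simp add: pdiff_G)
  qed
  have Dji: "qh (pdiff (apt y j) (apt y i)) \<le> \<delta>" using D(1) sym by simp
  have i: "hQ (s + t * of_int i) \<le> 2 * ln L + 8 * \<delta> + 13000 * cst"
    by (rule close_triple_height[OF on dist]) (use S D in auto)
  have j: "hQ (s + t * of_int j) \<le> 2 * ln L + 8 * \<delta> + 13000 * cst"
    by (rule close_triple_height[OF on(2,1,3) dist(1)[symmetric] dist(3,2)]) (use S D Dji in auto)
  have "hQ (s + t * of_int l) \<le> 1 + ln L + hQ (s + t * of_int i) + hQ (s + t * of_int j)"
  proof (rule hQ_linear_combination_le)
    show "s + t * of_int l = (of_int (j - l) * (s + t * of_int i) + of_int (l - i) * (s + t * of_int j)) / of_int (j - i)"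
      using dist(1) by (simp add: field_simps)
  qed (use dist S in auto)
  then show ?thesis using i j cst_ge_1 by linarith
qed

lemma card_separated_pdiff:
  assumes "rank_le r" "\<rho> \<ge> 0" "16 * (B + \<rho>) \<le> \<rho> * 4 ^ k" "finite J"
    and "\<And>i. i \<in> J \<Longrightarrow> on_curve E (P i)" "\<And>i. i \<in> J \<Longrightarrow> qh (P i) \<le> B"
    and "\<And>i j l. i \<in> J \<Longrightarrow> j \<in> J \<Longrightarrow> l \<in> J \<Longrightarrow> i \<noteq> j \<Longrightarrow> i \<noteq> l \<Longrightarrow> j \<noteq> l \<Longrightarrow>
      4 * \<rho> < qh (pdiff (P i) (P j)) \<or> 4 * \<rho> < qh (pdiff (P i) (P l)) \<or> 4 * \<rho> < qh (pdiff (P j) (P l))"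
  shows "card J \<le> 2 * 2 ^ (r * k)"
proof (rule card_separated_le[OF assms(1-4), of P])
  fix i j l assume h: "i \<in> J" "j \<in> J" "l \<in> J" "i \<noteq> j" "i \<noteq> l" "j \<noteq> l"
  show "4 * \<rho> < qh (P i \<otimes>\<^bsub>G\<^esub> inv\<^bsub>G\<^esub> P j) \<or> 4 * \<rho> < qh (P i \<otimes>\<^bsub>G\<^esub> inv\<^bsub>G\<^esub> P l) \<or>
      4 * \<rho> < qh (P j \<otimes>\<^bsub>G\<^esub> inv\<^bsub>G\<^esub> P l)"
    using assms(7)[OF h] assms(5) h(1-3) by (simp add: pdiff_G)
qed (use assms(5,6) in simp_all)

lemma card_good_class_le:
  assumes rk: "rank_le r" and c: "c > 0" and c2: "c2 \<ge> 1"
    and lang: "\<And>P. on_curve E P \<Longrightarrow> \<not> torsion E P \<Longrightarrow> qh P \<ge> c * h" and hE: "cst \<le> h + c2"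
    and k: "4 ^ k \<ge> (8208::real)" "4 ^ k \<ge> 26804224 / c + 16"
    and m: "m \<ge> (11::nat)" "m * ln 2 \<ge> 208008 * c2" and L: "L \<ge> (2::int)"
    and S: "S \<subseteq> {u..<u + L}" and on: "\<And>i. i \<in> S \<Longrightarrow> on_curve E (apt y i)"
    and mods: "\<And>i j. i \<in> S \<Longrightarrow> j \<in> S \<Longrightarrow> i mod 32 = j mod 32"
    and good: "\<And>i. i \<in> S \<Longrightarrow> M \<le> 2 * norm2 (f (of_int i))"
    and large: "\<And>i. i \<in> S \<Longrightarrow> hQ (s + t * of_int i) > m * ln L"
  shows "card S \<le> 2 * 2 ^ (r * k)"
proof (cases "S = {}")
  case False
  have finS: "finite S" using S finite_subset by blast
  define H where "H = Max ((\<lambda>i. hQ (s + t * of_int i)) ` S)"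
  have Hge: "hQ (s + t * of_int i) \<le> H" if "i \<in> S" for i
    using that finS unfolding H_def by (intro Max_ge) auto
  have "H \<in> (\<lambda>i. hQ (s + t * of_int i)) ` S" unfolding H_def using finS False by (intro Max_in) auto
  then obtain i0 where i0: "i0 \<in> S" "H = hQ (s + t * of_int i0)" by auto
  have lnL: "ln 2 \<le> ln (real_of_int L)" "0 < ln (real_of_int L)" using L by simp_all
  have HL: "H > m * ln L" using large[OF i0(1)] i0(2) by simp
  have "11 * ln (real_of_int L) \<le> m * ln L" using m(1) lnL by (intro mult_right_mono) auto
  then have H11: "H > 11 * ln L" using HL by linarith
  have Hpos: "H > 0" using H11 lnL by linarith
  have qP: "qh (apt y i) \<le> H + 700 * cst" if "i \<in> S" for i
    using canon_height_limit(2)[OF on[OF that]] Hge[OF that] unfolding apt_def by simp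
  show ?thesis
  proof (cases "104004 * cst \<le> H")
    case True
    show ?thesis
    proof (rule card_separated_pdiff[OF rk, of "H / 256" "2 * H" k S "apt y"])
      show "16 * (2 * H + H / 256) \<le> H / 256 * 4 ^ k"
      proof -
        \<comment> \<open>\<open>8208 = 16 * 512 + 16\<close> is what the packing requires for the
          radii \<open>2 * H\<close> and \<open>H / 256\<close>.\<close>
        have "H / 256 * 8208 \<le> H / 256 * 4 ^ k" using k(1) Hpos by (intro mult_left_mono) auto
        then show ?thesis by simp
      qed
      show "qh (apt y i) \<le> 2 * H" if "i \<in> S" for i using qP[OF that] True cst_ge_1 by linarith
      show "4 * (H / 256) < qh (pdiff (apt y i) (apt y j)) \<or> 4 * (H / 256) < qh (pdiff (apt y i) (apt y l))
          \<or> 4 * (H / 256) < qh (pdiff (apt y j) (apt y l))"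
        if h: "i \<in> S" "j \<in> S" "l \<in> S" "i \<noteq> j" "i \<noteq> l" "j \<noteq> l" for i j l
      proof (rule ccontr)
        assume "\<not> ?thesis"
        then have D: "qh (pdiff (apt y i) (apt y j)) \<le> H / 64" "qh (pdiff (apt y i) (apt y l)) \<le> H / 64"
          "qh (pdiff (apt y j) (apt y l)) \<le> H / 64"
          by simp_all
        \<comment> \<open>By \<open>H11\<close> and the case assumption, where
          \<open>104004 = 4 * 26001\<close>, the three terms are at most \<open>5 / 11\<close>,
          \<open>1 / 4\<close> and \<open>1 / 4\<close> of \<open>H\<close>. The largest height
          would be smaller than itself.\<close>
        have "hQ (s + t * of_int i0) \<le> 5 * ln L + 16 * (H / 64) + 26001 * cst"
          by (rule close_triple_height_all[OF on[OF h(1)] on[OF h(2)] on[OF h(3)] h(4,5,6)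
                subsetD[OF S h(1)] subsetD[OF S h(2)] subsetD[OF S h(3)] subsetD[OF S i0(1)] D])
        then show False using i0(2) True H11 lnL by linarith
      qed
    qed (use finS on Hpos in auto)
  next
    case False
    have "m * ln 2 \<le> m * ln L" using lnL by (intro mult_left_mono) auto
    \<comment> \<open>\<open>m * ln 2 \<le> m * ln L < H < 104004 * (h + c2)\<close>, while
      \<open>m * ln 2\<close> is at least twice \<open>104004 * c2\<close>.\<close>
    then have h2: "h \<ge> c2" using HL m(2) False hE by linarith
    then have hpos: "h > 0" using c2 by linarith
    show ?thesis
    proof (rule card_separated_pdiff[OF rk, of "c * h / 8" "209408 * h" k S "apt y"])
      show "16 * (209408 * h + c * h / 8) \<le> c * h / 8 * 4 ^ k"
      proof -
        \<comment> \<open>\<open>26804224 = 8 * 16 * 209408\<close>, where the 8 comes from the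
          radius \<open>c * h / 8\<close>.\<close>
        have "c * h / 8 * (26804224 / c + 16) \<le> c * h / 8 * 4 ^ k"
          using k(2) c hpos by (intro mult_left_mono) auto
        moreover have "c * h / 8 * (26804224 / c + 16) = 16 * (209408 * h + c * h / 8)"
          using c by (simp add: field_simps)
        ultimately show ?thesis by linarith
      qed
      \<comment> \<open>\<open>H + 700 * cst < 104704 * cst\<close>, and
        \<open>cst \<le> 2 * h\<close> by \<open>hE\<close> and \<open>h2\<close>.\<close>
      show "qh (apt y i) \<le> 209408 * h" if "i \<in> S" for i using qP[OF that] False hE h2 by linarith
      show "4 * (c * h / 8) < qh (pdiff (apt y i) (apt y j)) \<or> 4 * (c * h / 8) < qh (pdiff (apt y i) (apt y l))
          \<or> 4 * (c * h / 8) < qh (pdiff (apt y j) (apt y l))"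
        if h: "i \<in> S" "j \<in> S" "l \<in> S" "i \<noteq> j" "i \<noteq> l" "j \<noteq> l" for i j l
      proof -
        have "\<not> torsion E (pdiff (apt y i) (apt y j)) \<or> \<not> torsion E (pdiff (apt y i) (apt y l))
            \<or> \<not> torsion E (pdiff (apt y j) (apt y l))"
          using three_points_torsion[of i "y i" j "y j" l "y l"] on[OF h(1)] on[OF h(2)] on[OF h(3)]
            good[OF h(1)] good[OF h(2)] mods[OF h(1,2)] mods[OF h(1,3)] h(4-6) unfolding apt_def by blast
        then have "c * h \<le> qh (pdiff (apt y i) (apt y j)) \<or> c * h \<le> qh (pdiff (apt y i) (apt y l))
            \<or> c * h \<le> qh (pdiff (apt y j) (apt y l))"
          using lang on_curve_pdiff on h(1-3) by metis
        moreover have "4 * (c * h / 8) < c * h" using c hpos by simp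
        ultimately show ?thesis by linarith
      qed
      show "0 \<le> c * h / 8" using c hpos by simp
    qed (use finS on in auto)
  qed
qed simp

lemma progression_length_less:
  assumes rk: "rank_le r" and c: "c > 0" and c2: "c2 \<ge> 1"
    and lang: "\<And>P. on_curve E P \<Longrightarrow> \<not> torsion E P \<Longrightarrow> qh P \<ge> c * h" and hE: "cst \<le> h + c2"
    and k: "4 ^ k \<ge> (8208::real)" "4 ^ k \<ge> 26804224 / c + 16"
    and m: "m \<ge> (11::nat)" "m * ln 2 \<ge> 208008 * c2"
    and on: "\<And>i. i < N \<Longrightarrow> on_curve E (Aff (s + t * of_nat i) (y i))"
  shows "N < 4 * (96 * 2 ^ (r * k) + 1) ^ (2 * m + 1)"
proof (rule ccontr)
  assume N: "\<not> ?thesis"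
  \<comment> \<open>This choice makes \<open>L div 32\<close> equal to
    \<open>3 * 2 ^ (r * k)\<close>, more than the \<open>2 * 2 ^ (r * k)\<close> indices allowed in
    a good class.\<close>
  define L where "L = (96 * 2 ^ (r * k) + 1 :: nat)"
  have L: "L \<ge> 2" unfolding L_def using one_le_power[of "2::nat" "r * k"] by linarith
  have inj: "inj_on (\<lambda>i. s + t * of_nat i) {..<N}" using t by (auto intro: inj_onI)
  obtain u where u: "u + L \<le> N" "\<And>i. u \<le> i \<Longrightarrow> i < u + L \<Longrightarrow> hQ (s + t * of_nat i) > m * ln L"
    using block_without_small_height[OF inj, of L m] L N unfolding L_def by auto
  define I where "I = {int u..<int u + int L}"
  have I: "on_curve E (apt (\<lambda>i. y (nat i)) i)" "hQ (s + t * of_int i) > m * ln (real_of_int (int L))"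
    if "i \<in> I" for i
  proof -
    define j where "j = nat i"
    have j: "i = int j" "u \<le> j" "j < u + L" using that unfolding I_def j_def by auto
    show "on_curve E (apt (\<lambda>i. y (nat i)) i)" using on[of j] j u(1) unfolding apt_def by simp
    show "hQ (s + t * of_int i) > m * ln (real_of_int (int L))" using u(2)[OF j(2,3)] j(1) by simp
  qed
  from exists_good_residue[of I] obtain e where e4: "e \<in> {0..<4}"
    and e_all: "\<forall>i::int. i mod 4 = e \<longrightarrow> i \<in> I \<longrightarrow> M \<le> 2 * norm2 (f (of_int i))" ..
  have e: "M \<le> 2 * norm2 (f (of_int i))" if "i mod 4 = e" "i \<in> I" for i
    using e_all that by blast
  \<comment> \<open>The class of \<open>e\<close> modulo 32 is contained in the good class of
    \<open>e\<close> modulo 4.\<close>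
  define S where "S = {i \<in> I. i mod 32 = e mod 32}"
  have "card S \<le> 2 * 2 ^ (r * k)"
  proof (rule card_good_class_le[OF rk c c2 lang hE k m, of "int L" S "int u" "\<lambda>i. y (nat i)"])
    show "M \<le> 2 * norm2 (f (of_int i))" if "i \<in> S" for i
    proof (rule e)
      have "i mod 32 = e mod 32" using that unfolding S_def by simp
      then have "(i mod 32) mod 4 = (e mod 32) mod 4" by simp
      then show "i mod 4 = e" using e4 by (simp add: mod_mod_cancel)
    qed (use that S_def in simp)
  qed (use L I S_def I_def in auto)
  moreover have "L div 32 \<le> card S"
    unfolding S_def I_def by (rule card_residue_class)
  moreover have "L div 32 = 3 * 2 ^ (r * k)" unfolding L_def by simp
  moreover have "(0::nat) < 2 ^ (r * k)" by simp
  ultimately show False by linarith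
qed

end

section \<open>Changes of Weierstrass equations\<close>

text \<open>\<open>wiso\<close> with its parameters exposed, since the map on points and the
  composition law depend on them.\<close>

definition wiso_by :: "wcurve \<Rightarrow> wcurve \<Rightarrow> rat \<Rightarrow> rat \<Rightarrow> rat \<Rightarrow> rat \<Rightarrow> bool" where
  "wiso_by E E' u r s t \<longleftrightarrow> u \<noteq> 0 \<and>
     u * a1 E' = a1 E + 2 * s \<and>
     u ^ 2 * a2 E' = a2 E - s * a1 E + 3 * r - s ^ 2 \<and>
     u ^ 3 * a3 E' = a3 E + r * a1 E + 2 * t \<and>
     u ^ 4 * a4 E' = a4 E - s * a3 E + 2 * r * a2 E - (t + r * s) * a1 E + 3 * r ^ 2 - 2 * s * t \<and>
     u ^ 6 * a6 E' = a6 E + r * a4 E + r ^ 2 * a2 E + r ^ 3 - t * a3 E - t ^ 2 - r * t * a1 E"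

lemma wiso_iff: "wiso E E' \<longleftrightarrow> (\<exists>u r s t. wiso_by E E' u r s t)"
  unfolding wiso_def wiso_by_def by simp

lemma wiso_byD:
  assumes "wiso_by E E' u r s t"
  shows "u \<noteq> 0" "u * a1 E' = a1 E + 2 * s"
    "u ^ 2 * a2 E' = a2 E - s * a1 E + 3 * r - s ^ 2"
    "u ^ 3 * a3 E' = a3 E + r * a1 E + 2 * t"
    "u ^ 4 * a4 E' = a4 E - s * a3 E + 2 * r * a2 E - (t + r * s) * a1 E + 3 * r ^ 2 - 2 * s * t"
    "u ^ 6 * a6 E' = a6 E + r * a4 E + r ^ 2 * a2 E + r ^ 3 - t * a3 E - t ^ 2 - r * t * a1 E"
  using assms unfolding wiso_by_def by auto

text \<open>Composition of the two substitutions. Each equation for \<open>E''\<close> is first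
  multiplied by a power of \<open>u\<close>, so that the coefficients of \<open>E'\<close> occur
  only in the scaled form in which the first substitution gives them.\<close>

lemma wiso_by_trans:
  assumes "wiso_by E E' u r s t" "wiso_by E' E'' u' r' s' t'"
  shows "wiso_by E E'' (u * u') (u ^ 2 * r' + r) (u * s' + s) (u ^ 3 * t' + u ^ 2 * s * r' + t)"
proof -
  note e = wiso_byD[OF assms(1)] and e' = wiso_byD[OF assms(2)]
  have "(u * u') * a1 E'' = u * (a1 E' + 2 * s')" using e'(2) by algebra
  then have f1: "(u * u') * a1 E'' = a1 E + 2 * (u * s' + s)" using e(2) by algebra
  have "(u * u') ^ 2 * a2 E'' = u ^ 2 * a2 E' - (u * s') * (u * a1 E') + 3 * u ^ 2 * r' - (u * s') ^ 2"
    using e'(3) by algebra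
  then have f2: "(u * u') ^ 2 * a2 E'' = a2 E - (u * s' + s) * a1 E + 3 * (u ^ 2 * r' + r) - (u * s' + s) ^ 2"
    unfolding e(2,3) by algebra
  have "(u * u') ^ 3 * a3 E'' = u ^ 3 * a3 E' + (u ^ 2 * r') * (u * a1 E') + 2 * (u ^ 3 * t')"
    using e'(4) by algebra
  then have f3: "(u * u') ^ 3 * a3 E'' = a3 E + (u ^ 2 * r' + r) * a1 E + 2 * (u ^ 3 * t' + u ^ 2 * s * r' + t)"
    unfolding e(2,4) by algebra
  have "(u * u') ^ 4 * a4 E'' = u ^ 4 * a4 E' - (u * s') * (u ^ 3 * a3 E') + 2 * (u ^ 2 * r') * (u ^ 2 * a2 E')
      - (u ^ 3 * t' + (u ^ 2 * r') * (u * s')) * (u * a1 E') + 3 * (u ^ 2 * r') ^ 2 - 2 * (u * s') * (u ^ 3 * t')"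
    using e'(5) by algebra
  then have f4: "(u * u') ^ 4 * a4 E'' = a4 E - (u * s' + s) * a3 E + 2 * (u ^ 2 * r' + r) * a2 E
      - ((u ^ 3 * t' + u ^ 2 * s * r' + t) + (u ^ 2 * r' + r) * (u * s' + s)) * a1 E
      + 3 * (u ^ 2 * r' + r) ^ 2 - 2 * (u * s' + s) * (u ^ 3 * t' + u ^ 2 * s * r' + t)"
    unfolding e(2-5) by algebra
  have "(u * u') ^ 6 * a6 E'' = u ^ 6 * a6 E' + (u ^ 2 * r') * (u ^ 4 * a4 E') + (u ^ 2 * r') ^ 2 * (u ^ 2 * a2 E')
      + (u ^ 2 * r') ^ 3 - (u ^ 3 * t') * (u ^ 3 * a3 E') - (u ^ 3 * t') ^ 2 - (u ^ 2 * r') * (u ^ 3 * t') * (u * a1 E')"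
    using e'(6) by algebra
  then have f6: "(u * u') ^ 6 * a6 E'' = a6 E + (u ^ 2 * r' + r) * a4 E + (u ^ 2 * r' + r) ^ 2 * a2 E
      + (u ^ 2 * r' + r) ^ 3 - (u ^ 3 * t' + u ^ 2 * s * r' + t) * a3 E - (u ^ 3 * t' + u ^ 2 * s * r' + t) ^ 2
      - (u ^ 2 * r' + r) * (u ^ 3 * t' + u ^ 2 * s * r' + t) * a1 E"
    unfolding e(2-6) by algebra
  show ?thesis unfolding wiso_by_def using e(1) e'(1) f1 f2 f3 f4 f6 by simp
qed

lemma wiso_trans: "wiso E E' \<Longrightarrow> wiso E' E'' \<Longrightarrow> wiso E E''"
  using wiso_by_trans unfolding wiso_iff by blast

text \<open>The quantities \<open>b2\<close>, \<open>b4\<close>, \<open>b6\<close>,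
  \<open>b8\<close> have weights 2, 4, 6, 8 and transform by polynomials in \<open>r\<close> that do
  not involve \<open>s\<close> and \<open>t\<close>; for \<open>b8\<close> this is deduced from
  \<open>4 * b8 = b2 * b6 - b4 ^ 2\<close>.\<close>

lemma wiso_disc:
  assumes "wiso_by E E' u r s t" shows "u ^ 12 * disc E' = disc E"
proof -
  note e = wiso_byD(2-)[OF assms]
  have "u ^ 2 * b2 E' = (u * a1 E') ^ 2 + 4 * (u ^ 2 * a2 E')" unfolding b2_def by algebra
  then have b2: "u ^ 2 * b2 E' = b2 E + 12 * r" unfolding e b2_def by algebra
  have "u ^ 4 * b4 E' = 2 * (u ^ 4 * a4 E') + (u * a1 E') * (u ^ 3 * a3 E')" unfolding b4_def by algebra
  then have b4: "u ^ 4 * b4 E' = b4 E + r * b2 E + 6 * r ^ 2" unfolding e b2_def b4_def by algebra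
  have "u ^ 6 * b6 E' = (u ^ 3 * a3 E') ^ 2 + 4 * (u ^ 6 * a6 E')" unfolding b6_def by algebra
  then have b6: "u ^ 6 * b6 E' = b6 E + 2 * r * b4 E + r ^ 2 * b2 E + 4 * r ^ 3"
    unfolding e b2_def b4_def b6_def by algebra
  have 8: "4 * b8 F = b2 F * b6 F - b4 F ^ 2" for F unfolding b2_def b4_def b6_def b8_def by algebra
  have "u ^ 8 * (4 * b8 E') = (u ^ 2 * b2 E') * (u ^ 6 * b6 E') - (u ^ 4 * b4 E') ^ 2"
    unfolding 8 by algebra
  then have "u ^ 8 * (4 * b8 E') = 4 * (b8 E + 3 * r * b6 E + 3 * r ^ 2 * b4 E + r ^ 3 * b2 E + 3 * r ^ 4)"
    unfolding b2 b4 b6 using 8[of E] by algebra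
  then have b8: "u ^ 8 * b8 E' = b8 E + 3 * r * b6 E + 3 * r ^ 2 * b4 E + r ^ 3 * b2 E + 3 * r ^ 4" by simp
  have "u ^ 12 * disc E' = - ((u ^ 2 * b2 E') ^ 2 * (u ^ 8 * b8 E')) - 8 * (u ^ 4 * b4 E') ^ 3
      - 27 * (u ^ 6 * b6 E') ^ 2 + 9 * (u ^ 2 * b2 E') * (u ^ 4 * b4 E') * (u ^ 6 * b6 E')"
    unfolding disc_def by algebra
  then show ?thesis unfolding b2 b4 b6 b8 disc_def using 8[of E] by algebra
qed

text \<open>For \<open>u = 1 / d\<close> the coefficient \<open>a_i\<close> is multiplied by
  \<open>d ^ i\<close>, and \<open>d\<close> is a common denominator.\<close>

lemma exists_integral_model: "\<exists>E'. wiso E E' \<and> integral E'"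
proof -
  define f where "f x = snd (quotient_of x)" for x
  have f: "f x > 0 \<and> of_int (f x) * x \<in> \<int>" for x
  proof -
    obtain p q where pq: "quotient_of x = (p, q)" by (cases "quotient_of x")
    then have "q > 0" "x = of_int p / of_int q"
      using quotient_of_denom_pos[OF pq] quotient_of_div[OF pq] by auto
    then show ?thesis using pq unfolding f_def by simp
  qed
  define d :: rat where "d = of_int (f (a1 E) * f (a2 E) * f (a3 E) * f (a4 E) * f (a6 E))"
  have d0: "d \<noteq> 0" using f[of "a1 E"] f[of "a2 E"] f[of "a3 E"] f[of "a4 E"] f[of "a6 E"] unfolding d_def by auto
  have dZ: "d \<in> \<int>" unfolding d_def by simp
  have dx: "d * x \<in> \<int>" if "x \<in> {a1 E, a2 E, a3 E, a4 E, a6 E}" for x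
  proof -
    have "\<exists>k :: int. d = of_int k * of_int (f x)"
      using that unfolding d_def
      by (auto intro: exI[of _ "f (a2 E) * f (a3 E) * f (a4 E) * f (a6 E)"]
          exI[of _ "f (a1 E) * f (a3 E) * f (a4 E) * f (a6 E)"]
          exI[of _ "f (a1 E) * f (a2 E) * f (a4 E) * f (a6 E)"]
          exI[of _ "f (a1 E) * f (a2 E) * f (a3 E) * f (a6 E)"]
          exI[of _ "f (a1 E) * f (a2 E) * f (a3 E) * f (a4 E)"])
    then obtain k :: int where "d = of_int k * of_int (f x)" by blast
    then have e: "d * x = of_int k * (of_int (f x) * x)" by (simp only: mult.assoc)
    show ?thesis unfolding e by (rule Ints_mult) (use f[of x] in auto)
  qed
  have dn: "d ^ Suc n * x \<in> \<int>" if "x \<in> {a1 E, a2 E, a3 E, a4 E, a6 E}" for x n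
  proof -
    have e: "d ^ Suc n * x = d ^ n * (d * x)" by simp
    show ?thesis unfolding e by (rule Ints_mult[OF Ints_power[OF dZ] dx[OF that]])
  qed
  define E' where "E' = \<lparr>a1 = d ^ Suc 0 * a1 E, a2 = d ^ Suc 1 * a2 E, a3 = d ^ Suc 2 * a3 E,
     a4 = d ^ Suc 3 * a4 E, a6 = d ^ Suc 5 * a6 E\<rparr>"
  have "integral E'" unfolding integral_def E'_def wcurve.simps by (intro conjI dn) auto
  moreover have "wiso_by E E' (inverse d) 0 0 0"
    unfolding wiso_by_def E'_def using d0 by (simp add: field_simps power_numeral_reduce)
  ultimately show ?thesis unfolding wiso_iff by blast
qed

lemma min_disc_abs_witness:
  "\<exists>E'. wiso E E' \<and> integral E' \<and> of_nat (min_disc_abs E) = \<bar>disc E'\<bar>"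
proof -
  obtain E' where E': "wiso E E'" "integral E'" using exists_integral_model by blast
  have "disc E' \<in> \<int>"
    using E'(2) unfolding integral_def disc_def b2_def b4_def b6_def b8_def by simp
  then obtain z where "disc E' = of_int z" by (auto elim: Ints_cases)
  then have "of_nat (nat \<bar>z\<bar>) = \<bar>disc E'\<bar>" by simp
  then have "\<exists>E'. wiso E E' \<and> integral E' \<and> of_nat (nat \<bar>z\<bar>) = \<bar>disc E'\<bar>" using E' by blast
  then show ?thesis unfolding min_disc_abs_def by (rule LeastI)
qed

lemma min_disc_abs_le:
  assumes "wiso E E'" "integral E'" "of_nat n = \<bar>disc E'\<bar>" shows "min_disc_abs E \<le> n"
  unfolding min_disc_abs_def using assms by (intro Least_le) blast

definition c6 :: "wcurve \<Rightarrow> rat" where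
  "c6 E = - (b2 E ^ 3) + 36 * b2 E * b4 E - 216 * b6 E"

lemma c4_c6_disc: "c6 E ^ 2 = c4 E ^ 3 - 1728 * disc E"
proof -
  have "4 * b8 E = b2 E * b6 E - b4 E ^ 2" unfolding b2_def b4_def b6_def b8_def by algebra
  then show ?thesis unfolding c4_def c6_def disc_def by algebra
qed

text \<open>The substitution \<open>x = x'/36 - b\<^sub>2/12\<close>, \<open>y = y'/216 - (a\<^sub>1 x + a\<^sub>3)/2\<close>.\<close>
lemma wiso_short:
  "wiso_by E (short (- 27 * c4 E) (- 54 * c6 E)) (1 / 6) (- b2 E / 12) (- a1 E / 2)
     (- (a3 E - b2 E / 12 * a1 E) / 2)"
  unfolding wiso_by_def c4_def c6_def b2_def b4_def b6_def
  by (simp add: power_numeral_reduce) (simp add: field_simps)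

text \<open>The map leads from the transformed equation back to the original one, the direction that
  has no denominators.\<close>

fun wmap :: "rat \<Rightarrow> rat \<Rightarrow> rat \<Rightarrow> rat \<Rightarrow> point \<Rightarrow> point" where
  "wmap u r s t Inf = Inf"
| "wmap u r s t (Aff x y) = Aff (u ^ 2 * x + r) (u ^ 3 * y + u ^ 2 * s * x + t)"

lemma wiso_short_coeffs:
  assumes "wiso_by E (short a b) u r s t"
  shows "u \<noteq> 0" "a1 E = - 2 * s" "a2 E = - (s ^ 2) - 3 * r" "a3 E = 2 * r * s - 2 * t"
    "a4 E = u ^ 4 * a + 2 * r * s ^ 2 - 2 * s * t + 3 * r ^ 2"
    "a6 E = u ^ 6 * b - r * (u ^ 4 * a) - r ^ 3 - (r * s - t) ^ 2"
proof -
  note e = wiso_byD[OF assms, simplified]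
  show "u \<noteq> 0" by (rule e(1))
  show "a1 E = - 2 * s" using e(2) by algebra
  show "a2 E = - (s ^ 2) - 3 * r" using e(2,3) by algebra
  show "a3 E = 2 * r * s - 2 * t" using e(2,4) by algebra
  show "a4 E = u ^ 4 * a + 2 * r * s ^ 2 - 2 * s * t + 3 * r ^ 2" using e(2-5) by algebra
  show "a6 E = u ^ 6 * b - r * (u ^ 4 * a) - r ^ 3 - (r * s - t) ^ 2" using e(2-6) by algebra
qed

lemma wmap_eq_Inf_iff [simp]: "wmap u r s t P = Inf \<longleftrightarrow> P = Inf"
  by (cases P) auto

lemma on_curve_wmap:
  assumes w: "wiso_by E (short a b) u r s t" and on: "on_curve (short a b) P"
  shows "on_curve E (wmap u r s t P)"
proof (cases P)
  case (Aff x y)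
  then have "y ^ 2 = x ^ 3 + a * x + b" using on by simp
  then show ?thesis
    unfolding Aff wmap.simps on_curve.simps wiso_short_coeffs(2-6)[OF w] by algebra
qed simp

lemma on_curve_short_of_wiso:
  assumes w: "wiso_by E (short a b) u r s t" and on: "on_curve E (Aff x y)"
  shows "on_curve (short a b) (Aff ((x - r) / u ^ 2) ((y - s * (x - r) - t) / u ^ 3))"
proof -
  let ?x = "(x - r) / u ^ 2" and ?y = "(y - s * (x - r) - t) / u ^ 3"
  have u: "u \<noteq> 0" by (rule wiso_short_coeffs(1)[OF w])
  have x: "x = u ^ 2 * ?x + r" and y: "y = u ^ 3 * ?y + s * (x - r) + t" using u by simp_all
  have "u ^ 6 * (?y ^ 2 - (?x ^ 3 + a * ?x + b)) = 0"
    using on x y unfolding on_curve.simps wiso_short_coeffs(2-6)[OF w] by algebra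
  then show ?thesis using u by simp
qed

lemma wmap_pneg:
  assumes w: "wiso_by E (short a b) u r s t"
  shows "wmap u r s t (pneg (short a b) P) = pneg E (wmap u r s t P)"
  using wiso_short_coeffs(2-4)[OF w] by (cases P) (auto simp: algebra_simps)

text \<open>The substitution is affine, so it takes a line of slope \<open>l\<close> to one of slope
  \<open>u * l + s\<close>, and it preserves opposite points. It therefore commutes with the chord
  and tangent construction.\<close>

lemma wmap_padd:
  assumes w: "wiso_by E (short a b) u r s t"
    and on: "on_curve (short a b) P" "on_curve (short a b) Q"
  shows "wmap u r s t (padd (short a b) P Q) = padd E (wmap u r s t P) (wmap u r s t Q)"
proof -
  have u: "u \<noteq> 0" by (rule wiso_short_coeffs(1)[OF w])
  note co = wiso_short_coeffs(2-6)[OF w]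
  have sum: "(u ^ 3 * y + u ^ 2 * s * x + t) + (u ^ 3 * y' + u ^ 2 * s * x + t) + a1 E * (u ^ 2 * x + r) + a3 E
      = u ^ 3 * (y + y')" for x y y' unfolding co by algebra
  show ?thesis
  proof (cases rule: padd_short_cases[OF on])
    case (3 x y y')
    then show ?thesis using sum[of y x y'] by simp
  next
    case (4 x y x' y' l)
    define X where "X = u ^ 2 * x + r"
    define Y where "Y = u ^ 3 * y + u ^ 2 * s * x + t"
    define X' where "X' = u ^ 2 * x' + r"
    define Y' where "Y' = u ^ 3 * y' + u ^ 2 * s * x' + t"
    have sl: "y - y' = l * (x - x')" "l * (y + y') = x ^ 2 + x * x' + x' ^ 2 + a"
      using 4(4) unfolding slope_def by auto
    have curve: "y ^ 2 = x ^ 3 + a * x + b" using on(1) 4(1) by simp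
    define lam where "lam = (if X \<noteq> X' then (Y' - Y) / (X' - X)
        else (3 * X ^ 2 + 2 * a2 E * X + a4 E - a1 E * Y) / (2 * Y + a1 E * X + a3 E))"
    define nu where "nu = (if X \<noteq> X' then (Y * X' - Y' * X) / (X' - X)
        else (- (X ^ 3) + a4 E * X + 2 * a6 E - a3 E * Y) / (2 * Y + a1 E * X + a3 E))"
    have ne: "\<not> (X = X' \<and> Y + Y' + a1 E * X' + a3 E = 0)"
    proof
      assume h: "X = X' \<and> Y + Y' + a1 E * X' + a3 E = 0"
      then have "x = x'" using u unfolding X_def X'_def by simp
      moreover from this h have "y + y' = 0" using sum[of y x y'] u unfolding X'_def Y_def Y'_def by simp
      ultimately show False using 4(3) by blast
    qed
    have P: "padd E (Aff X Y) (Aff X' Y') =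
        Aff (lam ^ 2 + a1 E * lam - a2 E - X - X') (- (lam + a1 E) * (lam ^ 2 + a1 E * lam - a2 E - X - X') - nu - a3 E)"
      using ne unfolding padd.simps lam_def nu_def Let_def by (simp only: if_False)
    have ln: "lam = u * l + s \<and> nu = Y - lam * X"
    proof (cases "x = x'")
      case True
      then have XX: "X = X'" unfolding X_def X'_def by simp
      have "(y - y') = 0" using sl(1) True by simp
      then have yy: "y' = y" by simp
      then have y0: "y \<noteq> 0" using 4(3) True by auto
      have den: "2 * Y + a1 E * X + a3 E = 2 * u ^ 3 * y"
        unfolding co X_def Y_def by algebra
      have d0: "2 * u ^ 3 * y \<noteq> 0" using u y0 by simp
      have tl: "2 * y * l = 3 * x ^ 2 + a" using sl(2) True yy by (simp add: algebra_simps power2_eq_square)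
      have "3 * X ^ 2 + 2 * a2 E * X + a4 E - a1 E * Y = (u * l + s) * (2 * u ^ 3 * y)"
        using tl unfolding co X_def Y_def by algebra
      then have lam: "lam = u * l + s" using XX d0 unfolding lam_def den by simp
      have "- (X ^ 3) + a4 E * X + 2 * a6 E - a3 E * Y = (Y - (u * l + s) * X) * (2 * u ^ 3 * y)"
        using tl curve unfolding co X_def Y_def by algebra
      then have "nu = Y - (u * l + s) * X" using XX d0 unfolding nu_def den by simp
      then show ?thesis using lam by simp
    next
      case False
      then have XX: "X \<noteq> X'" "X' - X \<noteq> 0" using u unfolding X_def X'_def by simp_all
      have "Y' - Y = (u * l + s) * (X' - X)"
        using sl(1) unfolding X_def X'_def Y_def Y'_def by algebra
      then have lam: "lam = u * l + s" using XX unfolding lam_def by simp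
      have "Y * X' - Y' * X = (Y - (u * l + s) * X) * (X' - X)"
        using sl(1) unfolding X_def X'_def Y_def Y'_def by algebra
      then have "nu = Y - (u * l + s) * X" using XX unfolding nu_def by simp
      then show ?thesis using lam by simp
    qed
    have e: "nu = Y - (u * l + s) * X" "lam = u * l + s" using ln by auto
    have x3: "lam ^ 2 + a1 E * lam - a2 E - X - X' = u ^ 2 * (l ^ 2 - x - x') + r"
      unfolding e co X_def X'_def by algebra
    have y3: "- (lam + a1 E) * (u ^ 2 * (l ^ 2 - x - x') + r) - nu - a3 E =
        u ^ 3 * (l * (x - (l ^ 2 - x - x')) - y) + u ^ 2 * s * (l ^ 2 - x - x') + t"
      unfolding e co X_def Y_def by algebra
    show ?thesis
      unfolding 4(5) unfolding 4(1,2) wmap.simps X_def[symmetric] Y_def[symmetric] X'_def[symmetric] Y'_def[symmetric]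
        P x3 y3 ..
  qed auto
qed

lemma on_curve_pmult_short: "on_curve (short a b) P \<Longrightarrow> on_curve (short a b) (pmult (short a b) n P)"
  by (induction n) (auto intro: on_curve_padd_short)

lemma wmap_pmult:
  assumes w: "wiso_by E (short a b) u r s t" and on: "on_curve (short a b) P"
  shows "wmap u r s t (pmult (short a b) n P) = pmult E n (wmap u r s t P)"
  by (induction n) (simp_all add: wmap_padd[OF w on on_curve_pmult_short[OF on]])

lemma wmap_zmult:
  assumes w: "wiso_by E (short a b) u r s t" and on: "on_curve (short a b) P"
  shows "wmap u r s t (zmult (short a b) k P) = zmult E k (wmap u r s t P)"
  unfolding zmult_def by (simp add: wmap_pmult[OF w on] wmap_pneg[OF w])

lemma on_curve_zmult_short: "on_curve (short a b) P \<Longrightarrow> on_curve (short a b) (zmult (short a b) k P)"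
  unfolding zmult_def by (simp add: on_curve_pmult_short on_curve_pneg_short)

section \<open>Comparison of ranks\<close>

context integral_curve
begin

lemma zmult_G: "on_curve E P \<Longrightarrow> zmult E k P = P [^]\<^bsub>G\<^esub> k"
  using nat_pow_closed[of P "nat (- k)"] unfolding zmult_def int_pow_def2
  by (auto simp: pmult_G inv_G simp del: pow_nat)

lemma foldr_padd_G:
  assumes "distinct js" "\<And>i. i \<in> set js \<Longrightarrow> on_curve E (g i)"
  shows "foldr (\<lambda>i acc. padd E (zmult E (c i) (g i)) acc) js Inf = finprod G (\<lambda>i. g i [^]\<^bsub>G\<^esub> c i) (set js)"
  using assms
proof (induction js)
  case (Cons i js)
  have "finprod G (\<lambda>i. g i [^]\<^bsub>G\<^esub> c i) (insert i (set js)) =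
      g i [^]\<^bsub>G\<^esub> c i \<otimes>\<^bsub>G\<^esub> finprod G (\<lambda>i. g i [^]\<^bsub>G\<^esub> c i) (set js)"
    using Cons.prems by (intro finprod_insert) (auto intro!: int_pow_closed simp del: carrier_G simp: carrier_G[THEN iffD2])
  then show ?case using Cons by (simp add: mult_G zmult_G)
qed (simp add: one_G)

text \<open>By \<open>mw_rank\<close> the images of the points on \<open>F\<close> satisfy a
  relation. As \<open>wmap\<close> is a homomorphism that sends only \<open>Inf\<close> to
  \<open>Inf\<close>, the same coefficients give a relation on the short curve.\<close>

lemma rank_le_of_mw_rank:
  assumes w: "wiso_by F E u r s t" and rk: "mw_rank F n"
  shows "rank_le n"
  unfolding rank_le_def
proof (intro allI impI)
  fix g assume g: "\<forall>i<Suc n. g i \<in> carrier G"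
  let ?\<psi> = "wmap u r s t"
  define Ps where "Ps = map (\<lambda>i. ?\<psi> (g i)) [0..<Suc n]"
  have Ps: "length Ps = Suc n" "\<And>i. i < Suc n \<Longrightarrow> Ps ! i = ?\<psi> (g i)"
    unfolding Ps_def by (simp_all del: upt_Suc)
  have gE: "on_curve E (g i)" if "i < Suc n" for i using g that by simp
  have "\<not> lin_indep F Ps" using rk Ps(1) unfolding mw_rank_def by blast
  moreover have "\<forall>P\<in>set Ps. on_curve F P"
    unfolding Ps_def using on_curve_wmap[OF w gE] by auto
  ultimately obtain c :: "nat \<Rightarrow> int" where
    c: "foldr (\<lambda>i acc. padd F (zmult F (c i) (Ps ! i)) acc) [0..<length Ps] Inf = Inf"
    and nz: "\<exists>i<length Ps. c i \<noteq> 0" unfolding lin_indep_def by blast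
  have hom: "foldr (\<lambda>i acc. padd F (zmult F (c i) (Ps ! i)) acc) js Inf =
      ?\<psi> (foldr (\<lambda>i acc. padd E (zmult E (c i) (g i)) acc) js Inf) \<and>
      on_curve E (foldr (\<lambda>i acc. padd E (zmult E (c i) (g i)) acc) js Inf)"
    if "set js \<subseteq> {..<Suc n}" for js
    using that
  proof (induction js)
    case (Cons i js)
    then have i: "i < Suc n" by simp
    show ?case
      using Cons on_curve_zmult_short[OF gE[OF i]] Ps(2)[OF i]
      by (simp add: wmap_padd[OF w] wmap_zmult[OF w gE[OF i]] on_curve_padd_short)
  qed simp
  have "foldr (\<lambda>i acc. padd E (zmult E (c i) (g i)) acc) [0..<Suc n] Inf = Inf"
  proof -
    have sub: "set [0..<Suc n] \<subseteq> {..<Suc n}" by auto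
    show ?thesis using hom[OF sub] c unfolding Ps(1) by simp
  qed
  then have "finprod G (\<lambda>i. g i [^]\<^bsub>G\<^esub> c i) (set [0..<Suc n]) = Inf"
    using foldr_padd_G[of "[0..<Suc n]" g c] gE by (simp del: upt_Suc)
  then have "finprod G (\<lambda>i. g i [^]\<^bsub>G\<^esub> c i) {..<Suc n} = \<one>\<^bsub>G\<^esub>"
    by (simp add: one_G atLeast0LessThan del: upt_Suc)
  then show "\<exists>c. (\<exists>i<Suc n. c i \<noteq> 0) \<and> finprod G (\<lambda>i. g i [^]\<^bsub>G\<^esub> (c i :: int)) {..<Suc n} = \<one>\<^bsub>G\<^esub>"
    using nz Ps(1) by auto
qed

end

section \<open>A short integral model of controlled size\<close>

lemma real_of_rat_abs_of_int: "real_of_rat \<bar>of_int p\<bar> = \<bar>real_of_int p\<bar>"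
  by (simp add: of_int_abs[symmetric] del: of_int_abs)

lemma rat_le_exp_hQ: "real_of_rat \<bar>q\<bar> \<le> exp (hQ q)"
proof -
  obtain p d :: int where d: "d > 0" "q = of_int p / of_int d" and h: "hQ q = ln (real_of_int (max \<bar>p\<bar> d))"
    by (rule rat_reduced)
  have "real_of_rat \<bar>q\<bar> = \<bar>real_of_int p\<bar> / real_of_int d"
    using d by (simp add: of_rat_divide of_int_abs[symmetric] del: of_int_abs)
  also have "\<dots> \<le> \<bar>real_of_int p\<bar>" using d(1) by (simp add: divide_le_eq mult_le_cancel_left1)
  also have "\<dots> \<le> real_of_int (max \<bar>p\<bar> d)" by linarith
  also have "\<dots> = exp (hQ q)" unfolding h using d(1) by simp
  finally show ?thesis .
qed

text \<open>On a model of minimal discriminant, \<open>c4 ^ 3 = j * disc\<close> and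
  \<open>c6 ^ 2 = c4 ^ 3 - 1728 * disc\<close> bound \<open>c4\<close> and \<open>c6\<close> by
  constants times \<open>exp h\<close>, and the short model has the coefficients
  \<open>- 27 * c4\<close> and \<open>- 54 * c6\<close>. The invariants in the conclusion are those
  of the short curve, to which Lang's conjecture is applied.\<close>

lemma short_model:
  assumes "elliptic F"
  obtains a b :: int and u r s t :: rat where "integral_curve a b"
    "wiso_by F (short (of_int a) (of_int b)) u r s t"
    "integral_curve.cst a b \<le> max (hQ (j_inv (short (of_int a) (of_int b))))
       (ln (real (min_disc_abs (short (of_int a) (of_int b))))) + 2268"
proof -
  obtain E' where E': "wiso F E'" "integral E'" and n: "of_nat (min_disc_abs F) = \<bar>disc E'\<bar>"
    using min_disc_abs_witness by blast
  obtain u r s t where w: "wiso_by F E' u r s t" using E'(1) unfolding wiso_iff by blast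
  have u: "u \<noteq> 0" using w unfolding wiso_by_def by simp
  have D0: "disc E' \<noteq> 0" using wiso_disc[OF w] assms u unfolding elliptic_def by auto
  have int: "b2 E' \<in> \<int>" "b4 E' \<in> \<int>" "b6 E' \<in> \<int>"
    using E'(2) unfolding integral_def b2_def b4_def b6_def by simp_all
  then have "c4 E' \<in> \<int>" "c6 E' \<in> \<int>" unfolding c4_def c6_def by simp_all
  then obtain p q where p: "c4 E' = of_int p" and q: "c6 E' = of_int q" by (auto elim!: Ints_cases)
  define a where "a = - 27 * p"
  define b where "b = - 54 * q"
  define S where "S = short (of_int a) (of_int b)"
  have S: "S = short (- 27 * c4 E') (- 54 * c6 E')" unfolding S_def a_def b_def p q by simp
  have dS: "disc S = 6 ^ 12 * disc E'"
    using wiso_disc[OF wiso_short[of E']] unfolding S[symmetric] by (simp add: field_simps)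
  have "disc S = of_int (- 16 * (4 * a ^ 3 + 27 * b ^ 2))" unfolding S_def discriminant_short by simp
  then have "4 * a ^ 3 + 27 * b ^ 2 \<noteq> 0" using dS D0 by (metis mult_eq_0_iff of_int_0 power_not_zero zero_neq_numeral)
  then interpret integral_curve a b by unfold_locales
  have w': "wiso_by F S (u * (1 / 6)) (u ^ 2 * (- b2 E' / 12) + r) (u * (- a1 E' / 2) + s)
     (u ^ 3 * (- (a3 E' - b2 E' / 12 * a1 E') / 2) + u ^ 2 * s * (- b2 E' / 12) + t)"
    unfolding S by (rule wiso_by_trans[OF w wiso_short])
  define h where "h = max (hQ (j_inv S)) (ln (real (min_disc_abs S)))"
  have j: "j_inv S = c4 E' ^ 3 / disc E'"
  proof -
    have "c4 S = 6 ^ 4 * c4 E'" unfolding S c4_def[of "short _ _"] b2_def[of "short _ _"] b4_def[of "short _ _"] by simp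
    then show ?thesis unfolding j_inv_def dS by (simp add: power_mult_distrib)
  qed
  have h0: "0 \<le> h" using hQ_nonneg[of "j_inv S"] unfolding h_def by simp
  \<comment> \<open>By transitivity every integral model of \<open>S\<close> is also one of
    \<open>F\<close>.\<close>
  have "min_disc_abs F \<le> min_disc_abs S"
  proof -
    obtain E'' where "wiso S E''" "integral E''" "of_nat (min_disc_abs S) = \<bar>disc E''\<bar>"
      using min_disc_abs_witness by blast
    moreover have "wiso F S" using w' unfolding wiso_iff by blast
    ultimately show ?thesis using wiso_trans min_disc_abs_le by blast
  qed
  moreover have n1: "min_disc_abs F > 0" using n D0 by (cases "min_disc_abs F = 0") auto
  ultimately have "ln (real (min_disc_abs F)) \<le> h" unfolding h_def by (simp add: le_max_iff_disj)
  then have "exp (ln (real (min_disc_abs F))) \<le> exp h" by simp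
  then have nexp: "real (min_disc_abs F) \<le> exp h" using n1 by simp
  have dr: "real_of_rat \<bar>disc E'\<bar> = real (min_disc_abs F)" unfolding n[symmetric] by simp
  have e1: "exp h \<ge> 1" using h0 by simp
  have p3: "\<bar>real_of_int p\<bar> ^ 3 \<le> exp h ^ 2"
  proof -
    have "c4 E' ^ 3 = j_inv S * disc E'" unfolding j using D0 by simp
    then have "real_of_rat \<bar>c4 E' ^ 3\<bar> = real_of_rat \<bar>j_inv S\<bar> * real_of_rat \<bar>disc E'\<bar>"
      by (simp add: abs_mult of_rat_mult)
    also have "\<dots> \<le> exp h * exp h"
    proof (intro mult_mono)
      have "real_of_rat \<bar>j_inv S\<bar> \<le> exp (hQ (j_inv S))" by (rule rat_le_exp_hQ)
      also have "\<dots> \<le> exp h" unfolding h_def by simp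
      finally show "real_of_rat \<bar>j_inv S\<bar> \<le> exp h" .
    qed (use dr nexp in auto)
    finally show ?thesis unfolding p
      by (simp add: power2_eq_square power_abs of_rat_power real_of_rat_abs_of_int)
  qed
  have pe: "\<bar>real_of_int p\<bar> \<le> exp h"
  proof (rule ccontr)
    assume "\<not> ?thesis"
    then have "exp h ^ 3 < \<bar>real_of_int p\<bar> ^ 3" by (intro power_strict_mono) auto
    moreover have "exp h ^ 2 \<le> exp h ^ 3" using e1 by (intro power_increasing) auto
    ultimately show False using p3 by linarith
  qed
  \<comment> \<open>\<open>42 ^ 2 = 1764\<close> exceeds \<open>1 + 1728\<close>.\<close>
  have qe: "\<bar>real_of_int q\<bar> \<le> 42 * exp h"
  proof -
    have "\<bar>c6 E' ^ 2\<bar> \<le> \<bar>c4 E' ^ 3\<bar> + 1728 * \<bar>disc E'\<bar>" unfolding c4_c6_disc by simp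
    then have "real_of_rat \<bar>c6 E' ^ 2\<bar> \<le> real_of_rat (\<bar>c4 E' ^ 3\<bar> + 1728 * \<bar>disc E'\<bar>)"
      by (simp only: of_rat_less_eq)
    then have "\<bar>real_of_int q\<bar> ^ 2 \<le> \<bar>real_of_int p\<bar> ^ 3 + 1728 * real (min_disc_abs F)"
      unfolding p q n[symmetric] by (simp add: of_rat_add of_rat_mult of_rat_power power_abs real_of_rat_abs_of_int)
    also have "\<dots> \<le> exp h ^ 2 + 1728 * exp h ^ 2"
    proof -
      have "exp h \<le> exp h ^ 2" using e1 by (simp add: power2_eq_square)
      then show ?thesis using p3 nexp by linarith
    qed
    also have "\<dots> \<le> (42 * exp h) ^ 2" by (simp add: power_mult_distrib)
    finally show ?thesis by (rule power2_le_imp_le) simp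
  qed
  \<comment> \<open>\<open>2268 = 54 * 42\<close>, from the coefficient \<open>- 54 * c6\<close>,
    which has the larger bound.\<close>
  have "real_of_int K \<le> 2268 * exp h"
  proof -
    have "real_of_int \<bar>a\<bar> \<le> 2268 * exp h" "real_of_int \<bar>b\<bar> \<le> 2268 * exp h"
      using pe qe unfolding a_def b_def by (simp_all add: abs_mult)
    then show ?thesis using e1 unfolding K_def by linarith
  qed
  then have "ln (real_of_int K) \<le> ln (2268 * exp h)" using K(1) by (intro ln_mono) auto
  also have "\<dots> = ln 2268 + h" by (simp add: ln_mult)
  also have "ln 2268 \<le> (2267 :: real)" using ln_le_minus_one[of "2268::real"] by simp
  finally have "cst \<le> h + 2268" unfolding cst_def by simp
  then show thesis using that[OF integral_curve_axioms] w' unfolding h_def S_def by blast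
qed

theorem theorem1p5:
  assumes lang: "\<exists>cL>0. \<forall>E P. elliptic E \<longrightarrow> on_curve E P \<longrightarrow> \<not> torsion E P \<longrightarrow>
            canon_height E P \<ge> cL * max (hQ (j_inv E)) (ln (real (min_disc_abs E)))"
  shows "\<exists>A::real. \<exists>C::real. A > 1 \<and> C > 0 \<and>
           (\<forall>E r ps. elliptic E \<longrightarrow> mw_rank E r \<longrightarrow> x_arith_prog E ps \<longrightarrow>
              real (length ps) \<le> C * A ^ r)"
proof -
  obtain c where c: "c > 0" and lang: "\<And>E P. elliptic E \<Longrightarrow> on_curve E P \<Longrightarrow> \<not> torsion E P \<Longrightarrow>
      canon_height E P \<ge> c * max (hQ (j_inv E)) (ln (real (min_disc_abs E)))"
    using lang by blast
  \<comment> \<open>\<open>k\<close> depends only on Lang's constant and \<open>m\<close> only on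
    the 2268 of \<open>short_model\<close>, so both are absolute.\<close>
  obtain k where k: "max 8208 (26804224 / c + 16) < 4 ^ k"
    using real_arch_pow[of 4 "max 8208 (26804224 / c + 16)"] by auto
  obtain m :: nat where m: "max 11 (208008 * 2268 / ln 2) < real m"
    using reals_Archimedean2 by blast
  have m': "m \<ge> 11" "m * ln 2 \<ge> 208008 * 2268" using m by (auto simp: field_simps)
  have k0: "k > 0" using k by (cases k) auto
  define e where "e = 2 * m + 1"
  \<comment> \<open>The bound \<open>4 * (96 * 2 ^ (r * k) + 1) ^ e\<close> is at most
    \<open>4 * (97 * 2 ^ (r * k)) ^ e\<close>, which is \<open>C * A ^ r\<close>.\<close>
  define A :: real where "A = 2 ^ (k * e)"
  define C :: real where "C = 4 * 97 ^ e"
  have A: "A > 1" unfolding A_def using k0 unfolding e_def by (intro one_less_power) auto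
  have C: "C > 0" unfolding C_def by simp
  have main: "real (length ps) \<le> C * A ^ r"
    if E: "elliptic E" and rk: "mw_rank E r" and ps: "x_arith_prog E ps" for E r ps
  \<comment> \<open>With at most one term the common difference may be 0, so that the index is no
    coordinate on the curve; the bound is then trivial.\<close>
  proof (cases "length ps \<le> 1")
    case True
    have "1 \<le> C" unfolding C_def using one_le_power[of "97::real" e] by linarith
    moreover have "1 \<le> A ^ r" using A by simp
    ultimately have "1 * 1 \<le> C * A ^ r" by (intro mult_mono) auto
    then show ?thesis using True by linarith
  next
    case False
    obtain a b :: int and u v s t :: rat where ic: "integral_curve a b"
      and w: "wiso_by E (short (of_int a) (of_int b)) u v s t"
      and cst: "integral_curve.cst a b \<le> max (hQ (j_inv (short (of_int a) (of_int b))))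
       (ln (real (min_disc_abs (short (of_int a) (of_int b))))) + 2268"
      using short_model[OF E] by blast
    have u: "u \<noteq> 0" using w unfolding wiso_by_def by simp
    obtain x0 d where x: "\<And>i. i < length ps \<Longrightarrow> fst (ps ! i) = x0 + of_nat i * d"
      using ps unfolding x_arith_prog_def by blast
    have "distinct (map fst ps)" using ps unfolding x_arith_prog_def by blast
    moreover have len: "0 < length ps" "1 < length ps" using False by auto
    ultimately have "fst (ps ! 0) \<noteq> fst (ps ! 1)" using nth_eq_iff_index_eq[of "map fst ps" 0 1] by simp
    then have "d \<noteq> 0" using x[OF len(1)] x[OF len(2)] by auto
    then interpret shifted_curve a b "(x0 - v) / u ^ 2" "d / u ^ 2"
      using ic u by (intro shifted_curve.intro shifted_curve_axioms.intro) auto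
    have "length ps < 4 * (96 * 2 ^ (r * k) + 1) ^ (2 * m + 1)"
    proof (rule progression_length_less[OF rank_le_of_mw_rank[OF w rk] c _ lang[OF elliptic_E] cst _ _ m'])
      show "on_curve (short (of_int a) (of_int b)) (Aff ((x0 - v) / u ^ 2 + d / u ^ 2 * of_nat i)
          ((snd (ps ! i) - s * (fst (ps ! i) - v) - t) / u ^ 3))" if i: "i < length ps" for i
      proof -
        have "ps ! i \<in> set ps" using i by simp
        then have "on_curve E (Aff (fst (ps ! i)) (snd (ps ! i)))"
          using ps unfolding x_arith_prog_def by (auto simp: case_prod_beta)
        then have "on_curve (short (of_int a) (of_int b)) (Aff ((fst (ps ! i) - v) / u ^ 2)
          ((snd (ps ! i) - s * (fst (ps ! i) - v) - t) / u ^ 3))" by (rule on_curve_short_of_wiso[OF w])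
        moreover have "(fst (ps ! i) - v) / u ^ 2 = (x0 - v) / u ^ 2 + d / u ^ 2 * of_nat i"
          unfolding x[OF i] using u by (simp add: field_simps)
        ultimately show ?thesis by simp
      qed
    qed (use k in auto)
    also have "\<dots> \<le> 4 * (97 * 2 ^ (r * k)) ^ e"
      unfolding e_def using one_le_power[of "2::nat" "r * k"] by (intro mult_left_mono power_mono) auto
    finally have "real (length ps) \<le> real (4 * (97 * 2 ^ (r * k)) ^ e)" by (simp only: of_nat_le_iff less_imp_le)
    also have "\<dots> = C * A ^ r"
      unfolding C_def A_def by (simp add: power_mult_distrib power_mult[symmetric] mult.commute mult.left_commute)
    finally show ?thesis .
  qed
  show ?thesis using A C main by blast
qed

end
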